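(* Let $k\ge3$ be a constant. If FZ$k$C (respectively #FZ$k$C) can be solved in $T(n)$ time, then F$f$$k$C (respectively #F$f$$k$C) can be solved in $\tilde{O}(T(n)+n^2)$ time, for every function $f:(\{0,1\}^b)^{\binom{k}{2}}\to\{0,1\}$.
   Context: $g=o(\lg n/\lg\lg n)$, $b=o(\lg n)$. A $(g,b)$-factored vector $v$ is a $g$-tuple of sets $v[i]\subseteq\{0,1\}^b$. Let $\ell=\binom{k}{2}$. For $f:(\{0,1\}^b)^\ell\to\{0,1\}$, #F$f$$k$C: given an $n$-node graph $G=(V,E)$ whose edges $(x,y)$ are labeled by $(g,b)$-factored vectors $e_{x,y}$, output $\sum_{v_1,\dots,v_k\in V}\mathrm{isClique}(v_1,\dots,v_k)\prod_{i=1}^g\sum_{w_1\in e_{v_1,v_2}[i],\dots,w_\ell\in e_{v_{k-1},v_k}[i]}f(w_1,\dots,w_\ell)$; F$f$$k$C asks whether this is positive. (#)FZ$k$C is the case where $f=1$ iff $w_1+\cdots+w_\ell=0$ as $b$-bit numbers (possibly with $b$ enlarged by a constant factor). *)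

theory Defs
  imports Complex_Main "HOL-Library.Landau_Symbols"
begin

section \<open>Word RAM\<close>

text \<open>
  A deterministic word RAM with \<open>w\<close>-bit words, programmed in a structured language.
  A state has registers and arrays of words; a program names registers and arrays by
  constants, hence uses finitely many of each.  Array indices are words.  Every elementary
  operation and every test costs one time unit.
\<close>

record state =
  reg :: "nat \<Rightarrow> nat"
  mem :: "nat \<Rightarrow> nat \<Rightarrow> nat"

datatype binop = Add | Sub | Mul | Div | Mod | And | Or | Xor | Shl | Shr | Lt | Eq

datatype com =
    Skip
  | Const nat nat
  | Op binop nat nat nat
  | Load nat nat nat
  | Store nat nat nat
  | Seq com com
  | If nat com com
  | While nat com

fun binop_val :: "nat \<Rightarrow> binop \<Rightarrow> nat \<Rightarrow> nat \<Rightarrow> nat" where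
  "binop_val w Add x y = (x + y) mod 2 ^ w"
| "binop_val w Sub x y = (x + 2 ^ w - y) mod 2 ^ w"
| "binop_val w Mul x y = (x * y) mod 2 ^ w"
| "binop_val w Div x y = x div y"
| "binop_val w Mod x y = x mod y"
| "binop_val w And x y = Bit_Operations.and x y"
| "binop_val w Or x y = Bit_Operations.or x y"
| "binop_val w Xor x y = Bit_Operations.xor x y"
| "binop_val w Shl x y = push_bit y x mod 2 ^ w"
| "binop_val w Shr x y = drop_bit y x"
| "binop_val w Lt x y = of_bool (x < y) mod 2 ^ w"
| "binop_val w Eq x y = of_bool (x = y) mod 2 ^ w"

text \<open>\<open>exec w c s t s'\<close>: with word size \<open>w\<close>, program \<open>c\<close> started in \<open>s\<close> halts in \<open>s'\<close> after \<open>t\<close> steps.\<close>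

inductive exec :: "nat \<Rightarrow> com \<Rightarrow> state \<Rightarrow> nat \<Rightarrow> state \<Rightarrow> bool" for w :: nat where
  Skip: "exec w Skip s 1 s"
| Const: "exec w (Const r c) s 1 (s\<lparr>reg := (reg s)(r := c mod 2 ^ w)\<rparr>)"
| Op: "exec w (Op f r p q) s 1 (s\<lparr>reg := (reg s)(r := binop_val w f (reg s p) (reg s q))\<rparr>)"
| Load: "exec w (Load r A p) s 1 (s\<lparr>reg := (reg s)(r := mem s A (reg s p))\<rparr>)"
| Store: "exec w (Store A p q) s 1 (s\<lparr>mem := (mem s)(A := (mem s A)(reg s p := reg s q))\<rparr>)"
| Seq: "exec w c1 s t1 s' \<Longrightarrow> exec w c2 s' t2 s'' \<Longrightarrow> exec w (Seq c1 c2) s (t1 + t2) s''"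
| IfTrue: "reg s r \<noteq> 0 \<Longrightarrow> exec w c1 s t s' \<Longrightarrow> exec w (If r c1 c2) s (1 + t) s'"
| IfFalse: "reg s r = 0 \<Longrightarrow> exec w c2 s t s' \<Longrightarrow> exec w (If r c1 c2) s (1 + t) s'"
| WhileFalse: "reg s r = 0 \<Longrightarrow> exec w (While r c) s 1 s"
| WhileTrue: "reg s r \<noteq> 0 \<Longrightarrow> exec w c s t1 s' \<Longrightarrow> exec w (While r c) s' t2 s''
    \<Longrightarrow> exec w (While r c) s (1 + t1 + t2) s''"

text \<open>
  The input occupies an initial segment of array 0.  All other cells and the registers hold
  arbitrary words: storage is not assumed to be initialised.
\<close>

definition input_state :: "nat \<Rightarrow> nat list \<Rightarrow> state \<Rightarrow> bool" where
  "input_state w xs s \<longleftrightarrow>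
     (\<forall>r. reg s r < 2 ^ w) \<and> (\<forall>A i. mem s A i < 2 ^ w) \<and>
     (\<forall>i<length xs. mem s 0 i = xs ! i)"

text \<open>
  The output is a natural number, written in base \<open>2 ^ w\<close> with the least significant digit
  first: register 0 holds the number of digits, array 1 the digits.  (The counts considered
  below may need more than constantly many words.)
\<close>

definition output_value :: "nat \<Rightarrow> state \<Rightarrow> nat" where
  "output_value w s = (\<Sum>i<reg s 0. mem s 1 i * 2 ^ (w * i))"

text \<open>A problem assigns to each size parameter \<open>n\<close> its set of pairs (encoded instance, answer).\<close>

type_synonym problem = "nat \<Rightarrow> (nat list \<times> nat) set"

text \<open>
  One program has to work for all word sizes \<open>w \<ge> d * log 2 (n + 2)\<close>, for some constant \<open>d\<close>.
\<close>

definition solvable_in_time :: "problem \<Rightarrow> (nat \<Rightarrow> nat) \<Rightarrow> bool" where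
  "solvable_in_time \<Pi> T \<longleftrightarrow>
     (\<exists>c d. \<forall>n w xs a s.
        (xs, a) \<in> \<Pi> n \<longrightarrow> real d * log 2 (real n + 2) \<le> real w \<longrightarrow> input_state w xs s \<longrightarrow>
        (\<exists>t s'. exec w c s t s' \<and> t \<le> T n \<and> output_value w s' = a))"

definition soft_O :: "(nat \<Rightarrow> real) \<Rightarrow> (nat \<Rightarrow> real) set" where
  "soft_O F = {h. \<exists>m::nat. h \<in> O(\<lambda>n. F n * ln (real n) ^ m)}"


section \<open>Factored clique problems\<close>

text \<open>A bit string in \<open>{0,1}^b\<close> is identified with the number below \<open>2 ^ b\<close> it denotes in binary.\<close>

definition factored_vector :: "nat \<Rightarrow> nat \<Rightarrow> nat set list \<Rightarrow> bool" where
  "factored_vector g b v \<longleftrightarrow> length v = g \<and> (\<forall>S\<in>set v. S \<subseteq> {..<2 ^ b})"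

text \<open>Simple undirected graphs on the vertices \<open>0, \<dots>, n - 1\<close> with labelled edges.\<close>

definition factored_graph ::
  "nat \<Rightarrow> nat \<Rightarrow> nat \<Rightarrow> (nat \<Rightarrow> nat \<Rightarrow> bool) \<Rightarrow> (nat \<Rightarrow> nat \<Rightarrow> nat set list) \<Rightarrow> bool" where
  "factored_graph n g b E e \<longleftrightarrow>
     (\<forall>x y. E x y \<longrightarrow> x < n \<and> y < n \<and> x \<noteq> y \<and> E y x \<and>
        factored_vector g b (e x y) \<and> e x y = e y x)"

definition is_clique :: "(nat \<Rightarrow> nat \<Rightarrow> bool) \<Rightarrow> nat list \<Rightarrow> bool" where
  "is_clique E vs \<longleftrightarrow> (\<forall>p q. p < q \<and> q < length vs \<longrightarrow> E (vs ! p) (vs ! q))"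

text \<open>The position pairs \<open>(0,1), (0,2), \<dots>, (k-2,k-1)\<close>, in lexicographic order.\<close>

definition pairs :: "nat \<Rightarrow> (nat \<times> nat) list" where
  "pairs k = [(p, q). p \<leftarrow> [0..<k], q \<leftarrow> [Suc p..<k]]"

definition clique_count ::
  "nat \<Rightarrow> nat \<Rightarrow> nat \<Rightarrow> (nat list \<Rightarrow> bool) \<Rightarrow>
   (nat \<Rightarrow> nat \<Rightarrow> bool) \<Rightarrow> (nat \<Rightarrow> nat \<Rightarrow> nat set list) \<Rightarrow> nat" where
  "clique_count k n g f E e =
     (\<Sum>vs \<in> {vs. length vs = k \<and> set vs \<subseteq> {..<n}}.
        of_bool (is_clique E vs) *
        (\<Prod>i<g. \<Sum>ws \<in> listset (map (\<lambda>(p, q). e (vs ! p) (vs ! q) ! i) (pairs k)). of_bool (f ws)))"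

definition zero_sum :: "nat \<Rightarrow> nat list \<Rightarrow> bool" where
  "zero_sum b ws \<longleftrightarrow> sum_list ws mod 2 ^ b = 0"

text \<open>
  Instances are encoded by the parameters, the adjacency matrix and the characteristic vectors
  of the sets labelling the edges (all zero at non-edges), one bit per word.
\<close>

definition enc_graph ::
  "nat \<Rightarrow> nat \<Rightarrow> nat \<Rightarrow> (nat \<Rightarrow> nat \<Rightarrow> bool) \<Rightarrow> (nat \<Rightarrow> nat \<Rightarrow> nat set list) \<Rightarrow> nat list" where
  "enc_graph n g b E e =
     [n, g, b] @
     [of_bool (E x y). x \<leftarrow> [0..<n], y \<leftarrow> [0..<n]] @
     [of_bool (E x y \<and> u \<in> e x y ! i). x \<leftarrow> [0..<n], y \<leftarrow> [0..<n], i \<leftarrow> [0..<g], u \<leftarrow> [0..<2 ^ b]]"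

text \<open>
  Truth table of \<open>f\<close>; the tuple \<open>(w\<^sub>1, \<dots>, w\<^sub>l)\<close> has index \<open>w\<^sub>1 + w\<^sub>2 * 2 ^ b + w\<^sub>3 * 2 ^ (2 * b) + \<dots>\<close>.
\<close>

definition enc_fun :: "nat \<Rightarrow> nat \<Rightarrow> (nat list \<Rightarrow> bool) \<Rightarrow> nat list" where
  "enc_fun k b f = map (\<lambda>ws. of_bool (f ws)) (List.n_lists (k choose 2) [0..<2 ^ b])"

text \<open>
  The parameters \<open>g\<close> and \<open>b\<close>, and with \<open>b\<close> also the function \<open>f\<close>, depend on \<open>n\<close>.  As the family
  \<open>f\<close> is arbitrary, its member for the given \<open>n\<close> is made available to the algorithm as a table.
\<close>

definition count_FfkC :: "nat \<Rightarrow> (nat \<Rightarrow> nat) \<Rightarrow> (nat \<Rightarrow> nat) \<Rightarrow> (nat \<Rightarrow> nat list \<Rightarrow> bool) \<Rightarrow> problem" where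
  "count_FfkC k g b f n =
     {(enc_graph n (g n) (b n) E e @ enc_fun k (b n) (f n), clique_count k n (g n) (f n) E e) | E e.
        factored_graph n (g n) (b n) E e}"

definition FfkC :: "nat \<Rightarrow> (nat \<Rightarrow> nat) \<Rightarrow> (nat \<Rightarrow> nat) \<Rightarrow> (nat \<Rightarrow> nat list \<Rightarrow> bool) \<Rightarrow> problem" where
  "FfkC k g b f n =
     {(enc_graph n (g n) (b n) E e @ enc_fun k (b n) (f n), of_bool (clique_count k n (g n) (f n) E e > 0)) | E e.
        factored_graph n (g n) (b n) E e}"

definition count_FZkC :: "nat \<Rightarrow> (nat \<Rightarrow> nat) \<Rightarrow> (nat \<Rightarrow> nat) \<Rightarrow> problem" where
  "count_FZkC k g b n =
     {(enc_graph n (g n) (b n) E e, clique_count k n (g n) (zero_sum (b n)) E e) | E e.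
        factored_graph n (g n) (b n) E e}"

definition FZkC :: "nat \<Rightarrow> (nat \<Rightarrow> nat) \<Rightarrow> (nat \<Rightarrow> nat) \<Rightarrow> problem" where
  "FZkC k g b n =
     {(enc_graph n (g n) (b n) E e, of_bool (clique_count k n (g n) (zero_sum (b n)) E e > 0)) | E e.
        factored_graph n (g n) (b n) E e}"

end

theory Submission
  imports Defs "HOL-Combinatorics.Permutations"
begin

text \<open>
  Take \<open>c = k choose 2\<close>, the number of pairs of positions.  A tuple \<open>(w\<^sub>1, \<dots>, w\<^sub>c)\<close> satisfying \<open>f\<close>, read as a
  number with \<open>c\<close> digits of \<open>b\<close> bits, is guessed by the label of the first pair; each other pair
  contributes the negative of its own digit, so that the sum vanishes exactly if the guess agrees with all
  labels.  As this treats the positions differently, the new graph has to be \<open>k\<close>-partite.  To stay within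
  \<open>n\<close> vertices, cut the vertex set into at most \<open>2 * k\<close> blocks of size \<open>n div k\<close> and make one instance for
  every choice of \<open>k\<close> blocks.  A clique of such an instance meets every part once, in any order, and is
  therefore counted \<open>k!\<close> times; the answers are added up and divided by \<open>k!\<close>.

  The new instances have about \<open>n\<^sup>2 * g * 2 ^ (c * b)\<close> words, which is more than \<open>n\<^sup>2\<close> up to logarithmic factors.
  However, an adversary argument shows that the solver must inspect about \<open>n\<^sup>2 * 2 ^ (c * b)\<close> words of its input if
  \<open>g > 0\<close>, so writing the instances down costs at most \<open>O(g) * T n\<close>, and \<open>g\<close> is at most logarithmic.
\<close>

section \<open>Executions and a compiler for expressions\<close>

text \<open>\<open>T\<close> is measured in \<open>n\<close> and not in the length of the instance,
  so nothing in the hypothesis says that the solver has time to read its input. That it must is a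
  statement about an unknown program, valid because the program has to be correct on every instance.
  The argument forces one cell for each unordered pair of vertices and each element, but not one for
  each of the \<open>g\<close> coordinates, which in the adversary's instances all repeat the same
  set; this is where the factor \<open>g\<close> in the overhead comes from. For
  \<open>g = 0\<close> the label part of the encoding is empty and there is nothing to charge.

  The second obstacle is that a count may take about \<open>g + k\<close> words, with
  \<open>g\<close> growing. Adding the answers and dividing by \<open>k!\<close> is therefore done
  digit by digit in base \<open>2 ^ w\<close>. The decision version involves no division: a sum of
  at most \<open>(2 * k) ^ k\<close> bits fits into one word, and only its vanishing matters.

  The choices of blocks are constantly many, so the program carries a copy of its main code for each
  of them.\<close>

inductive_cases exec_SkipE: "exec w Skip s t s'"
inductive_cases exec_ConstE: "exec w (Const r c) s t s'"
inductive_cases exec_OpE: "exec w (Op f r p q) s t s'"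
inductive_cases exec_LoadE: "exec w (Load r A p) s t s'"
inductive_cases exec_StoreE: "exec w (Store A p q) s t s'"
inductive_cases exec_SeqE: "exec w (Seq c1 c2) s t s'"
inductive_cases exec_IfE: "exec w (If r c1 c2) s t s'"
inductive_cases exec_WhileE: "exec w (While r c) s t s'"

text \<open>Serves the adversary argument: a run carried over to a modified input has to be the very
  run for which the solver promises the right answer there.\<close>

lemma exec_deterministic:
  assumes "exec w c s t s1" "exec w c s u s2"
  shows "t = u \<and> s1 = s2"
  using assms
proof (induction arbitrary: u s2 rule: exec.induct)
  case (Seq c1 s t1 s' c2 t2 s'')
  from Seq.prems obtain u1 r u2 where u: "exec w c1 s u1 r" "exec w c2 r u2 s2" "u = u1 + u2"
    by (elim exec_SeqE) blast
  from Seq.IH(1)[OF u(1)] have 1: "t1 = u1" "r = s'" by auto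
  from Seq.IH(2)[OF u(2)[unfolded 1]] 1 u(3) show ?case by simp
next
  case (IfTrue s r c1 t s' c2)
  from IfTrue.prems IfTrue.hyps(1) obtain u1 where u: "exec w c1 s u1 s2" "u = 1 + u1"
    by (elim exec_IfE) auto
  from IfTrue.IH[OF u(1)] u(2) show ?case by simp
next
  case (IfFalse s r c2 t s' c1)
  from IfFalse.prems IfFalse.hyps(1) obtain u1 where u: "exec w c2 s u1 s2" "u = 1 + u1"
    by (elim exec_IfE) auto
  from IfFalse.IH[OF u(1)] u(2) show ?case by simp
next
  case (WhileTrue s r c t1 s' t2 s'')
  from WhileTrue.prems obtain u1 r' u2
    where u: "exec w c s u1 r'" "exec w (While r c) r' u2 s2" "u = 1 + u1 + u2"
    by (rule exec_WhileE) (use WhileTrue.hyps in auto)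
  from WhileTrue.IH(1)[OF u(1)] have 1: "t1 = u1" "r' = s'" by auto
  from WhileTrue.IH(2)[OF u(2)[unfolded 1]] 1 u(3) show ?case by simp
next
  case (WhileFalse s r c)
  from WhileFalse.prems show ?case by (rule exec_WhileE) (use WhileFalse.hyps in auto)
qed (auto elim: exec_SkipE exec_ConstE exec_OpE exec_LoadE exec_StoreE)

section \<open>Word-sized states, frame properties and untouched cells\<close>

definition words :: "nat \<Rightarrow> state \<Rightarrow> bool" where
  "words w s \<longleftrightarrow> (\<forall>r. reg s r < 2 ^ w) \<and> (\<forall>A i. mem s A i < 2 ^ w)"

lemma binop_val_less:
  assumes "x < 2 ^ w" "y < 2 ^ w"
  shows "binop_val w f x y < 2 ^ w"
proof -
  have x: "take_bit w x = x" and y: "take_bit w y = y"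
    using assms by (simp_all add: take_bit_nat_eq_self)
  have "take_bit w (and x y) = and x y" "take_bit w (or x y) = or x y" "take_bit w (xor x y) = xor x y"
    using x y by simp_all
  then have "and x y < 2 ^ w" "or x y < 2 ^ w" "xor x y < 2 ^ w"
    by (metis take_bit_nat_less_exp)+
  moreover have "x div y < 2 ^ w" "x mod y < 2 ^ w" "drop_bit y x < 2 ^ w"
    using assms(1) by (auto simp: drop_bit_eq_div intro: le_less_trans[OF div_le_dividend] le_less_trans[OF mod_less_eq_dividend])
  ultimately show ?thesis by (cases f) auto
qed

text \<open>The solver is called on memory left behind by earlier rounds, and its guarantee covers
  only states in which every cell holds a word. This invariant supplies that condition at each
  call.\<close>

lemma exec_words:
  assumes "exec w c s t s'" "words w s"
  shows "words w s'"
  using assms by (induction) (auto simp: words_def binop_val_less)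

fun used_regs :: "com \<Rightarrow> nat set" where
  "used_regs Skip = {}"
| "used_regs (Const r c) = {r}"
| "used_regs (Op f r p q) = {r, p, q}"
| "used_regs (Load r A p) = {r, p}"
| "used_regs (Store A p q) = {p, q}"
| "used_regs (Seq c1 c2) = used_regs c1 \<union> used_regs c2"
| "used_regs (If r c1 c2) = {r} \<union> used_regs c1 \<union> used_regs c2"
| "used_regs (While r c) = {r} \<union> used_regs c"

fun used_arrays :: "com \<Rightarrow> nat set" where
  "used_arrays (Load r A p) = {A}"
| "used_arrays (Store A p q) = {A}"
| "used_arrays (Seq c1 c2) = used_arrays c1 \<union> used_arrays c2"
| "used_arrays (If r c1 c2) = used_arrays c1 \<union> used_arrays c2"
| "used_arrays (While r c) = used_arrays c"
| "used_arrays _ = {}"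

lemma finite_used_regs: "finite (used_regs c)"
  by (induction c) auto

lemma finite_used_arrays: "finite (used_arrays c)"
  by (induction c) auto

text \<open>A program mentions finitely many names, so fresh registers and arrays exist; whatever
  the reduction keeps there survives a call of the solver.\<close>

lemma exec_frame:
  assumes "exec w c s t s'"
  shows "r \<notin> used_regs c \<Longrightarrow> reg s' r = reg s r"
    and "A \<notin> used_arrays c \<Longrightarrow> mem s' A = mem s A"
  using assms by (induction) auto

definition same_off :: "nat set \<Rightarrow> state \<Rightarrow> state \<Rightarrow> bool" where
  "same_off D s s' \<longleftrightarrow> reg s' = reg s \<and> (\<forall>A i. A \<noteq> 0 \<or> i \<notin> D \<longrightarrow> mem s' A i = mem s A i)"

text \<open>The set \<open>R\<close> collects the cells of array 0 that the run reads or writes; the remaining cells can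
  be changed without affecting it.\<close>

lemma exec_touched_cells:
  assumes "exec w c s t s'"
  shows "\<exists>R. finite R \<and> card R \<le> t \<and>
    (\<forall>D s1. D \<inter> R = {} \<longrightarrow> same_off D s s1 \<longrightarrow> (\<exists>s1'. exec w c s1 t s1' \<and> same_off D s' s1'))"
    (is "\<exists>R. ?P c s t s' R")
  using assms
proof (induction rule: exec.induct)
  case (Skip s)
  show ?case by (rule exI[of _ "{}"]) (metis card.empty exec.Skip finite.emptyI zero_le)
next
  case (Const r c s)
  have "\<exists>s1'. exec w (Const r c) s1 1 s1' \<and> same_off D (s\<lparr>reg := (reg s)(r := c mod 2 ^ w)\<rparr>) s1'"
    if "same_off D s s1" for D s1
    using that exec.Const[of w r c s1] by (intro exI conjI) (auto simp: same_off_def)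
  then show ?case by (intro exI[of _ "{}"]) auto
next
  case (Op f r p q s)
  have "\<exists>s1'. exec w (Op f r p q) s1 1 s1' \<and>
      same_off D (s\<lparr>reg := (reg s)(r := binop_val w f (reg s p) (reg s q))\<rparr>) s1'"
    if "same_off D s s1" for D s1
    using that exec.Op[of w f r p q s1] by (intro exI conjI) (auto simp: same_off_def)
  then show ?case by (intro exI[of _ "{}"]) auto
next
  case (Load r A p s)
  have "\<exists>s1'. exec w (Load r A p) s1 1 s1' \<and>
      same_off D (s\<lparr>reg := (reg s)(r := mem s A (reg s p))\<rparr>) s1'"
    if "same_off D s s1" "D \<inter> {reg s p} = {}" for D s1
    by (intro exI conjI, rule exec.Load[of w r A p s1]) (use that in \<open>auto simp: same_off_def\<close>)
  \<comment> \<open>The index is recorded whatever array \<open>A\<close> is, which can only enlarge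
    \<open>R\<close>.\<close>
  then show ?case by (intro exI[of _ "{reg s p}"]) simp
next
  case (Store A p q s)
  have "\<exists>s1'. exec w (Store A p q) s1 1 s1' \<and>
      same_off D (s\<lparr>mem := (mem s)(A := (mem s A)(reg s p := reg s q))\<rparr>) s1'"
    if "same_off D s s1" "D \<inter> {reg s p} = {}" for D s1
    by (intro exI conjI, rule exec.Store[of w A p q s1]) (use that in \<open>auto simp: same_off_def\<close>)
  then show ?case by (intro exI[of _ "{reg s p}"]) simp
next
  case (Seq c1 s t1 s' c2 t2 s'')
  then obtain R1 R2 where R1: "?P c1 s t1 s' R1" and R2: "?P c2 s' t2 s'' R2" by blast
  have "card (R1 \<union> R2) \<le> t1 + t2"
    using card_Un_le[of R1 R2] R1 R2 by linarith
  moreover have "\<exists>s1'. exec w (Seq c1 c2) s1 (t1 + t2) s1' \<and> same_off D s'' s1'"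
    if D: "D \<inter> (R1 \<union> R2) = {}" "same_off D s s1" for D s1
  proof -
    from D have "D \<inter> R1 = {}" "D \<inter> R2 = {}" by auto
    with R1 R2 D(2) show ?thesis by (meson exec.Seq)
  qed
  ultimately show ?case using R1 R2 by (intro exI[of _ "R1 \<union> R2"]) blast
next
  case (IfTrue s r c1 t s' c2)
  then obtain R where R: "?P c1 s t s' R" by blast
  have "\<exists>s1'. exec w (If r c1 c2) s1 (1 + t) s1' \<and> same_off D s' s1'"
    if D: "D \<inter> R = {}" "same_off D s s1" for D s1
  proof -
    have "reg s1 r \<noteq> 0" using D(2) IfTrue.hyps by (simp add: same_off_def)
    with R D show ?thesis by (meson exec.IfTrue)
  qed
  then show ?case using R by (intro exI[of _ R]) auto
next
  case (IfFalse s r c2 t s' c1)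
  then obtain R where R: "?P c2 s t s' R" by blast
  have "\<exists>s1'. exec w (If r c1 c2) s1 (1 + t) s1' \<and> same_off D s' s1'"
    if D: "D \<inter> R = {}" "same_off D s s1" for D s1
  proof -
    have "reg s1 r = 0" using D(2) IfFalse.hyps by (simp add: same_off_def)
    with R D show ?thesis by (meson exec.IfFalse)
  qed
  then show ?case using R by (intro exI[of _ R]) auto
next
  case (WhileFalse s r c)
  have "\<exists>s1'. exec w (While r c) s1 1 s1' \<and> same_off D s s1'"
    if D: "same_off D s s1" for D s1
  proof -
    have "reg s1 r = 0" using D WhileFalse.hyps by (simp add: same_off_def)
    with D show ?thesis by (meson exec.WhileFalse)
  qed
  then show ?case by (intro exI[of _ "{}"]) auto
next
  case (WhileTrue s r c t1 s' t2 s'')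
  then obtain R1 R2 where R1: "?P c s t1 s' R1" and R2: "?P (While r c) s' t2 s'' R2" by blast
  have "card (R1 \<union> R2) \<le> 1 + t1 + t2"
    using card_Un_le[of R1 R2] R1 R2 by linarith
  moreover have "\<exists>s1'. exec w (While r c) s1 (1 + t1 + t2) s1' \<and> same_off D s'' s1'"
    if D: "D \<inter> (R1 \<union> R2) = {}" "same_off D s s1" for D s1
  proof -
    from D have "D \<inter> R1 = {}" "D \<inter> R2 = {}" by auto
    moreover have "reg s1 r \<noteq> 0" using D(2) WhileTrue.hyps by (simp add: same_off_def)
    ultimately show ?thesis using R1 R2 D(2) by (meson exec.WhileTrue)
  qed
  ultimately show ?case using R1 R2 by (intro exI[of _ "R1 \<union> R2"]) blast
qed

section \<open>Expressions and their translation\<close>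

datatype ex = Num nat | Var nat | Bin binop ex ex | Ld nat ex | Ite ex ex ex

fun ev :: "nat \<Rightarrow> state \<Rightarrow> ex \<Rightarrow> nat" where
  "ev w s (Num c) = c mod 2 ^ w"
| "ev w s (Var r) = reg s r"
| "ev w s (Bin f x y) = binop_val w f (ev w s x) (ev w s y)"
| "ev w s (Ld A x) = mem s A (ev w s x)"
| "ev w s (Ite x y z) = (if ev w s x \<noteq> 0 then ev w s y else ev w s z)"

fun vars :: "ex \<Rightarrow> nat set" where
  "vars (Num c) = {}"
| "vars (Var r) = {r}"
| "vars (Bin f x y) = vars x \<union> vars y"
| "vars (Ld A x) = vars x"
| "vars (Ite x y z) = vars x \<union> vars y \<union> vars z"

fun arrs :: "ex \<Rightarrow> nat set" where
  "arrs (Num c) = {}"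
| "arrs (Var r) = {}"
| "arrs (Bin f x y) = arrs x \<union> arrs y"
| "arrs (Ld A x) = {A} \<union> arrs x"
| "arrs (Ite x y z) = arrs x \<union> arrs y \<union> arrs z"

text \<open>Stack discipline: the value ends in register \<open>z\<close>, and only registers from
  \<open>z\<close> on are overwritten. \<open>Op Or z r r\<close> serves as a register move.\<close>

fun compile :: "nat \<Rightarrow> ex \<Rightarrow> com" where
  "compile z (Num c) = Const z c"
| "compile z (Var r) = Op Or z r r"
| "compile z (Bin f x y) = Seq (compile z x) (Seq (compile (Suc z) y) (Op f z z (Suc z)))"
| "compile z (Ld A x) = Seq (compile z x) (Load z A z)"
| "compile z (Ite c x y) = Seq (compile z c) (If z (compile z x) (compile z y))"

text \<open>\<open>Ite\<close> is charged for both branches, so the bound depends on the expression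
  alone and is a constant of the program.\<close>

fun cost :: "ex \<Rightarrow> nat" where
  "cost (Num c) = 1"
| "cost (Var r) = 1"
| "cost (Bin f x y) = cost x + cost y + 1"
| "cost (Ld A x) = cost x + 1"
| "cost (Ite c x y) = cost c + cost x + cost y + 1"

text \<open>Equality of states up to the temporary registers, which are those from \<open>z\<close> on.\<close>

definition eqz :: "nat \<Rightarrow> state \<Rightarrow> state \<Rightarrow> bool" where
  "eqz z s s' \<longleftrightarrow> mem s' = mem s \<and> (\<forall>r<z. reg s' r = reg s r)"

lemma eqz_refl [simp]: "eqz z s s" by (simp add: eqz_def)
lemma eqz_trans: "eqz z s s' \<Longrightarrow> eqz z s' s'' \<Longrightarrow> eqz z s s''" by (simp add: eqz_def)
lemma eqz_mono: "eqz z s s' \<Longrightarrow> y \<le> z \<Longrightarrow> eqz y s s'" by (simp add: eqz_def)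

lemma ev_cong:
  assumes "\<And>r. r \<in> vars e \<Longrightarrow> reg s' r = reg s r" "\<And>A. A \<in> arrs e \<Longrightarrow> mem s' A = mem s A"
  shows "ev w s' e = ev w s e"
  using assms by (induction e) auto

lemma ev_eqz: "eqz z s s' \<Longrightarrow> vars e \<subseteq> {..<z} \<Longrightarrow> ev w s' e = ev w s e"
  by (rule ev_cong) (auto simp: eqz_def)

lemma exec_compile:
  assumes "vars e \<subseteq> {..<z}"
  shows "\<exists>t s'. exec w (compile z e) s t s' \<and> t \<le> cost e \<and> reg s' z = ev w s e \<and> eqz z s s'"
  using assms
proof (induction e arbitrary: z s)
  case (Num c)
  show ?case using exec.Const[of w z c s] by (intro exI conjI) (auto simp: eqz_def)
next
  case (Var r)
  show ?case using exec.Op[of w Or z r r s] by (intro exI conjI) (auto simp: eqz_def)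
next
  case (Bin f x y)
  obtain t1 s1 where 1: "exec w (compile z x) s t1 s1" "t1 \<le> cost x" "reg s1 z = ev w s x" "eqz z s s1"
    using Bin.IH(1)[of z s] Bin.prems by auto
  have "vars y \<subseteq> {..<Suc z}" using Bin.prems by auto
  then obtain t2 s2 where 2: "exec w (compile (Suc z) y) s1 t2 s2" "t2 \<le> cost y"
    "reg s2 (Suc z) = ev w s1 y" "eqz (Suc z) s1 s2"
    using Bin.IH(2) by blast
  have y: "ev w s1 y = ev w s y" using Bin.prems 1(4) by (intro ev_eqz) auto
  have z: "reg s2 z = ev w s x" using 1 2 by (simp add: eqz_def)
  have "eqz z s s2" using eqz_trans[OF 1(4) eqz_mono[OF 2(4)]] by simp
  then have "eqz z s (s2\<lparr>reg := (reg s2)(z := binop_val w f (ev w s x) (ev w s y))\<rparr>)"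
    by (simp add: eqz_def)
  moreover have "exec w (compile z (Bin f x y)) s (t1 + (t2 + 1))
     (s2\<lparr>reg := (reg s2)(z := binop_val w f (ev w s x) (ev w s y))\<rparr>)"
    using exec.Seq[OF 1(1) exec.Seq[OF 2(1) exec.Op[of w f z z "Suc z" s2]]] z y 2(3) by simp
  ultimately show ?case using 1(2) 2(2)
    by (intro exI[of _ "t1 + (t2 + 1)"] exI) auto
next
  case (Ld A x)
  obtain t1 s1 where 1: "exec w (compile z x) s t1 s1" "t1 \<le> cost x" "reg s1 z = ev w s x" "eqz z s s1"
    using Ld.IH[of z s] Ld.prems by auto
  have "exec w (compile z (Ld A x)) s (t1 + 1) (s1\<lparr>reg := (reg s1)(z := mem s1 A (reg s1 z))\<rparr>)"
    using exec.Seq[OF 1(1) exec.Load[of w z A z s1]] by simp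
  then show ?case using 1
    by (intro exI[of _ "t1 + 1"] exI) (auto simp: eqz_def)
next
  case (Ite c x y)
  obtain t1 s1 where 1: "exec w (compile z c) s t1 s1" "t1 \<le> cost c" "reg s1 z = ev w s c" "eqz z s s1"
    using Ite.IH(1)[of z s] Ite.prems by auto
  define e where "e = (if ev w s c \<noteq> 0 then x else y)"
  obtain t2 s2 where 2: "exec w (compile z e) s1 t2 s2" "t2 \<le> cost e" "reg s2 z = ev w s1 e" "eqz z s1 s2"
    using Ite.IH(2,3)[of z s1] Ite.prems unfolding e_def by (cases "ev w s c = 0") auto
  have "ev w s1 e = ev w s e" using Ite.prems 1(4) by (intro ev_eqz) (auto simp: e_def)
  moreover have "exec w (If z (compile z x) (compile z y)) s1 (1 + t2) s2"
    using 1(3) 2(1) exec.IfTrue[of s1 z w] exec.IfFalse[of s1 z w] by (cases "ev w s c = 0") (simp_all add: e_def)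
  moreover from this have "exec w (compile z (Ite c x y)) s (t1 + (1 + t2)) s2"
    unfolding compile.simps by (intro exec.Seq[OF 1(1)])
  moreover have "eqz z s s2" using 1(4) 2(4) eqz_trans by blast
  ultimately show ?case using 1 2
    by (intro exI[of _ "t1 + (1 + t2)"] exI[of _ s2]) (auto simp: e_def)
qed

section \<open>Straight-line code\<close>

datatype stmt = Asg nat ex | Sto nat ex ex

fun step :: "nat \<Rightarrow> stmt \<Rightarrow> state \<Rightarrow> state" where
  "step w (Asg r e) s = s\<lparr>reg := (reg s)(r := ev w s e)\<rparr>"
| "step w (Sto A x y) s = s\<lparr>mem := (mem s)(A := (mem s A)(ev w s x := ev w s y))\<rparr>"

fun comp_stmt :: "nat \<Rightarrow> stmt \<Rightarrow> com" where
  "comp_stmt z (Asg r e) = Seq (compile z e) (Op Or r z z)"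
| "comp_stmt z (Sto A x y) = Seq (compile z x) (Seq (compile (Suc z) y) (Store A z (Suc z)))"

fun stmt_cost :: "stmt \<Rightarrow> nat" where
  "stmt_cost (Asg r e) = cost e + 1"
| "stmt_cost (Sto A x y) = cost x + cost y + 1"

fun stmt_ok :: "nat \<Rightarrow> stmt \<Rightarrow> bool" where
  "stmt_ok z (Asg r e) \<longleftrightarrow> r < z \<and> vars e \<subseteq> {..<z}"
| "stmt_ok z (Sto A x y) \<longleftrightarrow> vars x \<subseteq> {..<z} \<and> vars y \<subseteq> {..<z}"

lemma step_eqz: "stmt_ok z c \<Longrightarrow> eqz z s s' \<Longrightarrow> eqz z (step w c s) (step w c s')"
  by (cases c) (auto simp: ev_eqz, auto simp: eqz_def)

lemma exec_stmt:
  assumes "stmt_ok z c"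
  shows "\<exists>t s'. exec w (comp_stmt z c) s t s' \<and> t \<le> stmt_cost c \<and> eqz z (step w c s) s'"
proof (cases c)
  case (Asg r e)
  with assms obtain t1 s1 where 1: "exec w (compile z e) s t1 s1" "t1 \<le> cost e" "reg s1 z = ev w s e" "eqz z s s1"
    using exec_compile[of e z w s] by auto
  have "exec w (comp_stmt z c) s (t1 + 1) (s1\<lparr>reg := (reg s1)(r := ev w s e)\<rparr>)"
    using exec.Seq[OF 1(1) exec.Op[of w Or r z z s1]] 1(3) by (simp add: Asg)
  then show ?thesis using 1 by (intro exI[of _ "t1 + 1"] exI) (auto simp: eqz_def Asg)
next
  case (Sto A x y)
  with assms obtain t1 s1 where 1: "exec w (compile z x) s t1 s1" "t1 \<le> cost x" "reg s1 z = ev w s x" "eqz z s s1"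
    using exec_compile[of x z w s] by auto
  have "vars y \<subseteq> {..<Suc z}" using assms Sto by auto
  then obtain t2 s2 where 2: "exec w (compile (Suc z) y) s1 t2 s2" "t2 \<le> cost y"
    "reg s2 (Suc z) = ev w s1 y" "eqz (Suc z) s1 s2"
    using exec_compile by blast
  have y: "ev w s1 y = ev w s y" using assms Sto 1(4) by (intro ev_eqz) auto
  have z: "reg s2 z = ev w s x" using 1 2 by (simp add: eqz_def)
  have "eqz z s s2" using eqz_trans[OF 1(4) eqz_mono[OF 2(4)]] by simp
  then have "eqz z (step w c s) (s2\<lparr>mem := (mem s2)(A := (mem s2 A)(ev w s x := ev w s y))\<rparr>)"
    by (simp add: eqz_def Sto)
  moreover have "exec w (comp_stmt z c) s (t1 + (t2 + 1))
     (s2\<lparr>mem := (mem s2)(A := (mem s2 A)(ev w s x := ev w s y))\<rparr>)"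
    using exec.Seq[OF 1(1) exec.Seq[OF 2(1) exec.Store[of w A z "Suc z" s2]]] z y 2(3) by (simp add: Sto)
  ultimately show ?thesis using 1(2) 2(2) by (intro exI[of _ "t1 + (t2 + 1)"] exI) (auto simp: Sto)
qed

definition comp_block :: "nat \<Rightarrow> stmt list \<Rightarrow> com" where
  "comp_block z cs = foldr (\<lambda>c. Seq (comp_stmt z c)) cs Skip"

definition block_cost :: "stmt list \<Rightarrow> nat" where
  "block_cost cs = sum_list (map stmt_cost cs) + 1"

lemma fold_step_eqz:
  "\<forall>c\<in>set cs. stmt_ok z c \<Longrightarrow> eqz z s s' \<Longrightarrow> eqz z (fold (step w) cs s) (fold (step w) cs s')"
  by (induction cs arbitrary: s s') (auto simp: step_eqz)

lemma exec_block:
  assumes "\<forall>c\<in>set cs. stmt_ok z c"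
  shows "\<exists>t s'. exec w (comp_block z cs) s t s' \<and> t \<le> block_cost cs \<and> eqz z (fold (step w) cs s) s'"
  using assms
proof (induction cs arbitrary: s)
  case Nil
  show ?case using exec.Skip[of w s] by (intro exI[of _ 1] exI[of _ s]) (simp add: comp_block_def block_cost_def)
next
  case (Cons c cs)
  obtain t1 s1 where 1: "exec w (comp_stmt z c) s t1 s1" "t1 \<le> stmt_cost c" "eqz z (step w c s) s1"
    using exec_stmt Cons.prems by (meson list.set_intros(1))
  obtain t2 s2 where 2: "exec w (comp_block z cs) s1 t2 s2" "t2 \<le> block_cost cs" "eqz z (fold (step w) cs s1) s2"
    using Cons.IH[of s1] Cons.prems by auto
  have "eqz z (fold (step w) cs (step w c s)) s2"
    using eqz_trans[OF fold_step_eqz[OF _ 1(3)] 2(3)] Cons.prems by simp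
  moreover have "exec w (comp_block z (c # cs)) s (t1 + t2) s2"
    using exec.Seq[OF 1(1) 2(1)] by (simp add: comp_block_def)
  moreover have "t1 + t2 \<le> block_cost (c # cs)" using 1(2) 2(2) by (simp add: block_cost_def)
  ultimately show ?case by (intro exI[of _ "t1 + t2"] exI[of _ s2]) simp
qed

section \<open>Counted loops\<close>

fun iterate :: "nat \<Rightarrow> nat \<Rightarrow> stmt list \<Rightarrow> nat \<Rightarrow> state \<Rightarrow> state" where
  "iterate w i cs 0 s = s\<lparr>reg := (reg s)(i := 0)\<rparr>"
| "iterate w i cs (Suc j) s =
     (let s' = fold (step w) cs (iterate w i cs j s) in s'\<lparr>reg := (reg s')(i := Suc j)\<rparr>)"

text \<open>\<open>While\<close> tests a register, so the comparison is evaluated into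
  \<open>z\<close> once before the loop and again at the end of each round.\<close>

definition for_loop :: "nat \<Rightarrow> nat \<Rightarrow> nat \<Rightarrow> stmt list \<Rightarrow> com" where
  "for_loop z i r cs =
     Seq (comp_block z [Asg i (Num 0)])
       (Seq (compile z (Bin Lt (Var i) (Var r)))
         (While z (Seq (comp_block z (cs @ [Asg i (Bin Add (Var i) (Num 1))])) (compile z (Bin Lt (Var i) (Var r))))))"

fun keeps_reg :: "nat \<Rightarrow> stmt \<Rightarrow> bool" where
  "keeps_reg r (Asg r' e) \<longleftrightarrow> r' \<noteq> r"
| "keeps_reg r (Sto A x y) \<longleftrightarrow> True"

fun keeps_array :: "nat \<Rightarrow> stmt \<Rightarrow> bool" where
  "keeps_array A (Asg r' e) \<longleftrightarrow> True"
| "keeps_array A (Sto A' x y) \<longleftrightarrow> A' \<noteq> A"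

lemma fold_step_keeps_reg: "\<forall>c\<in>set cs. keeps_reg r c \<Longrightarrow> reg (fold (step w) cs s) r = reg s r"
proof (induction cs arbitrary: s)
  case (Cons c cs)
  then show ?case by (cases c) auto
qed auto

lemma fold_step_keeps_array: "\<forall>c\<in>set cs. keeps_array A c \<Longrightarrow> mem (fold (step w) cs s) A = mem s A"
proof (induction cs arbitrary: s)
  case (Cons c cs)
  then show ?case by (cases c) auto
qed auto

lemma iterate_keeps_reg:
  "\<forall>c\<in>set cs. keeps_reg r c \<Longrightarrow> r \<noteq> i \<Longrightarrow> reg (iterate w i cs j s) r = reg s r"
  by (induction j) (auto simp: Let_def fold_step_keeps_reg)

lemma iterate_keeps_array:
  "\<forall>c\<in>set cs. keeps_array A c \<Longrightarrow> mem (iterate w i cs j s) A = mem s A"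
  by (induction j) (auto simp: Let_def fold_step_keeps_array)

lemma iterate_index: "reg (iterate w i cs j s) i = j"
  by (induction j) (auto simp: Let_def)

lemma exec_for_loop:
  assumes ok: "\<forall>c\<in>set cs. stmt_ok z c" and "i < z" "r < z" "i \<noteq> r"
    and keeps: "\<forall>c\<in>set cs. keeps_reg i c" "\<forall>c\<in>set cs. keeps_reg r c"
    and n: "reg s r < 2 ^ w" and w: "w \<ge> 1"
  shows "\<exists>t s'. exec w (for_loop z i r cs) s t s' \<and> t \<le> (block_cost cs + 20) * (reg s r + 1) \<and>
    eqz z (iterate w i cs (reg s r) s) s'"
proof -
  define n where "n = reg s r"
  define inc where "inc = Asg i (Bin Add (Var i) (Num 1))"
  define tst where "tst = Bin Lt (Var i) (Var r)"
  define lp where "lp = While z (Seq (comp_block z (cs @ [inc])) (compile z tst))"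
  \<comment> \<open>For \<open>w = 0\<close> the constant 1 and every successful test would be
    reduced to 0.\<close>
  have one: "1 < (2::nat) ^ w" using w by (intro one_less_power) auto
  have vt: "vars tst \<subseteq> {..<z}" using assms by (auto simp: tst_def)
  have okinc: "\<forall>c\<in>set (cs @ [inc]). stmt_ok z c" using assms by (auto simp: inc_def)
  have regr: "reg (iterate w i cs j s) r = n" for j
    using iterate_keeps_reg keeps(2) \<open>i \<noteq> r\<close> by (simp add: n_def)
  have evt: "ev w (iterate w i cs j s) tst = of_bool (j < n)" for j
    using one by (auto simp: tst_def iterate_index regr)
  have incs: "fold (step w) (cs @ [inc]) (iterate w i cs j s) = iterate w i cs (Suc j) s" if "j < n" for j
  proof -
    \<comment> \<open>The counter cannot wrap around, as it never exceeds the bound held in register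
      \<open>r\<close>.\<close>
    have "Suc j < 2 ^ w" using that n by (simp add: n_def)
    then show ?thesis
      using one w by (simp add: inc_def Let_def fold_step_keeps_reg[OF keeps(1)] iterate_index)
  qed
  \<comment> \<open>\<open>eqz z\<close> ignores register \<open>z\<close>, which carries the
    outcome of the test, so its content is a separate part of the invariant.\<close>
  have loop: "\<exists>t s''. exec w lp s' t s'' \<and> t \<le> (block_cost cs + 10) * (n - j) + 1 \<and> eqz z (iterate w i cs n s) s''"
    if "j \<le> n" "eqz z (iterate w i cs j s) s'" "reg s' z = of_bool (j < n)" for j s'
    using that
  proof (induction "n - j" arbitrary: j s')
    case 0
    then have "exec w lp s' 1 s'" unfolding lp_def by (intro exec.WhileFalse) simp
    with 0 show ?case by (intro exI[of _ 1] exI[of _ s']) simp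
  next
    case (Suc d)
    then have jn: "j < n" by simp
    obtain t1 s1 where 1: "exec w (comp_block z (cs @ [inc])) s' t1 s1" "t1 \<le> block_cost (cs @ [inc])"
      "eqz z (fold (step w) (cs @ [inc]) s') s1"
      using exec_block[OF okinc] by blast
    have e1: "eqz z (iterate w i cs (Suc j) s) s1"
      by (rule eqz_trans[OF fold_step_eqz[OF okinc Suc.prems(2)] 1(3), unfolded incs[OF jn]])
    obtain t2 s2 where 2: "exec w (compile z tst) s1 t2 s2" "t2 \<le> cost tst" "reg s2 z = ev w s1 tst" "eqz z s1 s2"
      using exec_compile[OF vt] by blast
    have e2: "eqz z (iterate w i cs (Suc j) s) s2" using e1 2(4) eqz_trans by blast
    have r2: "reg s2 z = of_bool (Suc j < n)" unfolding 2(3) ev_eqz[OF e1 vt] evt ..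
    obtain t3 s3 where 3: "exec w lp s2 t3 s3" "t3 \<le> (block_cost cs + 10) * (n - Suc j) + 1"
      "eqz z (iterate w i cs n s) s3"
    proof -
      have "d = n - Suc j" "Suc j \<le> n" using Suc.hyps(2) jn by auto
      from Suc.hyps(1)[OF this e2 r2] show ?thesis using that by blast
    qed
    have "exec w lp s' (1 + (t1 + t2) + t3) s3"
      unfolding lp_def by (rule exec.WhileTrue[OF _ exec.Seq[OF 1(1) 2(1)] 3(1)[unfolded lp_def]]) (use Suc.prems jn in simp)
    moreover have "1 + (t1 + t2) + t3 \<le> (block_cost cs + 10) * (n - j) + 1"
    proof -
      have "n - j = Suc (n - Suc j)" using jn by simp
      moreover have "t1 + t2 \<le> block_cost cs + 9" using 1(2) 2(2) by (simp add: block_cost_def inc_def tst_def)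
      ultimately show ?thesis using 3(2) by simp
    qed
    ultimately show ?case using 3(3) by blast
  qed
  have ok0: "\<forall>c\<in>set [Asg i (Num 0)]. stmt_ok z c" using assms by simp
  obtain t1 s1 where 1: "exec w (comp_block z [Asg i (Num 0)]) s t1 s1" "t1 \<le> block_cost [Asg i (Num 0)]"
    "eqz z (fold (step w) [Asg i (Num 0)] s) s1"
    using exec_block[OF ok0] by blast
  have e1: "eqz z (iterate w i cs 0 s) s1" using 1(3) by simp
  obtain t2 s2 where 2: "exec w (compile z tst) s1 t2 s2" "t2 \<le> cost tst" "reg s2 z = ev w s1 tst" "eqz z s1 s2"
    using exec_compile[OF vt] by blast
  have e2: "eqz z (iterate w i cs 0 s) s2" using e1 2(4) eqz_trans by blast
  have r2: "reg s2 z = of_bool (0 < n)" unfolding 2(3) ev_eqz[OF e1 vt] evt ..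
  obtain t3 s3 where 3: "exec w lp s2 t3 s3" "t3 \<le> (block_cost cs + 10) * (n - 0) + 1"
      "eqz z (iterate w i cs n s) s3"
    using loop[OF _ e2 r2] by blast
  have "exec w (for_loop z i r cs) s (t1 + (t2 + t3)) s3"
    unfolding for_loop_def inc_def[symmetric] tst_def[symmetric] lp_def[symmetric]
    using exec.Seq[OF 1(1) exec.Seq[OF 2(1) 3(1)]] by simp
  moreover have "t1 + (t2 + t3) \<le> (block_cost cs + 20) * (n + 1)"
    using 1(2) 2(2) 3(2) by (simp add: block_cost_def tst_def algebra_simps)
  ultimately show ?thesis using 3(3) unfolding n_def by blast
qed

text \<open>As \<open>e\<close> does not read the array being filled, the value written in each
  round is determined by the initial state and the counter.\<close>

lemma iterate_fill:
  assumes "A \<notin> arrs e"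
  shows "mem (iterate w i [Sto A (Var i) e] n s) =
    (mem s)(A := (\<lambda>t. if t < n then ev w (s\<lparr>reg := (reg s)(i := t)\<rparr>) e else mem s A t))"
proof (induction n)
  case 0
  show ?case by auto
next
  case (Suc n)
  have "ev w (iterate w i [Sto A (Var i) e] n s) e = ev w (s\<lparr>reg := (reg s)(i := n)\<rparr>) e"
    using assms by (intro ev_cong) (auto simp: iterate_index iterate_keeps_reg Suc)
  then show ?case by (auto simp: Let_def Suc iterate_index fun_eq_iff less_Suc_eq)
qed

section \<open>Encodings and zero-sum recoding\<close>

lemma mult_add_less:
  fixes i j m n :: nat
  assumes "i < n" "j < m"
  shows "i * m + j < n * m"
proof -
  have "i * m + j < Suc i * m" using assms(2) by simp
  also have "\<dots> \<le> n * m" using assms(1) by (intro mult_le_mono) auto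
  finally show ?thesis .
qed

lemma choose_two_ge: "k \<ge> 3 \<Longrightarrow> k choose 2 \<ge> 2"
proof -
  assume "k \<ge> 3"
  then have "3 * 2 \<le> k * (k - 1)" by (intro mult_le_mono) auto
  then show ?thesis by (simp add: choose_two)
qed

text \<open>Row-major flattening. Used repeatedly, it turns the nested comprehensions of the
  encoding into one list whose entries are given by index arithmetic.\<close>

lemma concat_grid:
  "concat (map (\<lambda>x. map (h x) [0..<m]) [0..<n]) = map (\<lambda>t. h (t div m) (t mod m)) [0..<n * m]"
proof (induction n)
  case (Suc n)
  have "map (\<lambda>t. h (t div m) (t mod m)) [n * m..<n * m + m] =
      map (\<lambda>t. h (t div m) (t mod m)) (map (\<lambda>r. r + n * m) [0..<m])"
    by (simp add: map_add_upt add.commute)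
  also have "\<dots> = map (h n) [0..<m]"
    by simp
  finally show ?case
    using Suc upt_add_eq_append[of 0 "n * m" m] by (simp add: add.commute)
qed simp

definition digits :: "nat \<Rightarrow> nat \<Rightarrow> nat \<Rightarrow> nat list" where
  "digits M l u = map (\<lambda>j. u div M ^ j mod M) [0..<l]"

text \<open>\<open>n_lists\<close> varies the first entry fastest, so the first entry is the least
  significant digit. Hence a guess \<open>u\<close> is itself the index of its tuple in the truth
  table of \<open>f\<close>.\<close>

lemma n_lists_eq_digits: "List.n_lists l [0..<M] = map (digits M l) [0..<M ^ l]"
proof (induction l)
  case (Suc l)
  have "List.n_lists (Suc l) [0..<M] =
      concat (map (\<lambda>u. map (\<lambda>y. y # digits M l u) [0..<M]) [0..<M ^ l])"
    by (simp add: Suc comp_def)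
  also have "\<dots> = map (\<lambda>t. t mod M # digits M l (t div M)) [0..<M ^ Suc l]"
    using concat_grid[of "\<lambda>u y. y # digits M l u" M "M ^ l"] by (simp add: mult.commute)
  also have "\<dots> = map (digits M (Suc l)) [0..<M ^ Suc l]"
    by (simp add: digits_def upt_conv_Cons div_mult2_eq del: upt_Suc)
       (simp add: map_Suc_upt[symmetric] div_mult2_eq comp_def del: upt_Suc)
  finally show ?case .
qed (simp add: digits_def)

lemma enc_fun_eq:
  "enc_fun k b f = map (\<lambda>u. of_bool (f (digits (2 ^ b) (k choose 2) u))) [0..<(2 ^ b) ^ (k choose 2)]"
  by (simp add: enc_fun_def n_lists_eq_digits comp_def)

text \<open>Decodes the mixed-radix position
  \<open>x * (n * (g * M)) + y * (g * M) + i * M + u\<close>; see \<open>label_index\<close> for the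
  converse.\<close>

definition label_bit ::
  "nat \<Rightarrow> nat \<Rightarrow> nat \<Rightarrow> (nat \<Rightarrow> nat \<Rightarrow> bool) \<Rightarrow> (nat \<Rightarrow> nat \<Rightarrow> nat set list) \<Rightarrow> nat \<Rightarrow> bool" where
  "label_bit n g M E e t \<longleftrightarrow>
     (let x = t div (n * (g * M)); t1 = t mod (n * (g * M)); y = t1 div (g * M);
          t2 = t1 mod (g * M); i = t2 div M; u = t2 mod M
      in E x y \<and> u \<in> e x y ! i)"

lemma enc_graph_eq:
  "enc_graph n g b E e =
     [n, g, b] @ map (\<lambda>t. of_bool (E (t div n) (t mod n))) [0..<n * n] @
     map (\<lambda>t. of_bool (label_bit n g (2 ^ b) E e t)) [0..<n * (n * (g * 2 ^ b))]"
  unfolding enc_graph_def label_bit_def Let_def by (simp only: concat_grid)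

lemma length_enc_graph: "length (enc_graph n g b E e) = 3 + n * n + n * (n * (g * 2 ^ b))"
  by (simp add: enc_graph_eq)

lemma nth_enc_graph:
  assumes "t < 3 + n * n + n * (n * (g * 2 ^ b))"
  shows "enc_graph n g b E e ! t =
    (if t = 0 then n else if t = 1 then g else if t = 2 then b
     else if t < 3 + n * n then of_bool (E ((t - 3) div n) ((t - 3) mod n))
     else of_bool (label_bit n g (2 ^ b) E e (t - 3 - n * n)))"
proof -
  consider "t = 0" | "t = 1" | "t = 2" | "t \<ge> 3" by linarith
  then show ?thesis
  proof cases
    case 4
    then obtain r where r: "t = Suc (Suc (Suc r))"
      by (metis add_2_eq_Suc le_Suc_ex numeral_3_eq_3 plus_nat.simps(2) Suc_1 add_Suc)
    show ?thesis using assms by (simp add: enc_graph_eq r nth_append)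
  qed (simp_all add: enc_graph_eq)
qed

section \<open>Sums over products of finite sets\<close>

lemma mem_listset:
  "xs \<in> listset As \<longleftrightarrow> length xs = length As \<and> (\<forall>i<length As. xs ! i \<in> As ! i)"
proof (induction As arbitrary: xs)
  case (Cons A As)
  show ?case by (cases xs) (auto simp: Cons set_Cons_def All_less_Suc2 nth_Cons split: nat.splits)
qed simp

lemma finite_listset: "\<forall>A\<in>set As. finite A \<Longrightarrow> finite (listset As)"
proof (induction As)
  case (Cons A As)
  have "listset (A # As) = (\<lambda>(x, xs). x # xs) ` (A \<times> listset As)"
    by (auto simp: set_Cons_def)
  then show ?case using Cons by simp
qed simp

lemma card_listset: "card (listset As) = (\<Prod>A\<leftarrow>As. card A)"
proof (induction As)
  case (Cons A As)
  have "listset (A # As) = (\<lambda>(x, xs). x # xs) ` (A \<times> listset As)"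
    by (auto simp: set_Cons_def)
  then have "card (listset (A # As)) = card (A \<times> listset As)"
    by (simp add: card_image inj_on_def)
  then show ?case using Cons by (simp add: card_cartesian_product)
qed simp

lemma sum_listset_Cons: "(\<Sum>ws\<in>listset (A # As). h ws) = (\<Sum>u\<in>A. \<Sum>ws\<in>listset As. h (u # ws))"
proof -
  have "listset (A # As) = (\<lambda>(x, xs). x # xs) ` (A \<times> listset As)"
    by (auto simp: set_Cons_def)
  moreover have "inj_on (\<lambda>(x, xs). x # xs) (A \<times> listset As)" by (auto simp: inj_on_def)
  ultimately have "(\<Sum>ws\<in>listset (A # As). h ws) = (\<Sum>(u, ws)\<in>A \<times> listset As. h (u # ws))"
    by (simp add: sum.reindex comp_def case_prod_unfold)
  then show ?thesis by (simp add: sum.cartesian_product)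
qed

text \<open>The summand sees a tuple only through its sum, so a factor may be pulled out from any
  place. The offset \<open>r\<close> collects the entries already fixed and carries the
  induction.\<close>

lemma sum_listset_insert:
  fixes h :: "nat \<Rightarrow> nat"
  shows "(\<Sum>ws\<in>listset (As @ A # Bs). h (r + sum_list ws)) =
    (\<Sum>u\<in>A. \<Sum>ws\<in>listset (As @ Bs). h (r + u + sum_list ws))"
proof (induction As arbitrary: r)
  case Nil
  show ?case by (simp add: sum_listset_Cons add.assoc del: listset.simps)
next
  case (Cons C As)
  have "(\<Sum>ws\<in>listset ((C # As) @ A # Bs). h (r + sum_list ws)) =
      (\<Sum>v\<in>C. \<Sum>ws\<in>listset (As @ A # Bs). h ((r + v) + sum_list ws))"
    by (simp add: sum_listset_Cons add.assoc del: listset.simps)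
  also have "\<dots> = (\<Sum>v\<in>C. \<Sum>u\<in>A. \<Sum>ws\<in>listset (As @ Bs). h (r + v + u + sum_list ws))"
    by (simp only: Cons)
  also have "\<dots> = (\<Sum>u\<in>A. \<Sum>v\<in>C. \<Sum>ws\<in>listset (As @ Bs). h (r + v + u + sum_list ws))"
    by (rule sum.swap)
  also have "\<dots> = (\<Sum>u\<in>A. \<Sum>ws\<in>listset ((C # As) @ Bs). h (r + u + sum_list ws))"
    by (simp add: sum_listset_Cons ac_simps del: listset.simps)
  finally show ?case .
qed

text \<open>This is where the symmetry of the zero-sum condition enters; for an arbitrary predicate
  on tuples the order of the factors would matter.\<close>

lemma sum_listset_mset:
  fixes h :: "nat \<Rightarrow> nat"
  assumes "mset As = mset Bs"
  shows "(\<Sum>ws\<in>listset As. h (r + sum_list ws)) = (\<Sum>ws\<in>listset Bs. h (r + sum_list ws))"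
  using assms
proof (induction As arbitrary: Bs r)
  case (Cons A As)
  then have "A \<in> set Bs" by (metis list.set_intros(1) set_mset_mset)
  then obtain B1 B2 where B: "Bs = B1 @ A # B2" by (meson split_list)
  then have "mset As = mset (B1 @ B2)" using Cons.prems by simp
  from Cons.IH[OF this] show ?case
    using sum_listset_insert[of h r "[]" A As] sum_listset_insert[of h r B1 A B2]
    by (simp add: B del: listset.simps)
qed simp

section \<open>Pairs of positions\<close>

lemma pairs_conv: "pairs k = concat (map (\<lambda>p. map (Pair p) [Suc p..<k]) [0..<k])"
  by (simp add: pairs_def)

lemma set_pairs: "set (pairs k) = {(p, q). p < q \<and> q < k}"
  by (force simp: pairs_conv)

lemma distinct_pairs: "distinct (pairs k)"
proof -
  have "x = y" if "x < k" "y < k" "map (Pair x) [Suc x..<k] = map (Pair y) [Suc y..<k]" for x y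
  proof (cases "Suc x < k")
    case True
    then have "(x, Suc x) \<in> set (map (Pair x) [Suc x..<k])" by simp
    then show ?thesis unfolding that(3) by auto
  next
    case False
    then have "map (Pair x) [Suc x..<k] = []" by simp
    with that have "\<not> Suc y < k" by (metis list.map_disc_iff upt_eq_Nil_conv not_less0 not_less)
    with False that show ?thesis by simp
  qed
  then show ?thesis
    unfolding pairs_conv by (intro distinct_concat) (auto simp: distinct_map inj_on_def)
qed

lemma length_pairs: "length (pairs k) = k choose 2"
proof -
  have "length (pairs k) = (\<Sum>p\<leftarrow>[0..<k]. k - Suc p)"
    by (simp add: pairs_conv length_concat comp_def)
  also have "\<dots> = (\<Sum>p<k. k - Suc p)"
    by (simp add: interv_sum_list_conv_sum_set_nat atLeast0LessThan)
  also have "\<dots> = (\<Sum>p<k. p)"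
    by (rule sum.nat_diff_reindex)
  also have "\<dots> = k choose 2"
    by (induction k) (simp_all add: numeral_2_eq_2)
  finally show ?thesis .
qed

definition pair_index :: "nat \<Rightarrow> nat \<Rightarrow> nat \<Rightarrow> nat" where
  "pair_index k p q = (THE j. j < length (pairs k) \<and> pairs k ! j = (p, q))"

lemma pair_index_nth:
  assumes "j < length (pairs k)" "pairs k ! j = (p, q)"
  shows "pair_index k p q = j"
  unfolding pair_index_def
  using assms distinct_pairs[of k] by (intro the_equality) (auto simp flip: nth_eq_iff_index_eq)

text \<open>A permutation of the positions acts on the unordered pairs. \<open>\<tau>\<close> is
  this action on increasing representatives, a bijection because it is an injective map of a finite
  set into itself.\<close>

lemma mset_pairs_permute:
  assumes \<sigma>: "\<sigma> permutes {..<k}" and sym: "\<And>p q. h p q = h q p"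
  shows "mset (map (\<lambda>(p, q). h (\<sigma> p) (\<sigma> q)) (pairs k)) = mset (map (\<lambda>(p, q). h p q) (pairs k))"
proof -
  define P where "P = {(p, q). p < q \<and> q < k}"
  define \<tau> where "\<tau> = (\<lambda>(p, q). (min (\<sigma> p) (\<sigma> q), max (\<sigma> p) (\<sigma> q)))"
  have msP: "mset (pairs k) = mset_set P"
    using mset_set_set[OF distinct_pairs, of k] by (simp add: P_def set_pairs)
  have fin: "finite P" using set_pairs[of k] by (metis List.finite_set P_def)
  have inj: "\<sigma> p = \<sigma> q \<longleftrightarrow> p = q" for p q using permutes_inj[OF \<sigma>] by (auto dest: injD)
  have less: "\<sigma> p < k \<longleftrightarrow> p < k" for p using permutes_in_image[OF \<sigma>] by simp
  have "inj_on \<tau> P"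
  proof (rule inj_onI, clarsimp simp: P_def \<tau>_def)
    fix p q p' q'
    assume *: "p < q" "p' < q'" "min (\<sigma> p) (\<sigma> q) = min (\<sigma> p') (\<sigma> q')" "max (\<sigma> p) (\<sigma> q) = max (\<sigma> p') (\<sigma> q')"
    then have "(\<sigma> p = \<sigma> p' \<and> \<sigma> q = \<sigma> q') \<or> (\<sigma> p = \<sigma> q' \<and> \<sigma> q = \<sigma> p')"
      by (auto simp: min_def max_def split: if_splits)
    with * show "p = p' \<and> q = q'" by (auto simp: inj)
  qed
  moreover have sub: "\<tau> ` P \<subseteq> P"
  proof
    fix z assume "z \<in> \<tau> ` P"
    then obtain p q where "p < q" "q < k" "z = \<tau> (p, q)" by (auto simp: P_def)
    moreover from this have "\<sigma> p \<noteq> \<sigma> q" "\<sigma> p < k" "\<sigma> q < k" by (auto simp: inj less)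
    ultimately show "z \<in> P" by (auto simp: P_def \<tau>_def min_def max_def)
  qed
  ultimately have im: "image_mset \<tau> (mset_set P) = mset_set P"
    using endo_inj_surj[OF fin sub] by (simp add: image_mset_mset_set)
  have "(case x of (p, q) \<Rightarrow> h (\<sigma> p) (\<sigma> q)) = (case \<tau> x of (p, q) \<Rightarrow> h p q)" for x
    by (auto simp: \<tau>_def min_def max_def sym split: prod.splits)
  then have "mset (map (\<lambda>(p, q). h (\<sigma> p) (\<sigma> q)) (pairs k)) =
      image_mset (\<lambda>(p, q). h p q) (image_mset \<tau> (mset_set P))"
    unfolding mset_map msP multiset.map_comp comp_def by (intro image_mset_cong)
  then show ?thesis by (simp add: im msP)
qed

text \<open>How the labels at the \<open>j\<close>-th pair of positions are recoded: the first pair guesses all digits of a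
  satisfying tuple, the others cancel their own digit.  The second pair also cancels the first digit,
  which keeps distinct tuples distinct and thereby preserves the count.\<close>

definition neg_mod :: "nat \<Rightarrow> nat \<Rightarrow> nat" where
  "neg_mod N u = (N - u) mod N"

definition recode :: "nat \<Rightarrow> nat \<Rightarrow> (nat list \<Rightarrow> bool) \<Rightarrow> nat \<Rightarrow> nat set \<Rightarrow> nat set" where
  "recode M l f j S = {u. u < M ^ l \<and>
     (if j = 0 then f (digits M l u) \<and> u mod M \<in> S
      else neg_mod (M ^ l) u div M ^ j \<in> S \<and> (j = 1 \<or> neg_mod (M ^ l) u mod M ^ j = 0))}"

lemma neg_mod_less: "N > 0 \<Longrightarrow> neg_mod N u < N"
  by (simp add: neg_mod_def)

lemma neg_mod_neg_mod: "u < N \<Longrightarrow> neg_mod N (neg_mod N u) = u"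
  by (cases "u = 0") (auto simp: neg_mod_def)

lemma add_neg_mod: "u < N \<Longrightarrow> (u + neg_mod N u) mod N = 0"
  by (cases "u = 0") (auto simp: neg_mod_def)

lemma digit_sum_less:
  fixes M :: nat
  assumes "\<And>j. j < l \<Longrightarrow> c j < M"
  shows "(\<Sum>j<l. c j * M ^ j) < M ^ l"
  using assms
proof (induction l)
  case (Suc l)
  then have "(\<Sum>j<l. c j * M ^ j) < M ^ l" by simp
  moreover have "Suc (c l) * M ^ l \<le> M * M ^ l" using Suc.prems[of l] by (intro mult_right_mono) auto
  ultimately show ?case by simp
qed simp

lemma digits_digit_sum:
  fixes M :: nat
  assumes "\<And>j. j < l \<Longrightarrow> c j < M"
  shows "digits M l (\<Sum>j<l. c j * M ^ j) = map c [0..<l]"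
  using assms
proof (induction l arbitrary: c)
  case (Suc l)
  let ?r = "\<Sum>j<l. c (Suc j) * M ^ j"
  have c0: "c 0 < M" using Suc.prems by simp
  have eq: "(\<Sum>j<Suc l. c j * M ^ j) = c 0 + M * ?r"
    by (simp only: sum.lessThan_Suc_shift) (simp add: sum_distrib_left ac_simps)
  have "digits M (Suc l) (c 0 + M * ?r) = c 0 # digits M l ?r"
    using c0 by (simp add: digits_def upt_conv_Cons div_mult2_eq del: upt_Suc)
       (simp add: map_Suc_upt[symmetric] div_mult2_eq comp_def del: upt_Suc)
  also have "digits M l ?r = map (\<lambda>j. c (Suc j)) [0..<l]"
    using Suc.prems by (intro Suc.IH) auto
  finally show ?case unfolding eq
    by (simp add: upt_conv_Cons map_Suc_upt[symmetric] comp_def del: upt_Suc)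
qed (simp add: digits_def)

lemma digit_sum_mod:
  fixes M :: nat
  assumes "\<And>j. j < l \<Longrightarrow> c j < M" "l > 0"
  shows "(\<Sum>j<l. c j * M ^ j) mod M = c 0"
proof -
  have "(digits M l (\<Sum>j<l. c j * M ^ j)) ! 0 = c 0" using digits_digit_sum[OF assms(1)] assms(2) by simp
  then show ?thesis using assms(2) by (simp add: digits_def)
qed

lemma sum_of_bool_card: "finite A \<Longrightarrow> (\<Sum>x\<in>A. of_bool (P x) :: nat) = card {x \<in> A. P x}"
  by (simp add: of_bool_def sum.If_cases Int_def)

text \<open>Apart from the first entry, the negatives of the recoded entries occupy disjoint digit
  ranges. Adding them produces no carry and stays below \<open>M ^ l\<close>, so the sum vanishes
  modulo \<open>M ^ l\<close> exactly if the first entry equals the number they spell. Reading off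
  and writing down the digits are then mutually inverse.\<close>

lemma recode_count:
  fixes M l :: nat
  assumes len: "length S = l" and l: "l \<ge> 2" and S: "\<And>j. j < l \<Longrightarrow> S ! j \<subseteq> {..<M}"
    and Mpos: "M > 0"
  shows "(\<Sum>us\<in>listset (map (\<lambda>j. recode M l f j (S ! j)) [0..<l]). of_bool (sum_list us mod M ^ l = 0)) =
    (\<Sum>ws\<in>listset S. of_bool (f ws) :: nat)"
proof -
  define N where "N = M ^ l"
  have N: "N > 0" using Mpos by (simp add: N_def)
  let ?R = "listset (map (\<lambda>j. recode M l f j (S ! j)) [0..<l])"
  \<comment> \<open>\<open>H\<close> reads the labels off a recoded tuple and \<open>G\<close>
    recodes a tuple of labels. \<open>H\<close> takes digit 0 from the guess; for zero-sum tuples it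
    agrees with the copy in the second entry.\<close>
  define H where "H = (\<lambda>us. map (\<lambda>j. if j = 0 then us ! 0 mod M else neg_mod N (us ! j) div M ^ j) [0..<l])"
  define G where "G = (\<lambda>ws. map (\<lambda>j. if j = 0 then \<Sum>i<l. ws ! i * M ^ i
      else if j = 1 then neg_mod N (ws ! 0 + ws ! 1 * M) else neg_mod N (ws ! j * M ^ j)) [0..<l])"
  have lsplit: "{..<l} = insert 0 (insert 1 {2..<l})" "{..<l} = insert 0 {1..<l}" "{1..<l} = insert 1 {2..<l}" using l by auto
  \<comment> \<open>Uniqueness of the additive inverse modulo \<open>N\<close>, for reduced
    representatives.\<close>
  have key: "(x + A) mod N = 0 \<longleftrightarrow> x = A'" if "x < N" "A' < N" "(A + A') mod N = 0" for x A A' :: nat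
  proof
    assume "(x + A) mod N = 0"
    then have "(x + A + A') mod N = A' mod N" by (metis add_0 mod_add_left_eq)
    moreover have "(x + A + A') mod N = x mod N" using that(3) by (metis add.assoc add_0_right mod_add_right_eq)
    ultimately show "x = A'" using that by simp
  qed (use that in \<open>simp add: add.commute\<close>)
  have sums: "sum_list us = us ! 0 + (\<Sum>j=1..<l. us ! j)" if "length us = l" for us :: "nat list"
    using that l by (simp add: sum_list_sum_nth atLeast0LessThan lsplit(2))
  have negs: "((\<Sum>j=1..<l. us ! j) + (\<Sum>j=1..<l. neg_mod N (us ! j))) mod N = 0"
    if "\<And>j. j < l \<Longrightarrow> us ! j < N" for us :: "nat list"
  proof -
    have "(\<Sum>j=1..<l. us ! j + neg_mod N (us ! j)) mod N = (\<Sum>j=1..<l. (us ! j + neg_mod N (us ! j)) mod N) mod N"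
      by (simp add: mod_sum_eq)
    also have "\<dots> = 0" using that by (simp add: add_neg_mod)
    finally show ?thesis by (simp add: sum.distrib)
  qed
  have HG: "H us \<in> {ws \<in> listset S. f ws} \<and> G (H us) = us" if "us \<in> {us \<in> ?R. sum_list us mod N = 0}" for us
  proof -
    have lu: "length us = l" and z: "sum_list us mod N = 0"
      and u: "\<And>j. j < l \<Longrightarrow> us ! j \<in> recode M l f j (S ! j)"
      using that by (auto simp: mem_listset)
    have uN: "us ! j < N" if "j < l" for j using u[OF that] by (simp add: recode_def N_def)
    have u0: "f (digits M l (us ! 0))" "us ! 0 mod M \<in> S ! 0"
      using u[of 0] l by (auto simp: recode_def)
    have uj: "neg_mod N (us ! j) div M ^ j \<in> S ! j" "j = 1 \<or> neg_mod N (us ! j) mod M ^ j = 0" if "0 < j" "j < l" for j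
      using u[OF that(2)] that(1) by (auto simp: recode_def N_def)
    \<comment> \<open>The digits spelled by the negatives; the second entry provides both digit 0
      and digit 1.\<close>
    define c where "c j = (if j = 0 then neg_mod N (us ! 1) mod M else neg_mod N (us ! j) div M ^ j)" for j
    have cM: "c j < M" if "j < l" for j using uj[of j] S[OF that] that Mpos by (auto simp: c_def)
    have nj: "neg_mod N (us ! j) = c j * M ^ j" if "2 \<le> j" "j < l" for j
      using uj(2)[of j] that div_mult_mod_eq[of "neg_mod N (us ! j)" "M ^ j"] by (simp add: c_def)
    have n1: "neg_mod N (us ! 1) = c 0 + c 1 * M"
      using div_mult_mod_eq[of "neg_mod N (us ! 1)" M] by (simp add: c_def)
    have "(\<Sum>j=1..<l. neg_mod N (us ! j)) = neg_mod N (us ! 1) + (\<Sum>j=2..<l. c j * M ^ j)"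
      unfolding lsplit(3) using nj by simp
    also have "\<dots> = (\<Sum>j<l. c j * M ^ j)" unfolding lsplit(1) n1 by simp
    finally have A': "(\<Sum>j=1..<l. neg_mod N (us ! j)) = (\<Sum>j<l. c j * M ^ j)" .
    have "(\<Sum>j<l. c j * M ^ j) < N" unfolding N_def using cM by (intro digit_sum_less)
    then have us0: "us ! 0 = (\<Sum>j<l. c j * M ^ j)"
      using key[OF uN[of 0] _ negs[OF uN], unfolded A'] z l by (simp add: sums[OF lu])
    have c0: "c 0 = us ! 0 mod M" unfolding us0 using cM l by (intro digit_sum_mod[symmetric]) auto
    have H: "H us = map c [0..<l]" using c0 by (auto simp: H_def c_def)
    have "f (H us)" using u0(1) digits_digit_sum[of l c M] cM by (simp add: H us0)
    moreover have "H us \<in> listset S"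
      using u0(2) uj(1) by (auto simp: mem_listset len H_def)
    moreover have "G (H us) = us"
    proof (rule nth_equalityI)
      fix j assume "j < length (G (H us))"
      then have j: "j < l" by (simp add: G_def)
      have "(\<Sum>i<l. map c [0..<l] ! i * M ^ i) = (\<Sum>i<l. c i * M ^ i)" by (rule sum.cong) auto
      then show "G (H us) ! j = us ! j"
        using j l us0 nj[of j] neg_mod_neg_mod[OF uN[of j]] neg_mod_neg_mod[OF uN[of 1]] n1 unfolding H
        by (auto simp: G_def)
    qed (simp add: G_def lu)
    ultimately show ?thesis by simp
  qed
  have GH: "G ws \<in> {us \<in> ?R. sum_list us mod N = 0} \<and> H (G ws) = ws" if "ws \<in> {ws \<in> listset S. f ws}" for ws
  proof -
    have lw: "length ws = l" and f: "f ws" and w: "\<And>j. j < l \<Longrightarrow> ws ! j \<in> S ! j"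
      using that by (auto simp: mem_listset len)
    have wM: "ws ! j < M" if "j < l" for j using w[OF that] S[OF that] by auto
    have wl: "map ((!) ws) [0..<l] = ws" unfolding lw[symmetric] by (rule map_nth)
    define v where "v = (\<Sum>i<l. ws ! i * M ^ i)"
    have vN: "v < N" unfolding v_def N_def using wM by (intro digit_sum_less) auto
    have bnd: "ws ! j * M ^ j < N" if "j < l" for j
    proof -
      have "ws ! j * M ^ j < M * M ^ j" using wM[OF that] Mpos by simp
      also have "\<dots> = M ^ Suc j" by simp
      also have "\<dots> \<le> N" unfolding N_def using that Mpos by (intro power_increasing) auto
      finally show ?thesis .
    qed
    have bnd1: "ws ! 0 + ws ! 1 * M < N"
    proof -
      have "ws ! 0 + ws ! 1 * M < Suc (ws ! 1) * M" using wM[of 0] l by simp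
      also have "\<dots> \<le> M * M" using wM[of 1] l by (intro mult_right_mono) auto
      also have "\<dots> = M ^ 2" by (simp add: power2_eq_square)
      also have "\<dots> \<le> N" unfolding N_def using l Mpos by (intro power_increasing) auto
      finally show ?thesis .
    qed
    have G0: "G ws ! 0 = v" using l by (simp add: G_def v_def)
    have G1: "neg_mod N (G ws ! 1) = ws ! 0 + ws ! 1 * M" using l bnd1 by (simp add: G_def neg_mod_neg_mod)
    have Gj: "neg_mod N (G ws ! j) = ws ! j * M ^ j" if "2 \<le> j" "j < l" for j
      using that bnd by (simp add: G_def neg_mod_neg_mod)
    have v0: "v mod M = ws ! 0" unfolding v_def using wM l by (intro digit_sum_mod) auto
    have dv: "digits M l v = ws" using digits_digit_sum[of l "\<lambda>j. ws ! j" M] wM wl by (simp add: v_def)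
    have GN: "G ws ! j < N" if "j < l" for j
      using that vN N by (auto simp: G_def v_def neg_mod_less)
    have d1: "(ws ! 0 + ws ! 1 * M) div M = ws ! 1" using wM[of 0] l by simp
    have "G ws ! j \<in> recode M l f j (S ! j)" if j: "j < l" for j
    proof -
      consider "j = 0" | "j = 1" | "j \<ge> 2" by linarith
      then show ?thesis
      proof cases
        case 1 then show ?thesis using G0 v0 dv f w[OF j] vN by (simp add: recode_def N_def)
      next
        case 2 then show ?thesis using G1 d1 w[OF j] GN[OF j] by (simp add: recode_def N_def)
      next
        case 3 then show ?thesis using Gj[OF 3 j] w[OF j] GN[OF j] Mpos by (simp add: recode_def N_def)
      qed
    qed
    then have R: "G ws \<in> ?R" by (simp add: mem_listset G_def)
    have lG: "length (G ws) = l" by (simp add: G_def)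
    have "(\<Sum>j=1..<l. neg_mod N (G ws ! j)) = v"
      unfolding lsplit(3) v_def lsplit(1) using Gj G1 by simp
    then have "sum_list (G ws) mod N = 0"
      using key[OF GN[of 0] _ negs[OF GN]] vN G0 l by (simp add: sums[OF lG])
    moreover have "H (G ws) = ws"
    proof (rule nth_equalityI)
      fix j assume "j < length (H (G ws))"
      then have j: "j < l" by (simp add: H_def)
      consider "j = 0" | "j = 1" | "j \<ge> 2" by linarith
      then show "H (G ws) ! j = ws ! j"
      proof cases
        case 1 then show ?thesis using G0 v0 l by (simp add: H_def)
      next
        case 2 then show ?thesis using G1 d1 j by (simp add: H_def)
      next
        case 3 then show ?thesis using Gj[OF 3 j] j Mpos by (simp add: H_def)
      qed
    qed (simp add: H_def lw)
    ultimately show ?thesis using R by simp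
  qed
  have "card {us \<in> ?R. sum_list us mod N = 0} = card {ws \<in> listset S. f ws}"
    by (rule bij_betw_same_card[of H], rule bij_betw_byWitness[where f' = G]) (use HG GH in auto)
  moreover have "finite ?R"
    by (rule finite_listset) (auto intro: finite_subset[of _ "{..<N}"] simp: recode_def N_def)
  moreover have "finite (listset S)"
    by (rule finite_listset) (metis S len in_set_conv_nth finite_subset finite_lessThan)
  ultimately show ?thesis by (simp only: sum_of_bool_card N_def)
qed

section \<open>The instances of the reduction\<close>

definition clique_term ::
  "nat \<Rightarrow> nat \<Rightarrow> (nat list \<Rightarrow> bool) \<Rightarrow> (nat \<Rightarrow> nat \<Rightarrow> bool) \<Rightarrow> (nat \<Rightarrow> nat \<Rightarrow> nat set list) \<Rightarrow> nat list \<Rightarrow> nat" where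
  "clique_term k g f E e vs = of_bool (is_clique E vs) *
     (\<Prod>i<g. \<Sum>ws \<in> listset (map (\<lambda>(p, q). e (vs ! p) (vs ! q) ! i) (pairs k)). of_bool (f ws))"

lemma clique_count_eq:
  "clique_count k n g f E e = (\<Sum>vs | length vs = k \<and> set vs \<subseteq> {..<n}. clique_term k g f E e vs)"
  by (simp add: clique_count_def clique_term_def)

lemma finite_tuples: "finite {vs. length vs = k \<and> set vs \<subseteq> {..<n::nat}}"
  using finite_lists_length_eq[of "{..<n}" k] by (simp add: conj_commute)

lemma is_clique_sym:
  assumes "symp E"
  shows "is_clique E vs \<longleftrightarrow> (\<forall>p<length vs. \<forall>q<length vs. p \<noteq> q \<longrightarrow> E (vs ! p) (vs ! q))"
proof
  assume *: "is_clique E vs"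
  show "\<forall>p<length vs. \<forall>q<length vs. p \<noteq> q \<longrightarrow> E (vs ! p) (vs ! q)"
  proof (intro allI impI)
    fix p q assume "p < length vs" "q < length vs" "p \<noteq> q"
    with * have "E (vs ! p) (vs ! q) \<or> E (vs ! q) (vs ! p)"
      unfolding is_clique_def by (cases "p < q") auto
    then show "E (vs ! p) (vs ! q)" using sympD[OF assms] by blast
  qed
qed (auto simp: is_clique_def)

text \<open>Reordering the vertices only redistributes the label sets among the pairs of positions,
  and the zero-sum count depends on the multiset of these sets.\<close>

lemma clique_term_permute:
  assumes \<sigma>: "\<sigma> permutes {..<k}" and len: "length us = k"
    and E: "symp E" and e: "\<And>x y. e x y = e y x"
  shows "clique_term k g (zero_sum B) E e (map (\<lambda>p. us ! \<sigma> p) [0..<k]) = clique_term k g (zero_sum B) E e us"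
proof -
  let ?us = "map (\<lambda>p. us ! \<sigma> p) [0..<k]"
  have less: "\<sigma> p < k \<longleftrightarrow> p < k" for p using permutes_in_image[OF \<sigma>] by simp
  have less': "inv \<sigma> p < k \<longleftrightarrow> p < k" for p using permutes_in_image[OF permutes_inv[OF \<sigma>]] by simp
  have "is_clique E ?us \<longleftrightarrow> is_clique E us"
  proof
    assume *: "is_clique E ?us"
    show "is_clique E us" unfolding is_clique_sym[OF E]
    proof (intro allI impI)
      fix p q assume pq: "p < length us" "q < length us" "p \<noteq> q"
      then have "inv \<sigma> p \<noteq> inv \<sigma> q" by (metis permutes_inverses(1)[OF \<sigma>])
      with * pq len less' have "E (?us ! inv \<sigma> p) (?us ! inv \<sigma> q)" unfolding is_clique_sym[OF E] by simp
      then show "E (us ! p) (us ! q)" using pq len less' permutes_inverses(1)[OF \<sigma>] by simp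
    qed
  next
    assume *: "is_clique E us"
    show "is_clique E ?us" unfolding is_clique_sym[OF E]
    proof (intro allI impI)
      fix p q assume pq: "p < length ?us" "q < length ?us" "p \<noteq> q"
      then have "\<sigma> p \<noteq> \<sigma> q" by (metis permutes_inverses(2)[OF \<sigma>])
      with * pq len less show "E (?us ! p) (?us ! q)" unfolding is_clique_sym[OF E] by simp
    qed
  qed
  moreover have "(\<Sum>ws \<in> listset (map (\<lambda>(p, q). e (?us ! p) (?us ! q) ! i) (pairs k)). of_bool (zero_sum B ws)) =
      (\<Sum>ws \<in> listset (map (\<lambda>(p, q). e (us ! p) (us ! q) ! i) (pairs k)). of_bool (zero_sum B ws) :: nat)" for i
  proof -
    have "map (\<lambda>(p, q). e (?us ! p) (?us ! q) ! i) (pairs k) =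
        map (\<lambda>(p, q). e (us ! \<sigma> p) (us ! \<sigma> q) ! i) (pairs k)"
      by (rule map_cong) (auto simp: set_pairs)
    moreover have "mset \<dots> = mset (map (\<lambda>(p, q). e (us ! p) (us ! q) ! i) (pairs k))"
      by (rule mset_pairs_permute[OF \<sigma>]) (simp only: e)
    ultimately have "mset (map (\<lambda>(p, q). e (?us ! p) (?us ! q) ! i) (pairs k)) =
        mset (map (\<lambda>(p, q). e (us ! p) (us ! q) ! i) (pairs k))" by (simp only:)
    from sum_listset_mset[OF this, of "\<lambda>x. of_bool (x mod 2 ^ B = 0)" 0]
    show ?thesis by (simp only: zero_sum_def add_0)
  qed
  ultimately show ?thesis by (simp add: clique_term_def)
qed

text \<open>The vertices \<open>p * m, \<dots>, p * m + m - 1\<close> of the new graph form its \<open>p\<close>-th part, and represent the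
  \<open>a ! p\<close>-th block of \<open>m\<close> consecutive vertices of the given graph.\<close>

definition source :: "nat \<Rightarrow> nat list \<Rightarrow> nat \<Rightarrow> nat" where
  "source m a x = a ! (x div m) * m + x mod m"

definition red_edge :: "nat \<Rightarrow> nat \<Rightarrow> nat list \<Rightarrow> (nat \<Rightarrow> nat \<Rightarrow> bool) \<Rightarrow> nat \<Rightarrow> nat \<Rightarrow> bool" where
  "red_edge k m a E x y \<longleftrightarrow> x div m < k \<and> y div m < k \<and> x div m \<noteq> y div m \<and> E (source m a x) (source m a y)"

text \<open>\<open>e\<close> is known to be symmetric on edges only. Requiring an edge inside the
  set empties all other labels, so the new labelling is symmetric everywhere, as
  \<open>clique_term_permute\<close> demands. \<open>min\<close> and \<open>max\<close> let the
  recoding depend on the unordered pair of parts.\<close>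

definition red_label ::
  "nat \<Rightarrow> nat \<Rightarrow> nat list \<Rightarrow> nat \<Rightarrow> nat \<Rightarrow> (nat list \<Rightarrow> bool) \<Rightarrow> (nat \<Rightarrow> nat \<Rightarrow> bool) \<Rightarrow>
   (nat \<Rightarrow> nat \<Rightarrow> nat set list) \<Rightarrow> nat \<Rightarrow> nat \<Rightarrow> nat set list" where
  "red_label k m a g M f E e x y =
     map (\<lambda>i. {u. E (source m a x) (source m a y) \<and>
       u \<in> recode M (k choose 2) f (pair_index k (min (x div m) (y div m)) (max (x div m) (y div m)))
             (e (source m a x) (source m a y) ! i)}) [0..<g]"

context
  fixes k n g b m :: nat and E :: "nat \<Rightarrow> nat \<Rightarrow> bool" and e :: "nat \<Rightarrow> nat \<Rightarrow> nat set list"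
    and f :: "nat list \<Rightarrow> bool"
  assumes k: "k \<ge> 3" and graph: "factored_graph n g b E e" and m: "m = n div k"
begin

abbreviation (input) "E' a \<equiv> red_edge k m a E"
abbreviation (input) "e' a \<equiv> red_label k m a g (2 ^ b) f E e"
abbreviation (input) "B' \<equiv> (k choose 2) * b"

lemma E_sym: "E x y \<Longrightarrow> E y x" and e_sym: "E x y \<Longrightarrow> e x y = e y x"
  and E_less: "E x y \<Longrightarrow> x < n \<and> y < n" and E_neq: "E x y \<Longrightarrow> x \<noteq> y"
  and e_label: "E x y \<Longrightarrow> factored_vector g b (e x y)"
  using graph by (auto simp: factored_graph_def)

lemma km: "k * m \<le> n"
  using m by simp

lemma symp_E: "symp E" by (rule sympI) (rule E_sym)

lemma red_edge_sym: "E' a x y \<Longrightarrow> E' a y x"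
  using E_sym by (auto simp: red_edge_def)

lemma symp_red_edge: "symp (E' a)" by (rule sympI) (rule red_edge_sym)

lemma red_label_sym: "e' a x y = e' a y x"
proof -
  have "(E (source m a x) (source m a y) \<and> u \<in> recode M l f j (e (source m a x) (source m a y) ! i)) \<longleftrightarrow>
      (E (source m a y) (source m a x) \<and> u \<in> recode M l f j (e (source m a y) (source m a x) ! i))" for u M l j i
    using E_sym e_sym by metis
  then show ?thesis unfolding red_label_def by (simp add: min.commute max.commute)
qed

lemma power_exp_mult: "(2 :: nat) ^ B' = (2 ^ b) ^ (k choose 2)"
  by (metis power_mult mult.commute)

lemma red_edge_less: "E' a x y \<Longrightarrow> x < n"
proof -
  assume *: "E' a x y"
  then have "m > 0" by (cases "m = 0") (auto simp: red_edge_def)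
  then have "x < k * m" using * by (auto simp: red_edge_def div_less_iff_less_mult)
  then show ?thesis using km by simp
qed

lemma red_factored_graph: "factored_graph n g B' (E' a) (e' a)"
  unfolding factored_graph_def
proof (intro allI impI conjI)
  fix x y assume xy: "E' a x y"
  show "x < n" "y < n" using red_edge_less xy red_edge_sym by blast+
  show "x \<noteq> y" using xy by (auto simp: red_edge_def)
  show "E' a y x" using red_edge_sym[OF xy] .
  show "factored_vector g B' (e' a x y)"
    unfolding factored_vector_def power_exp_mult by (auto simp: red_label_def recode_def)
  show "e' a x y = e' a y x" by (rule red_label_sym)
qed

lemma red_count_ordered:
  assumes "m > 0"
  shows "clique_count k n g (zero_sum B') (E' a) (e' a) = fact k *
    (\<Sum>us | length us = k \<and> set us \<subseteq> {..<n} \<and> (\<forall>p<k. us ! p div m = p).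
      clique_term k g (zero_sum B') (E' a) (e' a) us)"
proof -
  let ?t = "clique_term k g (zero_sum B') (E' a) (e' a)"
  let ?V = "{us. length us = k \<and> set us \<subseteq> {..<n}}"
  define U where "U \<sigma> = {us. length us = k \<and> set us \<subseteq> {..<n} \<and> (\<forall>p<k. us ! p div m = \<sigma> p)}" for \<sigma>
  let ?P = "{\<sigma>. \<sigma> permutes {..<k}}"
  have finU: "finite (U \<sigma>)" for \<sigma> by (rule finite_subset[OF _ finite_tuples[of k n]]) (auto simp: U_def)
  have finP: "finite ?P" by (simp add: finite_permutations)
  have "clique_count k n g (zero_sum B') (E' a) (e' a) = sum ?t ?V"
    by (simp add: clique_count_eq)
  also have "\<dots> = sum ?t (\<Union>\<sigma>\<in>?P. U \<sigma>)"
  proof (rule sum.mono_neutral_right[OF finite_tuples])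
    show "(\<Union>\<sigma>\<in>?P. U \<sigma>) \<subseteq> ?V" by (auto simp: U_def)
    show "\<forall>us\<in>?V - (\<Union>\<sigma>\<in>?P. U \<sigma>). ?t us = 0"
    proof (rule ballI, rule ccontr)
      fix us assume us: "us \<in> ?V - (\<Union>\<sigma>\<in>?P. U \<sigma>)" and nz: "?t us \<noteq> 0"
      then have cl: "is_clique (E' a) us" and len: "length us = k" by (auto simp: clique_term_def split: if_splits)
      \<comment> \<open>The part visited at each position, continued by the identity so that it can
        be a permutation of \<open>{..<k}\<close>.\<close>
      define \<rho> where "\<rho> p = (if p < k then us ! p div m else p)" for p
      have edge: "E' a (us ! p) (us ! q)" if "p < k" "q < k" "p \<noteq> q" for p q
        using cl that len unfolding is_clique_sym[OF symp_red_edge] by blast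
      have "\<rho> p < k" if "p < k" for p
      proof -
        \<comment> \<open>That a part has index below \<open>k\<close> is known for endpoints of
          edges, so a second position is taken to obtain an edge.\<close>
        obtain q where "q < k" "q \<noteq> p" using k that[of 0] that[of 1] by (cases "p = 0") auto
        from edge[OF that this(1)] this(2) show ?thesis by (auto simp: red_edge_def \<rho>_def that)
      qed
      moreover have "inj_on \<rho> {..<k}"
        by (rule inj_onI, rule ccontr) (use edge in \<open>auto simp: red_edge_def \<rho>_def\<close>)
      ultimately have "bij_betw \<rho> {..<k} {..<k}"
        by (simp add: bij_betw_def) (meson endo_inj_surj finite_lessThan image_subsetI lessThan_iff)
      then have "\<rho> permutes {..<k}" by (rule bij_imp_permutes) (simp add: \<rho>_def)
      moreover have "us \<in> U \<rho>" using us by (auto simp: U_def \<rho>_def)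
      ultimately show False using us by blast
    qed
  qed
  also have "\<dots> = (\<Sum>\<sigma>\<in>?P. sum ?t (U \<sigma>))"
  proof (rule sum.UNION_disjoint[OF finP])
    show "\<forall>\<sigma>\<in>?P. \<forall>\<tau>\<in>?P. \<sigma> \<noteq> \<tau> \<longrightarrow> U \<sigma> \<inter> U \<tau> = {}"
    proof (intro ballI impI)
      fix \<sigma> \<tau> assume *: "\<sigma> \<in> ?P" "\<tau> \<in> ?P" "\<sigma> \<noteq> \<tau>"
      then obtain p where p: "\<sigma> p \<noteq> \<tau> p" by blast
      then have "p < k" using * by (metis lessThan_iff mem_Collect_eq permutes_not_in)
      then show "U \<sigma> \<inter> U \<tau> = {}" using p by (auto simp: U_def)
    qed
  qed (use finU in auto)
  also have "\<dots> = (\<Sum>\<sigma>\<in>?P. sum ?t (U id))"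
  proof (rule sum.cong[OF refl])
    fix \<sigma> assume "\<sigma> \<in> ?P"
    then have \<sigma>: "\<sigma> permutes {..<k}" by simp
    have less: "\<sigma> p < k \<longleftrightarrow> p < k" for p using permutes_in_image[OF \<sigma>] by simp
    have less': "inv \<sigma> p < k \<longleftrightarrow> p < k" for p using permutes_in_image[OF permutes_inv[OF \<sigma>]] by simp
    note inv = permutes_inverses[OF \<sigma>]
    show "sum ?t (U \<sigma>) = sum ?t (U id)"
    proof (rule sum.reindex_bij_witness[where i = "\<lambda>us. map (\<lambda>p. us ! \<sigma> p) [0..<k]"
          and j = "\<lambda>us. map (\<lambda>p. us ! inv \<sigma> p) [0..<k]"])
      fix us assume us: "us \<in> U \<sigma>"
      then show "map (\<lambda>p. map (\<lambda>p. us ! inv \<sigma> p) [0..<k] ! \<sigma> p) [0..<k] = us"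
        by (intro nth_equalityI) (auto simp: U_def less inv)
      have "us ! inv \<sigma> p < n" if "p < k" for p using us that less'[of p] nth_mem[of "inv \<sigma> p" us] unfolding U_def by blast
      then show "map (\<lambda>p. us ! inv \<sigma> p) [0..<k] \<in> U id"
        using us by (auto simp: U_def less' inv)
      show "?t (map (\<lambda>p. us ! inv \<sigma> p) [0..<k]) = ?t us"
        using us by (intro clique_term_permute permutes_inv[OF \<sigma>] symp_red_edge red_label_sym) (auto simp: U_def)
    next
      fix us assume us: "us \<in> U id"
      then show "map (\<lambda>p. map (\<lambda>p. us ! \<sigma> p) [0..<k] ! inv \<sigma> p) [0..<k] = us"
        by (intro nth_equalityI) (auto simp: U_def less' inv)
      have "us ! \<sigma> p < n" if "p < k" for p using us that less[of p] nth_mem[of "\<sigma> p" us] unfolding U_def by blast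
      then show "map (\<lambda>p. us ! \<sigma> p) [0..<k] \<in> U \<sigma>"
        using us by (auto simp: U_def less)
    qed
  qed
  also have "\<dots> = fact k * sum ?t (U id)"
    using card_permutations[of "{..<k}" k] by simp
  finally show ?thesis by (simp add: U_def)
qed

text \<open>If position \<open>p\<close> holds a vertex of part \<open>p\<close>, the
  \<open>j\<close>-th pair of positions is also the \<open>j\<close>-th pair of parts and receives
  the \<open>j\<close>-th recoding. Then \<open>recode_count\<close> applies to each of the
  \<open>g\<close> factors separately.\<close>

lemma clique_term_red:
  assumes us: "length us = k" "\<forall>p<k. us ! p div m = p"
    and vs: "length vs = k" "\<forall>p<k. vs ! p = source m a (us ! p)"
  shows "clique_term k g (zero_sum B') (E' a) (e' a) us = clique_term k g f E e vs"
proof -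
  have cl: "is_clique (E' a) us \<longleftrightarrow> is_clique E vs"
    using us vs by (auto simp: is_clique_def red_edge_def)
  show ?thesis
  proof (cases "is_clique E vs")
    case True
    let ?l = "k choose 2"
    have "(\<Sum>ws \<in> listset (map (\<lambda>(p, q). e' a (us ! p) (us ! q) ! i) (pairs k)). of_bool (zero_sum B' ws)) =
        (\<Sum>ws \<in> listset (map (\<lambda>(p, q). e (vs ! p) (vs ! q) ! i) (pairs k)). of_bool (f ws) :: nat)"
      if i: "i < g" for i
    proof -
      define S where "S = map (\<lambda>(p, q). e (vs ! p) (vs ! q) ! i) (pairs k)"
      have "map (\<lambda>(p, q). e' a (us ! p) (us ! q) ! i) (pairs k) =
          map (\<lambda>j. recode (2 ^ b) ?l f j (S ! j)) [0..<?l]"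
      proof (rule nth_equalityI)
        fix j assume "j < length (map (\<lambda>(p, q). e' a (us ! p) (us ! q) ! i) (pairs k))"
        then have j: "j < length (pairs k)" by simp
        obtain p q where pq: "pairs k ! j = (p, q)" by fastforce
        then have less: "p < q" "q < k" using nth_mem[OF j] by (auto simp: set_pairs)
        have "E (vs ! p) (vs ! q)" using True less vs(1) by (auto simp: is_clique_def)
        then have "e' a (us ! p) (us ! q) ! i = recode (2 ^ b) ?l f j (e (vs ! p) (vs ! q) ! i)"
          using less us vs i pair_index_nth[OF j pq] by (simp add: red_label_def)
        then show "map (\<lambda>(p, q). e' a (us ! p) (us ! q) ! i) (pairs k) ! j =
            map (\<lambda>j. recode (2 ^ b) ?l f j (S ! j)) [0..<?l] ! j"
          using j pq by (simp add: S_def length_pairs)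
      qed (simp add: length_pairs)
      moreover have "(\<Sum>us\<in>listset (map (\<lambda>j. recode (2 ^ b) ?l f j (S ! j)) [0..<?l]).
          of_bool (sum_list us mod (2 ^ b) ^ ?l = 0)) = (\<Sum>ws\<in>listset S. of_bool (f ws) :: nat)"
      proof (rule recode_count)
        show "length S = ?l" by (simp add: S_def length_pairs)
        show "2 \<le> ?l" using k by (rule choose_two_ge)
        fix j assume j: "j < ?l"
        obtain p q where pq: "pairs k ! j = (p, q)" by fastforce
        then have less: "p < q" "q < k" using nth_mem[of j "pairs k"] j by (auto simp: set_pairs length_pairs)
        have "E (vs ! p) (vs ! q)" using True less vs(1) by (auto simp: is_clique_def)
        then show "S ! j \<subseteq> {..<2 ^ b}"
          using e_label i j pq by (simp add: S_def length_pairs factored_vector_def)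
      qed simp
      ultimately show ?thesis by (simp add: zero_sum_def power_exp_mult S_def)
    qed
    then show ?thesis by (simp add: clique_term_def cl)
  qed (simp add: clique_term_def cl)
qed

lemma red_count_block:
  assumes mpos: "m > 0" and a: "length a = k"
  shows "(\<Sum>us | length us = k \<and> set us \<subseteq> {..<n} \<and> (\<forall>p<k. us ! p div m = p).
      clique_term k g (zero_sum B') (E' a) (e' a) us) =
    (\<Sum>vs | length vs = k \<and> set vs \<subseteq> {..<n} \<and> map (\<lambda>v. v div m) vs = a. clique_term k g f E e vs)"
    (is "sum ?t ?U = sum ?s ?W")
proof -
  \<comment> \<open>Blocks may reach beyond the last vertex of the given graph. Copies of such
    missing vertices have no edges, so tuples containing them contribute nothing.\<close>
  let ?U' = "{us. length us = k \<and> set us \<subseteq> {..<n} \<and> (\<forall>p<k. us ! p div m = p) \<and> (\<forall>p<k. source m a (us ! p) < n)}"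
  have "sum ?t ?U = sum ?t ?U'"
  proof (rule sum.mono_neutral_right)
    show "finite ?U" by (rule finite_subset[OF _ finite_tuples[of k n]]) auto
    show "\<forall>us\<in>?U - ?U'. ?t us = 0"
    proof
      fix us assume "us \<in> ?U - ?U'"
      then obtain p where p: "p < k" "\<not> source m a (us ! p) < n" "length us = k" by auto
      obtain q where q: "q < k" "q \<noteq> p" using k that[of 0] that[of 1] by (cases "p = 0") auto
      have "\<not> is_clique (E' a) us"
        using p q E_less unfolding is_clique_sym[OF symp_red_edge] by (auto simp: red_edge_def)
      then show "?t us = 0" by (simp add: clique_term_def)
    qed
  qed auto
  also have "\<dots> = sum ?s ?W"
  proof (rule sum.reindex_bij_witness[where j = "map (source m a)"
        and i = "\<lambda>vs. map (\<lambda>p. p * m + vs ! p mod m) [0..<k]"])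
    fix us assume us: "us \<in> ?U'"
    have src: "source m a (us ! p) = a ! p * m + us ! p mod m" if "p < k" for p
      using us that by (simp add: source_def)
    have us_eq: "p * m + us ! p mod m = us ! p" if "p < k" for p
      using us that by (metis (mono_tags, lifting) div_mult_mod_eq mem_Collect_eq)
    show "map (\<lambda>p. p * m + map (source m a) us ! p mod m) [0..<k] = us"
      using us by (intro nth_equalityI) (auto simp: src us_eq)
    have "source m a x < n" if "x \<in> set us" for x using us that by (auto simp: in_set_conv_nth)
    moreover have "map (\<lambda>v. v div m) (map (source m a) us) = a"
      using us a mpos by (intro nth_equalityI) (auto simp: src)
    ultimately show "map (source m a) us \<in> ?W" using us by auto
    show "?s (map (source m a) us) = ?t us"
      using us by (intro clique_term_red[symmetric]) auto
  next
    fix vs assume vs: "vs \<in> ?W"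
    let ?us = "map (\<lambda>p. p * m + vs ! p mod m) [0..<k]"
    have av: "a ! p = vs ! p div m" if "p < k" for p using vs that by auto
    have src: "source m a (p * m + vs ! p mod m) = vs ! p" if "p < k" for p
      using that mpos by (simp add: source_def av)
    show "map (source m a) ?us = vs"
      using vs by (intro nth_equalityI) (auto simp: src)
    have "p * m + vs ! p mod m < n" if "p < k" for p
      using mult_add_less[of p k "vs ! p mod m" m] that mpos km by simp
    moreover have "vs ! p < n" if "p < k" for p using vs that nth_mem[of p vs] by blast
    ultimately show "?us \<in> ?U'" using mpos by (auto simp: src)
  qed
  finally show ?thesis .
qed

text \<open>Each \<open>k\<close>-tuple of vertices belongs to exactly one choice \<open>a\<close>,
  the list of the blocks of its entries. Repetitions in \<open>a\<close> must be allowed, since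
  several vertices of a clique may lie in the same block.\<close>

lemma red_count:
  "(\<Sum>a | length a = k \<and> set a \<subseteq> {..<2 * k}. clique_count k n g (zero_sum B') (E' a) (e' a)) =
   fact k * clique_count k n g f E e"
proof (cases "m = 0")
  \<comment> \<open>Here \<open>n < k\<close>. As division by 0 gives 0, all vertices fall into part
    0 and the new graph has no edges, while the given graph has too few vertices for a
    clique.\<close>
  case True
  have "\<not> is_clique (E' a) vs" if "length vs = k" for a vs
  proof
    assume "is_clique (E' a) vs"
    then have "E' a (vs ! 0) (vs ! 1)" using that k by (simp add: is_clique_def)
    then show False using True by (simp add: red_edge_def)
  qed
  then have "clique_count k n g (zero_sum B') (E' a) (e' a) = 0" for a
    by (simp add: clique_count_eq clique_term_def)
  moreover have "\<not> is_clique E vs" if "length vs = k" "set vs \<subseteq> {..<n}" for vs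
  proof
    assume "is_clique E vs"
    then have "distinct vs" unfolding is_clique_sym[OF symp_E] distinct_conv_nth using E_neq by blast
    then have "card (set vs) = k" using that by (simp add: distinct_card)
    moreover have "card (set vs) \<le> n" using card_mono[OF _ that(2)] by simp
    moreover have "n < k" using True m k by (simp add: div_eq_0_iff)
    ultimately show False by simp
  qed
  then have "clique_count k n g f E e = 0"
    by (simp add: clique_count_eq clique_term_def)
  ultimately show ?thesis by simp
next
  case False
  let ?A = "{a. length a = k \<and> set a \<subseteq> {..<2 * k}}"
  let ?V = "{vs. length vs = k \<and> set vs \<subseteq> {..<n}}"
  \<comment> \<open>The number \<open>2 * k\<close> of blocks: the remainder satisfies
    \<open>n mod k < k \<le> k * m\<close>, hence \<open>n < 2 * k * m\<close>.\<close>
  have big: "v div m < 2 * k" if "v < n" for v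
  proof -
    have "n = k * m + n mod k" unfolding m by simp
    moreover have "n mod k < k" using k by simp
    moreover have "k \<le> k * m" using False by simp
    ultimately have "n < 2 * k * m" by linarith
    with that have "v < 2 * k * m" by simp
    then show ?thesis using False by (simp add: div_less_iff_less_mult)
  qed
  have "(\<Sum>a\<in>?A. clique_count k n g (zero_sum B') (E' a) (e' a)) =
      (\<Sum>a\<in>?A. fact k * (\<Sum>vs | vs \<in> ?V \<and> map (\<lambda>v. v div m) vs = a. clique_term k g f E e vs))"
    using False by (intro sum.cong) (auto simp: red_count_ordered red_count_block conj_assoc)
  also have "\<dots> = fact k * (\<Sum>a\<in>?A. \<Sum>vs | vs \<in> ?V \<and> map (\<lambda>v. v div m) vs = a. clique_term k g f E e vs)"
    by (simp add: sum_distrib_left)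
  also have "(\<Sum>a\<in>?A. \<Sum>vs | vs \<in> ?V \<and> map (\<lambda>v. v div m) vs = a. clique_term k g f E e vs) =
      (\<Sum>vs\<in>?V. clique_term k g f E e vs)"
    by (rule sum.group[OF finite_tuples finite_tuples]) (use big in fastforce)
  finally show ?thesis by (simp add: clique_count_eq)
qed

end

lemma prod_list_card_le:
  fixes As :: "nat set list"
  assumes "\<And>A. A \<in> set As \<Longrightarrow> A \<subseteq> {..<N}"
  shows "(\<Prod>A\<leftarrow>As. card A) \<le> N ^ length As"
  using assms
proof (induction As)
  case (Cons A As)
  have "card A \<le> N" using card_mono[of "{..<N}" A] Cons.prems by simp
  moreover have "(\<Prod>A\<leftarrow>As. card A) \<le> N ^ length As" using Cons by simp
  ultimately show ?case by (simp add: mult_le_mono)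
qed simp

text \<open>Determines how many words the accumulated counts can occupy.\<close>

lemma clique_count_bound:
  assumes "factored_graph n g b E e"
  shows "clique_count k n g f E e \<le> n ^ k * ((2 ^ b) ^ (k choose 2)) ^ g"
proof -
  have "clique_term k g f E e vs \<le> ((2 ^ b) ^ (k choose 2)) ^ g" if len: "length vs = k" for vs
  proof (cases "is_clique E vs")
    case True
    have "(\<Sum>ws \<in> listset (map (\<lambda>(p, q). e (vs ! p) (vs ! q) ! i) (pairs k)). of_bool (f ws) :: nat) \<le>
        (2 ^ b) ^ (k choose 2)" if i: "i < g" for i
    proof -
      let ?S = "map (\<lambda>(p, q). e (vs ! p) (vs ! q) ! i) (pairs k)"
      have sub: "A \<subseteq> {..<2 ^ b}" if "A \<in> set ?S" for A
      proof -
        from that obtain p q where "p < q" "q < k" "A = e (vs ! p) (vs ! q) ! i" by (auto simp: set_pairs)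
        moreover from this have "E (vs ! p) (vs ! q)" using True len by (auto simp: is_clique_def)
        ultimately show ?thesis using assms i by (auto simp: factored_graph_def factored_vector_def)
      qed
      have "(\<Sum>ws \<in> listset ?S. of_bool (f ws) :: nat) \<le> (\<Sum>ws \<in> listset ?S. 1)"
        by (intro sum_mono) auto
      also have "\<dots> = (\<Prod>A\<leftarrow>?S. card A)" by (simp add: card_listset)
      also have "\<dots> \<le> (2 ^ b) ^ length ?S" by (rule prod_list_card_le) (rule sub)
      finally show ?thesis by (simp add: length_pairs)
    qed
    then have "(\<Prod>i<g. \<Sum>ws \<in> listset (map (\<lambda>(p, q). e (vs ! p) (vs ! q) ! i) (pairs k)). of_bool (f ws) :: nat) \<le>
        (\<Prod>i<g. (2 ^ b) ^ (k choose 2))"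
      by (intro prod_mono) auto
    then show ?thesis by (simp add: clique_term_def True)
  qed (simp add: clique_term_def)
  then have "clique_count k n g f E e \<le> (\<Sum>vs | length vs = k \<and> set vs \<subseteq> {..<n}. ((2 ^ b) ^ (k choose 2)) ^ g)"
    unfolding clique_count_eq by (intro sum_mono) auto
  also have "\<dots> = n ^ k * ((2 ^ b) ^ (k choose 2)) ^ g"
    using card_lists_length_eq[of "{..<n}" k] by (simp add: conj_commute)
  finally show ?thesis .
qed

section \<open>A lower bound for the solver\<close>

lemma input_state_words: "input_state w xs s \<longleftrightarrow> words w s \<and> (\<forall>i<length xs. mem s 0 i = xs ! i)"
  by (auto simp: input_state_def words_def)

lemma listset_empty: "{} \<in> set As \<Longrightarrow> listset As = {}"
  by (metis all_not_in_conv in_set_conv_nth mem_listset)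

text \<open>Vertices below \<open>k - 2\<close> are joined to all others by full labels; the labels between the others
  are given by \<open>D\<close>.  There is no zero-sum clique as long as \<open>D\<close> is empty, but any single element
  creates one.\<close>

definition hub_edge :: "nat \<Rightarrow> nat \<Rightarrow> nat \<Rightarrow> bool" where
  "hub_edge n x y \<longleftrightarrow> x < n \<and> y < n \<and> x \<noteq> y"

definition hub_label :: "nat \<Rightarrow> nat \<Rightarrow> nat \<Rightarrow> (nat \<times> nat \<times> nat) set \<Rightarrow> nat \<Rightarrow> nat \<Rightarrow> nat set list" where
  "hub_label k g B D x y =
     replicate g (if x < k - 2 \<or> y < k - 2 then {..<2 ^ B} else {u. (min x y, max x y, u) \<in> D})"

lemma hub_graph:
  assumes "\<And>x y u. (x, y, u) \<in> D \<Longrightarrow> u < 2 ^ B"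
  shows "factored_graph n g B (hub_edge n) (hub_label k g B D)"
  using assms by (auto simp: factored_graph_def hub_edge_def hub_label_def factored_vector_def min.commute max.commute)

lemma symp_hub_edge: "symp (hub_edge n)"
  by (auto intro!: sympI simp: hub_edge_def)

text \<open>Pigeonhole: at most \<open>k - 2\<close> of the \<open>k\<close> distinct vertices are
  hubs, so two lie outside, and the empty label between them makes the factor for coordinate 0
  vanish.\<close>

lemma hub_count_zero:
  assumes k: "k \<ge> 3" and g: "g \<ge> 1"
  shows "clique_count k n g f (hub_edge n) (hub_label k g B {}) = 0"
proof -
  have "clique_term k g f (hub_edge n) (hub_label k g B {}) vs = 0" if len: "length vs = k" for vs
  proof (cases "is_clique (hub_edge n) vs")
    case True
    have neq: "vs ! p \<noteq> vs ! q" if "p < k" "q < k" "p \<noteq> q" for p q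
      using True that len unfolding is_clique_sym[OF symp_hub_edge] by (simp add: hub_edge_def)
    define A where "A = {p. p < k \<and> vs ! p < k - 2}"
    define N where "N = {p. p < k \<and> \<not> vs ! p < k - 2}"
    have "card A \<le> card {..<k - 2}"
      by (rule card_inj_on_le[of "(!) vs"]) (use neq in \<open>auto simp: A_def inj_on_def\<close>)
    moreover have "card (A \<union> N) = card A + card N" by (rule card_Un_disjoint) (auto simp: A_def N_def)
    moreover have "A \<union> N = {..<k}" by (auto simp: A_def N_def)
    ultimately have "\<not> card N \<le> Suc 0" using k by simp
    moreover have "finite N" by (simp add: N_def)
    ultimately obtain p q where "p \<in> N" "q \<in> N" "p \<noteq> q" by (auto simp: card_le_Suc0_iff_eq)
    then obtain p q where "p \<in> N" "q \<in> N" "p < q" by (meson linorder_neqE_nat)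
    then have pq: "(p, q) \<in> set (pairs k)" "\<not> vs ! p < k - 2" "\<not> vs ! q < k - 2"
      by (auto simp: set_pairs N_def)
    have "hub_label k g B {} (vs ! p) (vs ! q) ! 0 = {}"
      using pq g by (simp add: hub_label_def)
    then have "{} \<in> set (map (\<lambda>(p, q). hub_label k g B {} (vs ! p) (vs ! q) ! 0) (pairs k))"
      using pq(1) by force
    from listset_empty[OF this] show ?thesis
      using g by (auto simp: clique_term_def intro!: bexI[of _ 0])
  qed (simp add: clique_term_def)
  then show ?thesis by (simp add: clique_count_eq)
qed

text \<open>The clique consists of \<open>x\<close>, \<open>y\<close> and all hubs. The element
  \<open>u\<close> between \<open>x\<close> and \<open>y\<close> is cancelled on an edge to a hub,
  which exists as \<open>k \<ge> 3\<close>; hub edges carry full labels.\<close>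

lemma hub_count_pos:
  assumes k: "k \<ge> 3" and xy: "k - 2 \<le> x" "x < y" "y < n" and u: "u < 2 ^ B"
  shows "clique_count k n g (zero_sum B) (hub_edge n) (hub_label k g B {(x, y, u)}) > 0"
proof -
  let ?E = "hub_edge n" and ?e = "hub_label k g B {(x, y, u)}"
  define vs where "vs = [x, y] @ [0..<k - 2]"
  have len: "length vs = k" using k by (simp add: vs_def)
  have set: "set vs \<subseteq> {..<n}" using xy by (auto simp: vs_def)
  have "distinct vs" using xy by (auto simp: vs_def)
  then have cl: "is_clique ?E vs"
    unfolding is_clique_sym[OF symp_hub_edge]
  proof (intro allI impI)
    fix p q assume pq: "p < length vs" "q < length vs" "p \<noteq> q"
    then have "vs ! p \<noteq> vs ! q" using \<open>distinct vs\<close> by (simp add: nth_eq_iff_index_eq)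
    moreover have "vs ! p < n" "vs ! q < n" using pq set nth_mem[of p vs] nth_mem[of q vs] by blast+
    ultimately show "?E (vs ! p) (vs ! q)" by (simp add: hub_edge_def)
  qed
  \<comment> \<open>\<open>u\<close> on the pair \<open>x\<close>, \<open>y\<close>, its negative
    between \<open>x\<close> and the first hub, 0 on all other pairs.\<close>
  define \<phi> where "\<phi> = (\<lambda>(p::nat, q::nat). if p = 0 \<and> q = 1 then u else if p = 0 \<and> q = 2 then neg_mod (2 ^ B) u else 0)"
  have "sum_list (map \<phi> (pairs k)) = (\<Sum>z\<in>set (pairs k). \<phi> z)"
    using distinct_pairs by (rule sum_list_distinct_conv_sum_set)
  also have "\<dots> = (\<Sum>z\<in>{(0, 1), (0, 2)}. \<phi> z)"
    by (rule sum.mono_neutral_right[OF List.finite_set]) (use k in \<open>auto simp: set_pairs \<phi>_def split: if_splits\<close>)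
  also have "\<dots> = u + neg_mod (2 ^ B) u" by (simp add: \<phi>_def)
  finally have zero: "zero_sum B (map \<phi> (pairs k))"
    using add_neg_mod[OF u] by (simp add: zero_sum_def)
  have vsp: "vs ! p < k - 2" if "2 \<le> p" "p < k" for p
    using that by (auto simp: vs_def nth_append nth_Cons split: nat.splits)
  have mem: "\<phi> (p, q) \<in> ?e (vs ! p) (vs ! q) ! i" if pq: "p < q" "q < k" and i: "i < g" for p q i
  proof (cases "q = 1")
    case True
    then have "p = 0" using pq by simp
    then show ?thesis using True xy i by (simp add: hub_label_def vs_def \<phi>_def)
  next
    case False
    then have "vs ! q < k - 2" using vsp[of q] pq by simp
    then show ?thesis using i u neg_mod_less[of "2 ^ B" u] by (simp add: hub_label_def \<phi>_def)
  qed
  have "clique_term k g (zero_sum B) ?E ?e vs > 0"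
  proof -
    have "(\<Sum>ws \<in> listset (map (\<lambda>(p, q). ?e (vs ! p) (vs ! q) ! i) (pairs k)). of_bool (zero_sum B ws) :: nat) > 0"
      if i: "i < g" for i
    proof -
      let ?S = "map (\<lambda>(p, q). ?e (vs ! p) (vs ! q) ! i) (pairs k)"
      have "finite A" if "A \<in> set ?S" for A
      proof -
        from that obtain x' y' where "A = ?e x' y' ! i" by auto
        then show ?thesis using i by (auto simp: hub_label_def intro: finite_subset[of _ "{u}"])
      qed
      then have "finite (listset ?S)" by (intro finite_listset) auto
      moreover have "map \<phi> (pairs k) \<in> listset ?S"
        unfolding mem_listset
      proof (intro conjI allI impI)
        fix j assume "j < length ?S"
        then have j: "j < length (pairs k)" by simp
        obtain p q where pq: "pairs k ! j = (p, q)" by fastforce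
        then have "p < q" "q < k" using nth_mem[OF j] by (auto simp: set_pairs)
        from mem[OF this i] show "map \<phi> (pairs k) ! j \<in> ?S ! j" using j pq by simp
      qed simp
      ultimately have "(of_bool (zero_sum B (map \<phi> (pairs k))) :: nat) \<le>
          (\<Sum>ws \<in> listset ?S. of_bool (zero_sum B ws))"
        by (intro member_le_sum) auto
      then show ?thesis using zero by simp
    qed
    then show ?thesis using cl by (simp add: clique_term_def prod_pos)
  qed
  also have "clique_term k g (zero_sum B) ?E ?e vs \<le> clique_count k n g (zero_sum B) ?E ?e"
    unfolding clique_count_eq by (rule member_le_sum) (use len set finite_tuples in auto)
  finally show ?thesis .
qed

text \<open>The coordinate and the orientation of the edge are forgotten, so all cells affected by
  one element of \<open>D\<close> share a triple. By truncated subtraction the header and adjacency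
  cells also get some triple, which can only increase the number of triples regarded as
  touched.\<close>

definition touched_triple :: "nat \<Rightarrow> nat \<Rightarrow> nat \<Rightarrow> nat \<Rightarrow> nat \<times> nat \<times> nat" where
  "touched_triple n g M t =
     (let t0 = t - 3 - n * n; x = t0 div (n * (g * M)); t1 = t0 mod (n * (g * M)); y = t1 div (g * M);
          t2 = t1 mod (g * M); u = t2 mod M
      in (min x y, max x y, u))"

lemma enc_hub_cong:
  assumes t: "t < 3 + n * n + n * (n * (g * 2 ^ B))"
    and D: "touched_triple n g (2 ^ B) t \<notin> D" "touched_triple n g (2 ^ B) t \<notin> D'"
  shows "enc_graph n g B E (hub_label k g B D) ! t = enc_graph n g B E (hub_label k g B D') ! t"
proof -
  have "label_bit n g (2 ^ B) E (hub_label k g B D) (t - 3 - n * n) =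
      label_bit n g (2 ^ B) E (hub_label k g B D') (t - 3 - n * n)" if t3: "3 + n * n \<le> t"
  proof -
    let ?r = "(t - 3 - n * n) mod (n * (g * 2 ^ B)) mod (g * 2 ^ B)"
    have "n * (n * (g * 2 ^ B)) > 0" using t t3 by linarith
    then have "?r < g * 2 ^ B" by simp
    then have "?r div 2 ^ B < g" by (simp add: less_mult_imp_div_less)
    then show ?thesis using D by (simp add: label_bit_def touched_triple_def hub_label_def Let_def)
  qed
  then show ?thesis unfolding nth_enc_graph[OF t] by simp
qed

text \<open>On the instance with empty \<open>D\<close> the answer is \<open>h 0\<close>. If no
  touched cell belonged to some triple, inserting that triple into \<open>D\<close> would leave the
  run and its output unchanged although the count becomes positive. So there are at least as many
  touched cells as triples. The condition on \<open>h\<close> covers counting and deciding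
  alike.\<close>

lemma solver_time_lower_bound:
  assumes k: "k \<ge> 3" and g: "g \<ge> 1" and w: "n < 2 ^ w" "g < 2 ^ w" "B < 2 ^ w" "w \<ge> 1"
    and h: "\<And>x. x > 0 \<Longrightarrow> h x \<noteq> h 0"
    and solver: "\<And>E e s. factored_graph n g B E e \<Longrightarrow> input_state w (enc_graph n g B E e) s \<Longrightarrow>
      \<exists>t s'. exec w c s t s' \<and> t \<le> T \<and> output_value w s' = h (clique_count k n g (zero_sum B) E e)"
  shows "((n - (k - 2)) choose 2) * 2 ^ B \<le> T"
proof -
  let ?E = "hub_edge n" and ?e = "hub_label k g B"
  let ?xs = "\<lambda>D. enc_graph n g B ?E (?e D)"
  let ?tr = "touched_triple n g (2 ^ B)"
  have len: "length (?xs D) = 3 + n * n + n * (n * (g * 2 ^ B))" for D by (simp add: length_enc_graph)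
  have one: "(1::nat) < 2 ^ w" using w(4) by (intro one_less_power) auto
  have bnd: "?xs D ! t < 2 ^ w" if "t < length (?xs D)" for D t
    unfolding nth_enc_graph[OF that[unfolded len]] using w one by simp
  \<comment> \<open>Everything outside the input is zero, so the states for different
    \<open>D\<close> differ only in label cells.\<close>
  define st where "st D = \<lparr>reg = \<lambda>_. 0, mem = \<lambda>A i. if A = 0 \<and> i < length (?xs D) then ?xs D ! i else 0\<rparr>" for D
  have inp: "input_state w (?xs D) (st D)" for D
    using bnd by (auto simp: input_state_def st_def)
  have "factored_graph n g B ?E (?e {})" by (rule hub_graph) simp
  from solver[OF this inp] obtain t s' where run: "exec w c (st {}) t s'" "t \<le> T" and out: "output_value w s' = h 0"
    using hub_count_zero[OF k g, of n "zero_sum B" B] by auto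
  from exec_touched_cells[OF run(1)] obtain R where R: "finite R" "card R \<le> t"
    and same: "\<And>D s1. D \<inter> R = {} \<Longrightarrow> same_off D (st {}) s1 \<Longrightarrow> \<exists>s1'. exec w c s1 t s1' \<and> same_off D s' s1'"
    by blast
  \<comment> \<open>The shift by \<open>k - 2\<close> skips the hubs.\<close>
  let ?f = "\<lambda>((p, q), u). (p + (k - 2), q + (k - 2), u)"
  let ?P = "set (pairs (n - (k - 2))) \<times> {..<(2::nat) ^ B}"
  have "?f ` ?P \<subseteq> ?tr ` R"
  proof (clarsimp simp: set_pairs simp del: image_iff)
    fix p q u :: nat assume pq: "p < q" "q < n - (k - 2)" and u: "u < 2 ^ B"
    define x y where "x = p + (k - 2)" and "y = q + (k - 2)"
    have xy: "k - 2 \<le> x" "x < y" "y < n" using pq by (auto simp: x_def y_def)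
    have "(x, y, u) \<in> ?tr ` R"
    proof (rule ccontr)
      assume no: "(x, y, u) \<notin> ?tr ` R"
      \<comment> \<open>A set of cells here: every position whose content may change when the triple
        is inserted.\<close>
      define D where "D = {t. ?tr t = (x, y, u)}"
      have "D \<inter> R = {}" using no by (force simp: D_def)
      moreover have "same_off D (st {}) (st {(x, y, u)})"
        using enc_hub_cong[where D = "{}" and D' = "{(x, y, u)}"]
        by (auto simp: same_off_def st_def D_def len)
      ultimately obtain s1 where s1: "exec w c (st {(x, y, u)}) t s1" "same_off D s' s1" using same by blast
      have "factored_graph n g B ?E (?e {(x, y, u)})" by (rule hub_graph) (use u in auto)
      from solver[OF this inp] obtain t2 s2 where s2: "exec w c (st {(x, y, u)}) t2 s2"
        and out2: "output_value w s2 = h (clique_count k n g (zero_sum B) ?E (?e {(x, y, u)}))" by blast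
      have "s1 = s2" using exec_deterministic[OF s1(1) s2] by simp
      then have "output_value w s2 = output_value w s'"
        using s1(2) by (simp add: output_value_def same_off_def)
      then show False using out out2 h[OF hub_count_pos[OF k xy u, of g]] by simp
    qed
    then show "(p + (k - 2), q + (k - 2), u) \<in> ?tr ` R" by (simp add: x_def y_def)
  qed
  then have "card (?f ` ?P) \<le> card R"
    using R(1) by (meson card_image_le card_mono finite_imageI le_trans)
  moreover have "card (?f ` ?P) = card ?P"
    by (rule card_image) (auto simp: inj_on_def)
  moreover have "card (set (pairs (n - (k - 2)))) = (n - (k - 2)) choose 2"
    by (simp add: distinct_card distinct_pairs length_pairs)
  ultimately show ?thesis using R(2) run(2) by (simp add: card_cartesian_product)
qed

section \<open>Computing the cells of the new instances\<close>

abbreviation bin_add (infixl "[+]" 65) where "x [+] y \<equiv> Bin Add x y"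
abbreviation bin_sub (infixl "[-]" 65) where "x [-] y \<equiv> Bin Sub x y"
abbreviation bin_mul (infixl "[*]" 70) where "x [*] y \<equiv> Bin Mul x y"
abbreviation bin_div (infixl "[div]" 70) where "x [div] y \<equiv> Bin Div x y"
abbreviation bin_mod (infixl "[mod]" 70) where "x [mod] y \<equiv> Bin Mod x y"
abbreviation bin_less (infix "[<]" 50) where "x [<] y \<equiv> Bin Lt x y"
abbreviation bin_eq (infix "[=]" 50) where "x [=] y \<equiv> Bin Eq x y"

text \<open>Machine arithmetic is exact as long as no result leaves the range of a word; the
  overflow bounds of the locale \<open>reduction\<close> exist to discharge these side
  conditions.\<close>

lemma ev_arith:
  "ev w s x + ev w s y < 2 ^ w \<Longrightarrow> ev w s (x [+] y) = ev w s x + ev w s y"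
  "ev w s x * ev w s y < 2 ^ w \<Longrightarrow> ev w s (x [*] y) = ev w s x * ev w s y"
  "ev w s y \<le> ev w s x \<Longrightarrow> ev w s x < 2 ^ w \<Longrightarrow> ev w s (x [-] y) = ev w s x - ev w s y"
  "ev w s x * 2 ^ ev w s y < 2 ^ w \<Longrightarrow> ev w s (Bin Shl x y) = ev w s x * 2 ^ ev w s y"
  "c < 2 ^ w \<Longrightarrow> ev w s (Num c) = c"
proof -
  assume *: "ev w s y \<le> ev w s x" "ev w s x < 2 ^ w"
  then have eq: "ev w s x + 2 ^ w - ev w s y = (ev w s x - ev w s y) + 2 ^ w" by simp
  show "ev w s (x [-] y) = ev w s x - ev w s y" unfolding ev.simps binop_val.simps eq mod_add_self2 using * by (intro mod_less) linarith
qed (simp_all add: push_bit_eq_mult)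

lemma ev_test:
  assumes "w \<ge> 1"
  shows "ev w s (x [<] y) = of_bool (ev w s x < ev w s y)" "ev w s (x [=] y) = of_bool (ev w s x = ev w s y)"
proof -
  have "(1::nat) < 2 ^ w" using assms by (intro one_less_power) auto
  then show "ev w s (x [<] y) = of_bool (ev w s x < ev w s y)" "ev w s (x [=] y) = of_bool (ev w s x = ev w s y)"
    by simp_all
qed

text \<open>The table belongs to the program text and has constant length, so a chain of comparisons
  takes constant time.\<close>

definition lookup :: "ex \<Rightarrow> (nat \<times> nat) list \<Rightarrow> ex" where
  "lookup x kvs = foldr (\<lambda>(c, v) y. Ite (x [=] Num c) (Num v) y) kvs (Num 0)"

lemma ev_lookup:
  assumes "w \<ge> 1" "distinct (map fst kvs)" "(ev w s x, v) \<in> set kvs"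
    "\<And>c v. (c, v) \<in> set kvs \<Longrightarrow> c < 2 ^ w \<and> v < 2 ^ w"
  shows "ev w s (lookup x kvs) = v"
  using assms(2-4)
proof (induction kvs)
  case (Cons cv kvs)
  obtain c u where cv: "cv = (c, u)" by fastforce
  have b: "c < 2 ^ w" "u < 2 ^ w" using Cons.prems(3) cv by auto
  have eq: "ev w s (lookup x (cv # kvs)) = (if ev w s x = c then u else ev w s (lookup x kvs))"
    using b ev_test(2)[OF assms(1), of s x "Num c"] by (simp add: lookup_def cv del: ev.simps(3))
  show ?case
  proof (cases "ev w s x = c")
    case True
    have "v = u"
    proof (rule ccontr)
      assume "v \<noteq> u"
      then have "(c, v) \<in> set kvs" using Cons.prems(2) True cv by auto
      then have "c \<in> set (map fst kvs)" by force
      then show False using Cons.prems(1) cv by simp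
    qed
    then show ?thesis using True eq by simp
  next
    case False
    then have "(ev w s x, v) \<in> set kvs" using Cons.prems(2) cv by auto
    moreover have "distinct (map fst kvs)" using Cons.prems(1) by simp
    ultimately have "ev w s (lookup x kvs) = v" using Cons.prems(3) by (intro Cons.IH) auto
    then show ?thesis using False eq by simp
  qed
qed simp

lemma vars_lookup: "vars (lookup x kvs) \<subseteq> vars x"
  by (induction kvs) (auto simp: lookup_def)

lemma arrs_lookup: "arrs (lookup x kvs) \<subseteq> arrs x"
  by (induction kvs) (auto simp: lookup_def)

text \<open>The solver owns the registers below \<open>R\<close> and the arrays below \<open>A\<close>.  Array \<open>A\<close> keeps a copy of the
  input; the registers \<open>R, \<dots>, R + 14\<close> hold the parameters listed in \<open>config\<close>.\<close>

locale program =
  fixes k R A :: nat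
  assumes k3: "k \<ge> 3" and R1: "R \<ge> 1" and A2: "A \<ge> 2"
begin

abbreviation "l \<equiv> k choose 2"
abbreviation "vn \<equiv> Var R"
abbreviation "vg \<equiv> Var (R + 1)"
abbreviation "vm \<equiv> Var (R + 2)"
abbreviation "vb \<equiv> Var (R + 3)"
abbreviation "vM \<equiv> Var (R + 4)"
abbreviation "vN \<equiv> Var (R + 5)"
abbreviation "vnn \<equiv> Var (R + 6)"
abbreviation "vgM \<equiv> Var (R + 7)"
abbreviation "vngM \<equiv> Var (R + 8)"
abbreviation "vgN \<equiv> Var (R + 9)"
abbreviation "vngN \<equiv> Var (R + 10)"
abbreviation "voff \<equiv> Var (R + 11)"
abbreviation "vi \<equiv> Var (R + 15)"
abbreviation "vc \<equiv> Var (R + 16)"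
abbreviation "vt \<equiv> Var (R + 17)"
abbreviation "vq \<equiv> Var (R + 18)"
abbreviation "vr \<equiv> Var (R + 19)"
abbreviation "z \<equiv> R + 20"

text \<open>Array 0 is overwritten in every round, so the parameters and their products are kept in
  registers. The last three entries are loop bounds: the length of the given input, the length of a
  new instance, and the number of digits reserved for a count.\<close>

definition config :: "nat \<Rightarrow> nat \<Rightarrow> nat \<Rightarrow> nat list" where
  "config n g b = (let M = 2 ^ b; N = 2 ^ (l * b); off = 3 + n * n + n * (n * (g * M)) in
     [n, g, n div k, b, M, N, n * n, g * M, n * (g * M), g * N, n * (g * N), off, off + N,
      3 + n * n + n * (n * (g * N)), g + (k + 2)])"

definition ctx :: "nat \<Rightarrow> nat \<Rightarrow> nat \<Rightarrow> state \<Rightarrow> bool" where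
  "ctx n g b s \<longleftrightarrow> (\<forall>j<15. reg s (R + j) = config n g b ! j)"

lemma ctxD:
  assumes "ctx n g b s"
  shows "reg s R = n" "reg s (Suc R) = g" "reg s (R + 2) = n div k" "reg s (R + 3) = b" "reg s (R + 4) = 2 ^ b"
    "reg s (R + 5) = 2 ^ (l * b)" "reg s (R + 6) = n * n" "reg s (R + 7) = g * 2 ^ b"
    "reg s (R + 8) = n * (g * 2 ^ b)" "reg s (R + 9) = g * 2 ^ (l * b)" "reg s (R + 10) = n * (g * 2 ^ (l * b))"
    "reg s (R + 11) = 3 + n * n + n * (n * (g * 2 ^ b))"
    "reg s (R + 12) = 3 + n * n + n * (n * (g * 2 ^ b)) + 2 ^ (l * b)"
    "reg s (R + 13) = 3 + n * n + n * (n * (g * 2 ^ (l * b)))"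
    "reg s (R + 14) = g + (k + 2)"
  using assms[unfolded ctx_def, rule_format, of 0] assms[unfolded ctx_def, rule_format, of 1]
    assms[unfolded ctx_def, rule_format, of 2] assms[unfolded ctx_def, rule_format, of 3]
    assms[unfolded ctx_def, rule_format, of 4] assms[unfolded ctx_def, rule_format, of 5]
    assms[unfolded ctx_def, rule_format, of 6] assms[unfolded ctx_def, rule_format, of 7]
    assms[unfolded ctx_def, rule_format, of 8] assms[unfolded ctx_def, rule_format, of 9]
    assms[unfolded ctx_def, rule_format, of 10] assms[unfolded ctx_def, rule_format, of 11]
    assms[unfolded ctx_def, rule_format, of 12] assms[unfolded ctx_def, rule_format, of 13]
    assms[unfolded ctx_def, rule_format, of 14]
  by (simp_all add: config_def Let_def)

lemma ctx_cong: "ctx n g b s \<Longrightarrow> (\<And>r. R \<le> r \<Longrightarrow> r < R + 15 \<Longrightarrow> reg s' r = reg s r) \<Longrightarrow> ctx n g b s'"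
  by (auto simp: ctx_def)

definition src :: "nat list \<Rightarrow> ex \<Rightarrow> ex" where
  "src a x = lookup (x [div] vm) (zip [0..<k] a) [*] vm [+] x [mod] vm"

text \<open>The two tests against \<open>vn\<close> protect the read in \<open>c\<close>: for a
  source beyond the last vertex its address could belong to other data. Only the chosen branch of
  \<open>Ite\<close> is evaluated.\<close>

definition guard :: "nat list \<Rightarrow> ex \<Rightarrow> ex \<Rightarrow> ex \<Rightarrow> ex" where
  "guard a x y c =
     Ite (x [div] vm [<] Num k) (Ite (y [div] vm [<] Num k)
       (Ite (x [div] vm [=] y [div] vm) (Num 0)
         (Ite (src a x [<] vn) (Ite (src a y [<] vn) c (Num 0)) (Num 0))) (Num 0)) (Num 0)"

definition adj_cell :: "nat list \<Rightarrow> ex \<Rightarrow> ex \<Rightarrow> ex" where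
  "adj_cell a x y = guard a x y (Ld A (Num 3 [+] (src a x [*] vn [+] src a y)))"

definition member :: "nat list \<Rightarrow> ex \<Rightarrow> ex \<Rightarrow> ex \<Rightarrow> ex \<Rightarrow> ex" where
  "member a x y i v =
     Ld A (Num 3 [+] vnn [+] (src a x [*] vngM [+] (src a y [*] vgM [+] (i [*] vM [+] v))))"

definition pair_no :: "ex \<Rightarrow> ex \<Rightarrow> ex" where
  "pair_no x y =
     (let P = x [div] vm; Q = y [div] vm
      in lookup (Ite (P [<] Q) (P [*] Num k [+] Q) (Q [*] Num k [+] P))
           (zip (map (\<lambda>(p, q). p * k + q) (pairs k)) [0..<l]))"

text \<open>Membership in \<open>recode\<close> is decided for one element at a time, so no recoded
  set is ever formed. The comparison of \<open>v\<close> with \<open>vM\<close> comes before the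
  read because a quotient of \<open>M\<close> or more lies in no label but could address a cell of
  another one.\<close>

definition label_cell :: "nat list \<Rightarrow> ex \<Rightarrow> ex \<Rightarrow> ex \<Rightarrow> ex \<Rightarrow> ex" where
  "label_cell a x y i u =
     (let j = pair_no x y; u' = (vN [-] u) [mod] vN; M_j = Bin Shl (Num 1) (vb [*] j); v = u' [div] M_j
      in guard a x y
        (Ite (j [=] Num 0) (Ite (Ld A (voff [+] u)) (member a x y i (u [mod] vM)) (Num 0))
          (Ite (v [<] vM)
            (Ite (j [=] Num 1) (member a x y i v) (Ite (u' [mod] M_j) (Num 0) (member a x y i v)))
            (Num 0))))"

text \<open>The new instance as a function of the position, so that a single loop writes it in
  constant time per word.\<close>

definition cell :: "nat list \<Rightarrow> ex" where
  "cell a =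
     (let t = vi [-] Num 3; t' = t [-] vnn; t1 = t' [mod] vngN; t2 = t1 [mod] vgN
      in Ite (vi [<] Num 3) (Ite (vi [=] Num 0) vn (Ite (vi [=] Num 1) vg (Num l [*] vb)))
        (Ite (t [<] vnn) (adj_cell a (t [div] vn) (t [mod] vn))
          (label_cell a (t' [div] vngN) (t1 [div] vgN) (t2 [div] vN) (t2 [mod] vN))))"

lemma vars_src: "vars (src a x) \<subseteq> insert (R + 2) (vars x)"
  using vars_lookup[of "x [div] vm" "zip [0..<k] a"] by (auto simp: src_def)

lemma vars_pair_no: "vars (pair_no x y) \<subseteq> insert (R + 2) (vars x \<union> vars y)"
  unfolding pair_no_def Let_def by (rule order_trans[OF vars_lookup]) auto

lemma arrs_src: "arrs (src a x) \<subseteq> arrs x"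
  using arrs_lookup[of "x [div] vm" "zip [0..<k] a"] by (auto simp: src_def)

lemma arrs_pair_no: "arrs (pair_no x y) \<subseteq> arrs x \<union> arrs y"
  unfolding pair_no_def Let_def by (rule order_trans[OF arrs_lookup]) auto

lemma vars_guard: "vars (guard a x y c) \<subseteq> {R, R + 2} \<union> vars x \<union> vars y \<union> vars c"
  using vars_src[of a x] vars_src[of a y] by (auto simp: guard_def)

lemma arrs_guard: "arrs (guard a x y c) \<subseteq> arrs x \<union> arrs y \<union> arrs c"
  using arrs_src[of a x] arrs_src[of a y] by (auto simp: guard_def)

lemma vars_adj_cell: "vars (adj_cell a x y) \<subseteq> {R, R + 2} \<union> vars x \<union> vars y"
  using vars_src[of a x] vars_src[of a y] unfolding adj_cell_def
  by (intro order_trans[OF vars_guard]) auto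

lemma arrs_adj_cell: "arrs (adj_cell a x y) \<subseteq> {A} \<union> arrs x \<union> arrs y"
  using arrs_src[of a x] arrs_src[of a y] unfolding adj_cell_def
  by (intro order_trans[OF arrs_guard]) auto

lemma vars_member: "vars (member a x y i v) \<subseteq> {..<R + 15} \<union> vars x \<union> vars y \<union> vars i \<union> vars v"
  using vars_src[of a x] vars_src[of a y] by (auto simp: member_def)

lemma arrs_member: "arrs (member a x y i v) \<subseteq> {A} \<union> arrs x \<union> arrs y \<union> arrs i \<union> arrs v"
  using arrs_src[of a x] arrs_src[of a y] by (auto simp: member_def)

lemma vars_label_cell: "vars (label_cell a x y i u) \<subseteq> {..<R + 15} \<union> vars x \<union> vars y \<union> vars i \<union> vars u"
  unfolding label_cell_def Let_def
  by (intro order_trans[OF vars_guard] Un_least)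
     (use vars_member[of a x y i] vars_pair_no[of x y] in \<open>fastforce+\<close>)

lemma arrs_label_cell: "arrs (label_cell a x y i u) \<subseteq> {A} \<union> arrs x \<union> arrs y \<union> arrs i \<union> arrs u"
  unfolding label_cell_def Let_def
  by (intro order_trans[OF arrs_guard] Un_least)
     (use arrs_member[of a x y i] arrs_pair_no[of x y] in \<open>fastforce+\<close>)

lemma vars_cell: "vars (cell a) \<subseteq> {..<z}"
  unfolding cell_def Let_def vars.simps
  by (intro Un_least order_trans[OF vars_adj_cell] order_trans[OF vars_label_cell]) auto

text \<open>The cells are computed from the copy in array \<open>A\<close>, never from array 0 while
  it is being overwritten; this is the hypothesis of \<open>iterate_fill\<close>.\<close>

lemma arrs_cell: "0 \<notin> arrs (cell a)"
proof -
  have "arrs (cell a) \<subseteq> {A}"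
    unfolding cell_def Let_def arrs.simps
    by (intro Un_least order_trans[OF arrs_adj_cell] order_trans[OF arrs_label_cell]) auto
  then show ?thesis using A2 by auto
qed

end

lemma mult_add_div_mod:
  fixes q d r :: nat
  assumes "r < d"
  shows "(q * d + r) div d = q" "(q * d + r) mod d = r"
  using assms by auto

lemma label_index:
  fixes X Y i v n g M :: nat
  assumes "X < n" "Y < n" "i < g" "v < M"
  defines "t \<equiv> X * (n * (g * M)) + (Y * (g * M) + (i * M + v))"
  shows "t < n * (n * (g * M))" "label_bit n g M E e t \<longleftrightarrow> E X Y \<and> v \<in> e X Y ! i"
proof -
  have 1: "i * M + v < g * M" by (intro mult_add_less assms)
  have 2: "Y * (g * M) + (i * M + v) < n * (g * M)" by (intro mult_add_less assms 1)
  show "t < n * (n * (g * M))" unfolding t_def by (intro mult_add_less assms 2)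
  have "t div (n * (g * M)) = X" "t mod (n * (g * M)) = Y * (g * M) + (i * M + v)"
    unfolding t_def by (rule mult_add_div_mod[OF 2])+
  moreover have "(Y * (g * M) + (i * M + v)) div (g * M) = Y" "(Y * (g * M) + (i * M + v)) mod (g * M) = i * M + v"
    by (rule mult_add_div_mod[OF 1])+
  moreover have "(i * M + v) div M = i" "(i * M + v) mod M = v" using assms by auto
  ultimately show "label_bit n g M E e t \<longleftrightarrow> E X Y \<and> v \<in> e X Y ! i"
    by (simp add: label_bit_def Let_def)
qed

text \<open>The \<open>fit_\<close> assumptions are the overflow bounds of the program;
  \<open>solvable_transfer\<close> derives them from the word size. \<open>fit_gN\<close> is listed
  separately because \<open>fit_len\<close> does not imply it for \<open>n = 0\<close>.\<close>

locale reduction = program +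
  fixes n g b w :: nat and E :: "nat \<Rightarrow> nat \<Rightarrow> bool" and e :: "nat \<Rightarrow> nat \<Rightarrow> nat set list"
    and f :: "nat list \<Rightarrow> bool"
  assumes graph: "factored_graph n g b E e"
    and w1: "w \<ge> 1"
    and fit_len: "3 + n * n + n * (n * (g * 2 ^ (l * b))) + 2 ^ (l * b) < 2 ^ w"
    and fit_gN: "g * 2 ^ (l * b) < 2 ^ w"
    and fit_src: "(2 * k + 1) * (n + 1) < 2 ^ w"
    and fit_pairs: "k * k < 2 ^ w"
    and fit_nd: "g + (k + 2) < 2 ^ w"
    and fit_fact: "2 * (fact k * fact k) < (2::nat) ^ w"
begin

abbreviation "m \<equiv> n div k"
abbreviation "Ea a \<equiv> red_edge k m a E"
abbreviation "ea a \<equiv> red_label k m a g (2 ^ b) f E e"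
abbreviation "xs \<equiv> enc_graph n g b E e @ enc_fun k b f"
abbreviation "tuples \<equiv> {a. length a = k \<and> set a \<subseteq> {..<2 * k}}"

text \<open>The invariant between rounds: parameters and input copy are intact, while array 0 and
  the solver's own storage may hold anything.\<close>

definition ready :: "state \<Rightarrow> bool" where
  "ready s \<longleftrightarrow> ctx n g b s \<and> (\<forall>i<length xs. mem s A i = xs ! i)"

lemma l_ge: "l \<ge> 1"
  using choose_two_ge[OF k3] by simp

lemma length_xs: "length xs = 3 + n * n + n * (n * (g * 2 ^ b)) + 2 ^ (l * b)"
  by (simp add: length_enc_graph enc_fun_eq power_mult[symmetric] mult.commute)

lemma M_le_N: "(2::nat) ^ b \<le> 2 ^ (l * b)"
  using l_ge by (intro power_increasing) auto

lemma off_le: "n * (n * (g * 2 ^ b)) \<le> n * (n * (g * 2 ^ (l * b)))"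
  using M_le_N by simp

lemma length_xs_less: "length xs < 2 ^ w"
  using fit_len off_le unfolding length_xs by linarith

lemma k_less: "k < 2 ^ w"
  using fit_nd by simp

lemma ready_regs: "ready s \<Longrightarrow> ctx n g b s"
  by (simp add: ready_def)

lemma ready_mem: "ready s \<Longrightarrow> i < length xs \<Longrightarrow> mem s A i = xs ! i"
  by (simp add: ready_def)

lemma ev_src:
  assumes s: "ready s" and a: "a \<in> tuples" and x: "ev w s x = X" "X < n" "X div m < k"
  shows "ev w s (src a x) = source m a X"
proof -
  note c = ctxD[OF ready_regs[OF s]]
  let ?P = "X div m"
  have aP: "a ! ?P < 2 * k" using a x(3) nth_mem[of ?P a] by blast
  have P: "ev w s (x [div] vm) = ?P" using x(1) c by simp
  have "ev w s (lookup (x [div] vm) (zip [0..<k] a)) = a ! ?P"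
  proof (rule ev_lookup[OF w1])
    show "distinct (map fst (zip [0..<k] a))" using a by simp
    show "(ev w s (x [div] vm), a ! ?P) \<in> set (zip [0..<k] a)"
      unfolding P using a x(3) by (auto simp: set_zip intro!: exI[of _ ?P])
    fix c v assume "(c, v) \<in> set (zip [0..<k] a)"
    then have "c < k" "v \<in> set a" by (auto dest: set_zip_leftD set_zip_rightD)
    then have "c < k" "v < 2 * k" using a by auto
    then show "c < 2 ^ w \<and> v < 2 ^ w" using fit_src by auto
  qed
  note lk = this
  \<comment> \<open>The block may lie beyond the last vertex, so the source is bounded by a multiple
    of \<open>n\<close> rather than by \<open>n\<close>.\<close>
  have "a ! ?P * m \<le> 2 * k * n" using aP by (intro mult_le_mono) auto
  moreover have "X mod m \<le> n" using x(2) mod_less_eq_dividend[of X m] by linarith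
  moreover have "2 * k * n + n < 2 ^ w" using fit_src by (simp add: algebra_simps)
  ultimately have b: "a ! ?P * m + X mod m < 2 ^ w" by linarith
  then have "ev w s (lookup (x [div] vm) (zip [0..<k] a) [*] vm) = a ! ?P * m"
    using lk c by (subst ev_arith(2)) auto
  then show ?thesis
    unfolding src_def source_def using b x(1) c by (subst ev_arith(1)) auto
qed

lemma ev_guard:
  assumes s: "ready s" and a: "a \<in> tuples" and x: "ev w s x = X" "X < n" and y: "ev w s y = Y" "Y < n"
  shows "ev w s (guard a x y c) =
    (if X div m < k \<and> Y div m < k \<and> X div m \<noteq> Y div m \<and> source m a X < n \<and> source m a Y < n then ev w s c else 0)"
proof -
  note c = ctxD[OF ready_regs[OF s]]
  have P: "ev w s (x [div] vm) = X div m" "ev w s (y [div] vm) = Y div m" using x y c by simp_all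
  have K: "ev w s (Num k) = k" "ev w s (Num 0) = 0" "ev w s vn = n" using k_less c by simp_all
  show ?thesis
    unfolding guard_def using ev_src[OF s a x] ev_src[OF s a y]
    by (auto simp only: ev.simps(5) ev_test[OF w1] P K split: if_splits) auto
qed

lemma mem_adj:
  assumes "ready s" "X < n" "Y < n"
  shows "mem s A (3 + (X * n + Y)) = of_bool (E X Y)"
proof -
  have "X * n + Y < n * n" by (intro mult_add_less assms)
  then have "3 + (X * n + Y) < length (enc_graph n g b E e)" by (simp add: length_enc_graph)
  moreover have "(X * n + Y) div n = X" "(X * n + Y) mod n = Y" using assms by auto
  ultimately show ?thesis
    using ready_mem[OF assms(1), of "3 + (X * n + Y)"] \<open>X * n + Y < n * n\<close>
    by (simp add: nth_append nth_enc_graph length_enc_graph)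
qed

lemma ev_adj_cell:
  assumes s: "ready s" and a: "a \<in> tuples" and x: "ev w s x = X" "X < n" and y: "ev w s y = Y" "Y < n"
  shows "ev w s (adj_cell a x y) = of_bool (Ea a X Y)"
proof (cases "X div m < k \<and> Y div m < k \<and> X div m \<noteq> Y div m \<and> source m a X < n \<and> source m a Y < n")
  case True
  note c = ctxD[OF ready_regs[OF s]]
  let ?X = "source m a X" and ?Y = "source m a Y"
  have sx: "ev w s (src a x) = ?X" using ev_src[OF s a x] True by simp
  have sy: "ev w s (src a y) = ?Y" using ev_src[OF s a y] True by simp
  have "?X * n + ?Y < n * n" using True by (intro mult_add_less) auto
  then have b: "3 + (?X * n + ?Y) < 2 ^ w" using fit_len by linarith
  have "ev w s (src a x [*] vn) = ?X * n" using sx c b by (subst ev_arith(2)) auto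
  then have "ev w s (src a x [*] vn [+] src a y) = ?X * n + ?Y" using sy b by (subst ev_arith(1)) auto
  moreover have "ev w s (Num 3) = 3" using b by simp
  ultimately have "ev w s (Num 3 [+] (src a x [*] vn [+] src a y)) = 3 + (?X * n + ?Y)"
    using b by (subst ev_arith(1)) auto
  then show ?thesis
    using True mem_adj[OF s, of ?X ?Y]
    unfolding adj_cell_def ev_guard[OF s a x y] by (simp add: red_edge_def)
next
  case False
  have "\<not> Ea a X Y" using False graph by (auto simp: red_edge_def factored_graph_def)
  then show ?thesis using False unfolding adj_cell_def ev_guard[OF s a x y] by auto
qed

lemma ev_member:
  assumes s: "ready s" and X: "ev w s (src a x) = X" "X < n" and Y: "ev w s (src a y) = Y" "Y < n"
    and i: "ev w s i = I" "I < g" and v: "ev w s v = V" "V < 2 ^ b"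
  shows "ev w s (member a x y i v) = of_bool (E X Y \<and> V \<in> e X Y ! I)"
proof -
  note c = ctxD[OF ready_regs[OF s]]
  define t where "t = X * (n * (g * 2 ^ b)) + (Y * (g * 2 ^ b) + (I * 2 ^ b + V))"
  have t: "t < n * (n * (g * 2 ^ b))" "label_bit n g (2 ^ b) E e t \<longleftrightarrow> E X Y \<and> V \<in> e X Y ! I"
    unfolding t_def using label_index[OF X(2) Y(2) i(2) v(2)] by blast+
  have len: "3 + n * n + t < length (enc_graph n g b E e)" using t(1) by (simp add: length_enc_graph)
  then have b: "3 + n * n + t < 2 ^ w" using length_xs_less by simp
  have "ev w s (i [*] vM) = I * 2 ^ b" using i c b by (subst ev_arith(2)) (auto simp: t_def)
  then have 1: "ev w s (i [*] vM [+] v) = I * 2 ^ b + V" using v b by (subst ev_arith(1)) (auto simp: t_def)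
  have "ev w s (src a y [*] vgM) = Y * (g * 2 ^ b)" using Y c b by (subst ev_arith(2)) (auto simp: t_def)
  with 1 have 2: "ev w s (src a y [*] vgM [+] (i [*] vM [+] v)) = Y * (g * 2 ^ b) + (I * 2 ^ b + V)"
    using b by (subst ev_arith(1)) (auto simp: t_def simp del: ev.simps)
  have "ev w s (src a x [*] vngM) = X * (n * (g * 2 ^ b))" using X c b by (subst ev_arith(2)) (auto simp: t_def)
  with 2 have 3: "ev w s (src a x [*] vngM [+] (src a y [*] vgM [+] (i [*] vM [+] v))) = t"
    using b by (subst ev_arith(1)) (auto simp: t_def simp del: ev.simps)
  have "ev w s (Num 3 [+] vnn) = 3 + n * n" using c b by (subst ev_arith(1)) auto
  with 3 have "ev w s (Num 3 [+] vnn [+] (src a x [*] vngM [+] (src a y [*] vgM [+] (i [*] vM [+] v)))) = 3 + n * n + t"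
    using b by (subst ev_arith(1)) (auto simp del: ev.simps)
  then have "ev w s (member a x y i v) = mem s A (3 + n * n + t)" by (simp add: member_def)
  also have "\<dots> = enc_graph n g b E e ! (3 + n * n + t)"
    using ready_mem[OF s, of "3 + n * n + t"] len by (simp add: nth_append)
  also have "\<dots> = of_bool (label_bit n g (2 ^ b) E e t)"
    using len by (subst nth_enc_graph) (auto simp: length_enc_graph)
  finally show ?thesis using t(2) by simp
qed

lemma ev_pair_no:
  assumes s: "ready s" and x: "ev w s x = X" and y: "ev w s y = Y"
    and XY: "X div m < k" "Y div m < k" "X div m \<noteq> Y div m"
  shows "ev w s (pair_no x y) = pair_index k (min (X div m) (Y div m)) (max (X div m) (Y div m))"
    "ev w s (pair_no x y) < l"
proof -
  note c = ctxD[OF ready_regs[OF s]]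
  define p q where "p = min (X div m) (Y div m)" and "q = max (X div m) (Y div m)"
  have pq: "p < q" "q < k" using XY by (auto simp: p_def q_def)
  then obtain j where j: "j < length (pairs k)" "pairs k ! j = (p, q)"
    by (metis (mono_tags, lifting) case_prodI in_set_conv_nth mem_Collect_eq set_pairs)
  have key_less: "p * k + q < k * k" if "p < k" "q < k" for p q using that by (rule mult_add_less)
  have P: "ev w s (x [div] vm) = X div m" "ev w s (y [div] vm) = Y div m" using x y c by simp_all
  have K: "ev w s (Num k) = k" using k_less by simp
  have kk: "p * k + q < 2 ^ w" if "p < k" "q < k" for p q using key_less[OF that] fit_pairs by simp
  have lin: "ev w s (u [*] Num k [+] v) = p * k + q" if "ev w s u = p" "ev w s v = q" "p < k" "q < k" for u v p q
  proof -
    have "ev w s (u [*] Num k) = p * k" using kk[OF that(3,4)] that K by (subst ev_arith(2)) (auto simp del: ev.simps)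
    then show ?thesis using kk[OF that(3,4)] that by (subst ev_arith(1)) (auto simp del: ev.simps)
  qed
  let ?key = "Ite (x [div] vm [<] y [div] vm) (x [div] vm [*] Num k [+] y [div] vm) (y [div] vm [*] Num k [+] x [div] vm)"
  have key: "ev w s ?key = p * k + q"
    unfolding ev.simps(5) ev_test[OF w1] P using lin[OF P] lin[OF P(2,1)] XY by (auto simp: p_def q_def simp del: ev.simps)
  let ?kvs = "zip (map (\<lambda>(p, q). p * k + q) (pairs k)) [0..<l]"
  have "ev w s (lookup ?key ?kvs) = j"
  proof (rule ev_lookup[OF w1])
    have "inj_on (\<lambda>(p, q). p * k + q) (set (pairs k))"
    proof (rule inj_onI, clarsimp simp: set_pairs)
      fix p q p' q' assume *: "p < q" "q < k" "p' < q'" "q' < k" "p * k + q = p' * k + q'"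
      show "p = p' \<and> q = q'" using mult_add_div_mod[OF *(2), of p] mult_add_div_mod[OF *(4), of p'] *(5) by simp
    qed
    then show "distinct (map fst ?kvs)" by (simp add: length_pairs distinct_map distinct_pairs)
    show "(ev w s ?key, j) \<in> set ?kvs"
      unfolding key using j by (auto simp: set_zip length_pairs intro!: exI[of _ j])
    fix c v assume "(c, v) \<in> set ?kvs"
    then have "c \<in> set (map (\<lambda>(p, q). p * k + q) (pairs k))" "v \<in> set [0..<l]"
      by (auto dest: set_zip_leftD set_zip_rightD)
    then have "c < k * k" "v < l" using key_less by (auto simp: set_pairs)
    moreover have "l \<le> k * k" by (simp add: choose_two div_le_dividend le_trans[OF div_le_dividend])
    ultimately show "c < 2 ^ w \<and> v < 2 ^ w" using fit_pairs by simp
  qed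
  then have "ev w s (pair_no x y) = j" by (simp add: pair_no_def Let_def)
  then show "ev w s (pair_no x y) = pair_index k (min (X div m) (Y div m)) (max (X div m) (Y div m))"
    "ev w s (pair_no x y) < l"
    using pair_index_nth[OF j] j by (simp_all add: p_def q_def length_pairs)
qed

end

lemma less_15_cases: "(j::nat) < 15 \<Longrightarrow> j \<in> {0,1,2,3,4,5,6,7,8,9,10,11,12,13,14}"
  by (simp add: eval_nat_numeral less_Suc_eq)

context reduction
begin

lemma power_exp: "((2::nat) ^ b) ^ j = 2 ^ (b * j)"
  by (simp add: power_mult)

lemma ev_label_cell:
  assumes s: "ready s" and a: "a \<in> tuples" and x: "ev w s x = X" "X < n" and y: "ev w s y = Y" "Y < n"
    and i: "ev w s i = I" "I < g" and u: "ev w s u = U" "U < 2 ^ (l * b)"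
  shows "ev w s (label_cell a x y i u) = of_bool (Ea a X Y \<and> U \<in> ea a X Y ! I)"
proof (cases "X div m < k \<and> Y div m < k \<and> X div m \<noteq> Y div m \<and> source m a X < n \<and> source m a Y < n")
  case True
  note c = ctxD[OF ready_regs[OF s]]
  let ?X = "source m a X" and ?Y = "source m a Y" and ?N = "2 ^ (l * b) :: nat" and ?M = "2 ^ b :: nat"
  define J where "J = pair_index k (min (X div m) (Y div m)) (max (X div m) (Y div m))"
  have J: "ev w s (pair_no x y) = J" "J < l"
    using ev_pair_no[OF s x(1) y(1)] True by (auto simp: J_def)
  have sx: "ev w s (src a x) = ?X" using ev_src[OF s a x] True by simp
  have sy: "ev w s (src a y) = ?Y" using ev_src[OF s a y] True by simp
  have mem: "ev w s (member a x y i v) = of_bool (E ?X ?Y \<and> V \<in> e ?X ?Y ! I)" if "ev w s v = V" "V < ?M" for v V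
    using ev_member[OF s sx _ sy _ i that] True by simp
  have NW: "?N < 2 ^ w" using fit_len by linarith
  \<comment> \<open>Elements of edge labels are below \<open>M\<close>, so the test
    \<open>v [<] vM\<close> rejects no member.\<close>
  have sub: "e ?X ?Y ! I \<subseteq> {..<?M}" if "E ?X ?Y"
    using that graph i(2) by (auto simp: factored_graph_def factored_vector_def)
  have N: "?M ^ l = ?N" by (simp add: power_exp mult.commute)
  have rhs: "(Ea a X Y \<and> U \<in> ea a X Y ! I) \<longleftrightarrow> E ?X ?Y \<and> U \<in> recode ?M l f J (e ?X ?Y ! I)"
    using True i(2) by (simp add: red_edge_def red_label_def J_def)
  let ?u' = "(vN [-] u) [mod] vN" and ?Mj = "Bin Shl (Num 1) (vb [*] pair_no x y)"
  have "ev w s (vN [-] u) = ?N - U" using c u NW by (subst ev_arith(3)) auto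
  then have u': "ev w s ?u' = neg_mod ?N U" using c by (simp add: neg_mod_def)
  have "b * J \<le> l * b" using J(2) by (simp add: mult.commute)
  moreover have "l * b < ?N" by (rule less_exp)
  ultimately have "b * J < 2 ^ w" using NW by linarith
  then have bJ: "ev w s (vb [*] pair_no x y) = b * J" using c J(1) by (subst ev_arith(2)) auto
  have "(2::nat) ^ (b * J) \<le> ?N" using \<open>b * J \<le> l * b\<close> by (intro power_increasing) auto
  then have "(2::nat) ^ (b * J) < 2 ^ w" using NW by linarith
  then have Mj: "ev w s ?Mj = ?M ^ J"
    using bJ ev_arith(5)[of 1 w s] w1 one_less_power[of "2::nat" w] by (subst ev_arith(4)) (auto simp: power_exp simp del: ev.simps)
  have v: "ev w s (?u' [div] ?Mj) = neg_mod ?N U div ?M ^ J" "ev w s (?u' [mod] ?Mj) = neg_mod ?N U mod ?M ^ J"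
    using u' Mj by (simp_all del: ev.simps add: ev.simps(3))
  have F: "ev w s (Ld A (voff [+] u)) = of_bool (f (digits ?M l U))"
  proof -
    have len: "3 + n * n + n * (n * (g * 2 ^ b)) + U < length xs" using u(2) length_xs by linarith
    then have "ev w s (voff [+] u) = 3 + n * n + n * (n * (g * 2 ^ b)) + U"
      using c u(1) length_xs_less by (subst ev_arith(1)) auto
    then have "ev w s (Ld A (voff [+] u)) = xs ! (length (enc_graph n g b E e) + U)"
      using ready_mem[OF s len] by (simp add: length_enc_graph)
    then show ?thesis using u(2) by (simp add: enc_fun_eq N)
  qed
  have one: "(1::nat) < 2 ^ w" using w1 by (intro one_less_power) auto
  have const: "ev w s (Num 0) = 0" "ev w s (Num 1) = 1" "ev w s vM = ?M" using c one w1 by simp_all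
  have m0: "ev w s (u [mod] vM) = U mod ?M" using u(1) c by simp
  let ?v = "?u' [div] ?Mj"
  have "ev w s (label_cell a x y i u) =
    (if J = 0 then if f (digits ?M l U) then ev w s (member a x y i (u [mod] vM)) else 0
     else if neg_mod ?N U div ?M ^ J < ?M then
       if J = 1 then ev w s (member a x y i ?v)
       else if neg_mod ?N U mod ?M ^ J \<noteq> 0 then 0 else ev w s (member a x y i ?v)
     else 0)"
    unfolding label_cell_def Let_def ev_guard[OF s a x y] ev.simps(5) ev_test[OF w1] J(1) const F v
    using True by (simp del: ev.simps)
  also have "\<dots> = of_bool (E ?X ?Y \<and> U \<in> recode ?M l f J (e ?X ?Y ! I))"
    using mem[OF m0] mem[OF v(1)] sub u(2) by (auto simp: recode_def N)
  finally show ?thesis unfolding rhs .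
next
  case False
  have "\<not> Ea a X Y" using False graph by (auto simp: red_edge_def factored_graph_def)
  then show ?thesis using False unfolding label_cell_def Let_def ev_guard[OF s a x y] by auto
qed

lemma ev_cell:
  assumes s: "ready s" and a: "a \<in> tuples" and t: "reg s (R + 15) = t"
    and tl: "t < 3 + n * n + n * (n * (g * 2 ^ (l * b)))"
  shows "ev w s (cell a) = enc_graph n g (l * b) (Ea a) (ea a) ! t"
proof -
  note c = ctxD[OF ready_regs[OF s]]
  let ?N = "2 ^ (l * b) :: nat"
  have tw: "t < 2 ^ w" using tl fit_len by linarith
  have "l * b < ?N" by (rule less_exp)
  then have lbw: "l * b < 2 ^ w" using fit_len by linarith
  have "l \<le> k * k" by (simp add: choose_two div_le_dividend le_trans[OF div_le_dividend])
  then have lw: "l < 2 ^ w" using fit_pairs by simp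
  have three: "(3::nat) < 2 ^ w" using fit_len by linarith
  have const: "ev w s (Num 3) = 3" "ev w s (Num 0) = 0" "ev w s (Num 1) = 1" "ev w s vi = t" "ev w s vn = n" "ev w s vg = g"
    "ev w s vnn = n * n"
    using three t c w1 by simp_all
  have lb: "ev w s (Num l [*] vb) = l * b" using lw lbw c by (subst ev_arith(2)) auto
  show ?thesis
  proof (cases "t < 3")
    case True
    then have "t = 0 \<or> t = 1 \<or> t = 2" by auto
    then show ?thesis
      unfolding cell_def Let_def ev.simps(5) ev_test[OF w1] const lb nth_enc_graph[OF tl] by auto
  next
    case False
    have t3: "ev w s (vi [-] Num 3) = t - 3"
      using False tw const by (subst ev_arith(3)) (auto simp del: ev.simps)
    show ?thesis
    proof (cases "t - 3 < n * n")
      case True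
      then have n: "n > 0" by (cases n) auto
      have "ev w s ((vi [-] Num 3) [div] vn) = (t - 3) div n" "ev w s ((vi [-] Num 3) [mod] vn) = (t - 3) mod n"
        using t3 const by (simp_all del: ev.simps add: ev.simps(3))
      moreover have "(t - 3) div n < n" "(t - 3) mod n < n" using True n by (auto simp: less_mult_imp_div_less)
      ultimately have "ev w s (adj_cell a ((vi [-] Num 3) [div] vn) ((vi [-] Num 3) [mod] vn)) =
          of_bool (Ea a ((t - 3) div n) ((t - 3) mod n))"
        using ev_adj_cell[OF s a] by blast
      then show ?thesis
        unfolding cell_def Let_def ev.simps(5) ev_test[OF w1] const t3 nth_enc_graph[OF tl]
        using False True by auto
    next
      case big: False
      let ?t = "t - 3 - n * n"
      let ?t1 = "?t mod (n * (g * ?N))"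
      let ?t2 = "?t1 mod (g * ?N)"
      let ?e = "vi [-] Num 3 [-] vnn"
      have tt: "ev w s ?e = ?t"
        using big tw t3 const by (subst ev_arith(3)) (auto simp del: ev.simps)
      have less: "?t < n * (n * (g * ?N))" using tl big False by linarith
      then have pos: "n * (g * ?N) > 0" "g * ?N > 0" by (auto intro: gr0I)
      have X: "ev w s (?e [div] vngN) = ?t div (n * (g * ?N))" "?t div (n * (g * ?N)) < n"
        using tt c less by (simp_all del: ev.simps add: ev.simps(2,3) less_mult_imp_div_less)
      have t1: "ev w s (?e [mod] vngN) = ?t1" using tt c by (simp del: ev.simps add: ev.simps(2,3))
      have t1l: "?t1 < n * (g * ?N)" using pos by simp
      have Y: "ev w s (?e [mod] vngN [div] vgN) = ?t1 div (g * ?N)" "?t1 div (g * ?N) < n"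
        using t1 c t1l by (simp_all del: ev.simps add: ev.simps(2,3) less_mult_imp_div_less)
      have t2: "ev w s (?e [mod] vngN [mod] vgN) = ?t2" using t1 c by (simp del: ev.simps add: ev.simps(2,3))
      have t2l: "?t2 < g * ?N" using pos by simp
      have I: "ev w s (?e [mod] vngN [mod] vgN [div] vN) = ?t2 div ?N" "?t2 div ?N < g"
        using t2 c t2l by (simp_all del: ev.simps add: ev.simps(2,3) less_mult_imp_div_less)
      have U: "ev w s (?e [mod] vngN [mod] vgN [mod] vN) = ?t2 mod ?N" "?t2 mod ?N < ?N"
        using t2 c by (simp_all del: ev.simps add: ev.simps(2,3))
      have "ev w s (label_cell a (?e [div] vngN) (?e [mod] vngN [div] vgN) (?e [mod] vngN [mod] vgN [div] vN)
          (?e [mod] vngN [mod] vgN [mod] vN)) = of_bool (label_bit n g ?N (Ea a) (ea a) ?t)"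
        unfolding ev_label_cell[OF s a X Y I U] by (simp add: label_bit_def Let_def)
      moreover have "\<not> t < 3 + n * n" "t \<noteq> 0" "t \<noteq> 1" "t \<noteq> 2" using False big by linarith+
      ultimately show ?thesis
        unfolding cell_def Let_def ev.simps(5) ev_test[OF w1] const t3 nth_enc_graph[OF tl]
        using False big by (simp only: of_bool_def if_False simp_thms if_True if_cancel)
    qed
  qed
qed

end

section \<open>Initialising the parameters\<close>

context program
begin

text \<open>The order matters: each entry refers only to registers assigned before it, and
  \<open>fold_assigns\<close> exploits this.\<close>

definition init_exps :: "ex list" where
  "init_exps = [Ld 0 (Num 0), Ld 0 (Num 1), vn [div] Num k, Ld 0 (Num 2), Bin Shl (Num 1) vb,
     Bin Shl (Num 1) (Num l [*] vb), vn [*] vn, vg [*] vM, vn [*] vgM, vg [*] vN, vn [*] vgN,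
     Num 3 [+] vnn [+] vn [*] vngM, voff [+] vN, Num 3 [+] vnn [+] vn [*] vngN, vg [+] Num (k + 2)]"

definition init_block :: "stmt list" where
  "init_block = map (\<lambda>j. Asg (R + j) (init_exps ! j)) [0..<15]"

lemma fold_assigns:
  assumes "\<And>j s'. j < N \<Longrightarrow> mem s' = mem s \<Longrightarrow> (\<And>i. i < j \<Longrightarrow> reg s' (R + i) = vals ! i) \<Longrightarrow>
    ev w s' (es ! j) = vals ! j"
  shows "mem (fold (step w) (map (\<lambda>j. Asg (R + j) (es ! j)) [0..<N]) s) = mem s \<and>
    (\<forall>j<N. reg (fold (step w) (map (\<lambda>j. Asg (R + j) (es ! j)) [0..<N]) s) (R + j) = vals ! j)"
  using assms
proof (induction N)
  case (Suc N)
  let ?s = "fold (step w) (map (\<lambda>j. Asg (R + j) (es ! j)) [0..<N]) s"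
  have IH: "mem ?s = mem s" "\<forall>j<N. reg ?s (R + j) = vals ! j"
    using Suc.IH Suc.prems by auto
  have "ev w ?s (es ! N) = vals ! N" using IH by (intro Suc.prems) auto
  then show ?case using IH by (auto simp: less_Suc_eq)
qed simp

lemma init_block_ok: "\<forall>c\<in>set init_block. stmt_ok z c"
proof -
  have "stmt_ok z (Asg (R + j) (init_exps ! j))" if "j < 15" for j
  proof -
    have "j \<in> {0,1,2,3,4,5,6,7,8,9,10,11,12,13,14}" using that by (rule less_15_cases)
    then show ?thesis unfolding insert_iff empty_iff by (elim disjE) (auto simp: init_exps_def)
  qed
  then show ?thesis by (auto simp: init_block_def simp del: stmt_ok.simps)
qed

end

context reduction
begin

lemma init_ctx:
  assumes s: "input_state w xs s"
  shows "ctx n g b (fold (step w) init_block s)" "mem (fold (step w) init_block s) = mem s"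
proof -
  let ?M = "2 ^ b :: nat" and ?N = "2 ^ (l * b) :: nat"
  have in0: "mem s 0 0 = n" "mem s 0 1 = g" "mem s 0 2 = b"
    using s by (auto simp: input_state_def nth_append enc_graph_eq)
  have three: "(3::nat) < 2 ^ w" using fit_len by linarith
  have "l \<le> k * k" by (simp add: choose_two div_le_dividend le_trans[OF div_le_dividend])
  then have lw: "l < 2 ^ w" using fit_pairs by simp
  have "l * b < ?N" by (rule less_exp)
  then have lbw: "l * b < 2 ^ w" using fit_len by linarith
  have NW: "?N < 2 ^ w" and MW: "?M < 2 ^ w" using fit_len M_le_N by linarith+
  have nn: "n * n < 2 ^ w" using fit_len by linarith
  have ngN: "n * (g * ?N) < 2 ^ w"
  proof (cases n)
    case (Suc n')
    then have "n * (g * ?N) \<le> n * (n * (g * ?N))" by simp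
    then show ?thesis using fit_len by linarith
  qed simp
  have gM: "g * ?M \<le> g * ?N" "n * (g * ?M) \<le> n * (g * ?N)" using M_le_N by auto
  define vals where "vals = config n g b"
  have eval: "ev w s' (init_exps ! j) = vals ! j"
    if j: "j < 15" and mem: "mem s' = mem s" and regs: "\<And>i. i < j \<Longrightarrow> reg s' (R + i) = vals ! i" for j s'
  proof -
    have r: "0 < j \<Longrightarrow> ev w s' vn = n" "1 < j \<Longrightarrow> ev w s' vg = g" "3 < j \<Longrightarrow> ev w s' vb = b" "4 < j \<Longrightarrow> ev w s' vM = ?M"
      "5 < j \<Longrightarrow> ev w s' vN = ?N" "6 < j \<Longrightarrow> ev w s' vnn = n * n" "7 < j \<Longrightarrow> ev w s' vgM = g * ?M"
      "8 < j \<Longrightarrow> ev w s' vngM = n * (g * ?M)" "9 < j \<Longrightarrow> ev w s' vgN = g * ?N" "10 < j \<Longrightarrow> ev w s' vngN = n * (g * ?N)"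
      "11 < j \<Longrightarrow> ev w s' voff = 3 + n * n + n * (n * (g * ?M))"
      using regs[of 0] regs[of 1] regs[of 3] regs[of 4] regs[of 5] regs[of 6] regs[of 7] regs[of 8] regs[of 9]
        regs[of 10] regs[of 11] by (simp_all add: vals_def config_def Let_def)
    note entry = init_exps_def vals_def config_def Let_def
    have num: "ev w s' (Num 0) = 0" "ev w s' (Num 1) = 1" "ev w s' (Num 2) = 2" "ev w s' (Num 3) = 3"
      "ev w s' (Num k) = k" "ev w s' (Num l) = l" "ev w s' (Num (k + 2)) = k + 2"
      using three k_less lw fit_nd w1 by simp_all
    have "j \<in> {0,1,2,3,4,5,6,7,8,9,10,11,12,13,14}" using j by (rule less_15_cases)
    then consider "j = 0" | "j = 1" | "j = 2" | "j = 3" | "j = 4" | "j = 5" | "j = 6" | "j = 7" | "j = 8" | "j = 9"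
      | "j = 10" | "j = 11" | "j = 12" | "j = 13" | "j = 14" unfolding insert_iff empty_iff by blast
    then show ?thesis
    proof cases
      case 1 then show ?thesis using num in0 mem by (simp add: entry)
    next
      case 2 then show ?thesis using num in0 mem by (simp add: entry)
    next
      case 3 then show ?thesis using num r(1) by (simp add: entry)
    next
      case 4 then show ?thesis using num in0 mem by (simp add: entry)
    next
      case 5
      have "ev w s' (Bin Shl (Num 1) vb) = ?M" using 5 num r(3) MW by (subst ev_arith(4)) (simp_all del: ev.simps)
      then show ?thesis using 5 by (simp add: entry del: ev.simps)
    next
      case 6
      have lb: "ev w s' (Num l [*] vb) = l * b" using 6 num r(3) lbw by (subst ev_arith(2)) (simp_all del: ev.simps)
      have "ev w s' (Bin Shl (Num 1) (Num l [*] vb)) = ?N" using num lb NW by (subst ev_arith(4)) (simp_all del: ev.simps)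
      then show ?thesis using 6 by (simp add: entry del: ev.simps)
    next
      case 7
      have "ev w s' (vn [*] vn) = n * n" using 7 r(1) nn by (subst ev_arith(2)) (simp_all del: ev.simps)
      then show ?thesis using 7 by (simp add: entry del: ev.simps)
    next
      case 8
      have "g * ?M < 2 ^ w" using gM(1) fit_gN by linarith
      then have "ev w s' (vg [*] vM) = g * ?M" using 8 r(2,4) by (subst ev_arith(2)) (simp_all del: ev.simps)
      then show ?thesis using 8 by (simp add: entry del: ev.simps)
    next
      case 9
      have "n * (g * ?M) < 2 ^ w" using gM ngN by linarith
      then have "ev w s' (vn [*] vgM) = n * (g * ?M)" using 9 r(1,7) by (subst ev_arith(2)) (simp_all del: ev.simps)
      then show ?thesis using 9 by (simp add: entry del: ev.simps)
    next
      case 10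
      have "ev w s' (vg [*] vN) = g * ?N" using 10 r(2,5) fit_gN by (subst ev_arith(2)) (simp_all del: ev.simps)
      then show ?thesis using 10 by (simp add: entry del: ev.simps)
    next
      case 11
      have "ev w s' (vn [*] vgN) = n * (g * ?N)" using 11 r(1,9) ngN by (subst ev_arith(2)) (simp_all del: ev.simps)
      then show ?thesis using 11 by (simp add: entry del: ev.simps)
    next
      case 12
      have b: "3 + n * n + n * (n * (g * ?M)) < 2 ^ w" using off_le fit_len by linarith
      have 1: "ev w s' (vn [*] vngM) = n * (n * (g * ?M))" using 12 r(1,8) b by (subst ev_arith(2)) (simp_all del: ev.simps)
      have 2: "ev w s' (Num 3 [+] vnn) = 3 + n * n" using 12 r(6) num b by (subst ev_arith(1)) (simp_all del: ev.simps)
      have "ev w s' (Num 3 [+] vnn [+] vn [*] vngM) = 3 + n * n + n * (n * (g * ?M))"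
        using 1 2 b by (subst ev_arith(1)) (simp_all del: ev.simps)
      then show ?thesis using 12 by (simp add: entry del: ev.simps)
    next
      case 13
      have b: "3 + n * n + n * (n * (g * ?M)) + ?N < 2 ^ w" using off_le fit_len by linarith
      then have "ev w s' (voff [+] vN) = 3 + n * n + n * (n * (g * ?M)) + ?N"
        using 13 r(5,11) by (subst ev_arith(1)) (simp_all del: ev.simps)
      then show ?thesis using 13 by (simp add: entry del: ev.simps)
    next
      case 14
      have b: "3 + n * n + n * (n * (g * ?N)) < 2 ^ w" using fit_len by linarith
      have 1: "ev w s' (vn [*] vngN) = n * (n * (g * ?N))" using 14 r(1,10) b by (subst ev_arith(2)) (simp_all del: ev.simps)
      have 2: "ev w s' (Num 3 [+] vnn) = 3 + n * n" using 14 r(6) num b by (subst ev_arith(1)) (simp_all del: ev.simps)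
      have "ev w s' (Num 3 [+] vnn [+] vn [*] vngN) = 3 + n * n + n * (n * (g * ?N))"
        using 1 2 b by (subst ev_arith(1)) (simp_all del: ev.simps)
      then show ?thesis using 14 by (simp add: entry del: ev.simps)
    next
      case 15
      have "ev w s' (vg [+] Num (k + 2)) = g + (k + 2)" using 15 r(2) num fit_nd by (subst ev_arith(1)) (simp_all del: ev.simps)
      then show ?thesis using 15 by (simp add: entry del: ev.simps)
    qed
  qed
  have "mem (fold (step w) init_block s) = mem s \<and> (\<forall>j<15. reg (fold (step w) init_block s) (R + j) = vals ! j)"
    unfolding init_block_def by (rule fold_assigns) (rule eval)
  then show "ctx n g b (fold (step w) init_block s)" "mem (fold (step w) init_block s) = mem s"
    by (simp_all add: ctx_def vals_def)
qed

end

section \<open>Multi-word arithmetic\<close>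

lemma exec_fill:
  assumes "A \<notin> arrs x" "vars x \<subseteq> {..<z}" "i < z" "r < z" "i \<noteq> r" "reg s r < 2 ^ w" "w \<ge> 1"
  shows "\<exists>t s'. exec w (for_loop z i r [Sto A (Var i) x]) s t s' \<and>
    t \<le> (block_cost [Sto A (Var i) x] + 20) * (reg s r + 1) \<and>
    mem s' = (mem s)(A := (\<lambda>t. if t < reg s r then ev w (s\<lparr>reg := (reg s)(i := t)\<rparr>) x else mem s A t)) \<and>
    (\<forall>r'<z. r' \<noteq> i \<longrightarrow> reg s' r' = reg s r')"
proof -
  let ?cs = "[Sto A (Var i) x]"
  obtain t s' where *: "exec w (for_loop z i r ?cs) s t s'" "t \<le> (block_cost ?cs + 20) * (reg s r + 1)"
    "eqz z (iterate w i ?cs (reg s r) s) s'"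
    using exec_for_loop[of ?cs z i r s w] assms by auto
  have "mem s' = mem (iterate w i ?cs (reg s r) s)" "\<forall>r'<z. r' \<noteq> i \<longrightarrow> reg s' r' = reg s r'"
    using *(3) iterate_keeps_reg[of ?cs _ i w "reg s r" s] by (auto simp: eqz_def)
  with * show ?thesis unfolding iterate_fill[OF assms(1)] by blast
qed

definition number :: "nat \<Rightarrow> nat \<Rightarrow> (nat \<Rightarrow> nat) \<Rightarrow> nat" where
  "number w N h = (\<Sum>i<N. h i * 2 ^ (w * i))"

lemma number_cong: "(\<And>i. i < N \<Longrightarrow> h i = h' i) \<Longrightarrow> number w N h = number w N h'"
  by (simp add: number_def)

text \<open>The solver chooses how many digits it writes. Missing digits count as 0, and any digits
  from position \<open>N\<close> on must be 0 because the value is below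
  \<open>2 ^ (w * N)\<close>.\<close>

lemma number_output:
  assumes "output_value w s = v" "v < 2 ^ (w * N)"
  shows "number w N (\<lambda>i. if i < reg s 0 then mem s 1 i else 0) = v"
proof (cases "reg s 0 \<le> N")
  case True
  have "number w N (\<lambda>i. if i < reg s 0 then mem s 1 i else 0) = (\<Sum>i<reg s 0. mem s 1 i * 2 ^ (w * i))"
    unfolding number_def by (rule sum.mono_neutral_cong_right) (use True in auto)
  then show ?thesis using assms(1) by (simp add: output_value_def)
next
  case False
  have zero: "mem s 1 i = 0" if "N \<le> i" "i < reg s 0" for i
  proof (rule ccontr)
    assume "mem s 1 i \<noteq> 0"
    have "(2::nat) ^ (w * N) \<le> 2 ^ (w * i)" using that by (intro power_increasing) auto
    also have "\<dots> \<le> mem s 1 i * 2 ^ (w * i)" using \<open>mem s 1 i \<noteq> 0\<close> by simp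
    also have "\<dots> \<le> (\<Sum>i<reg s 0. mem s 1 i * 2 ^ (w * i))" using that by (intro member_le_sum) auto
    finally show False using assms by (simp add: output_value_def)
  qed
  have "(\<Sum>i<reg s 0. mem s 1 i * 2 ^ (w * i)) = number w N (\<lambda>i. if i < reg s 0 then mem s 1 i else 0)"
    unfolding number_def by (rule sum.mono_neutral_cong_right) (use False zero in auto)
  then show ?thesis using assms(1) by (simp add: output_value_def)
qed

text \<open>Carries are detected by comparison: a wrapped sum is smaller than its operand. At most
  one of the two additions overflows, since after an overflow of \<open>x + y\<close> the rest is at
  most \<open>W - 2\<close> and absorbs \<open>c\<close>.\<close>

lemma add_digits:
  fixes x y c W :: nat
  assumes "x < W" "y < W" "c \<le> 1" "W \<ge> 2"
  defines "t \<equiv> (x + y) mod W" and "q \<equiv> ((x + y) mod W + c) mod W"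
  shows "q + W * (of_bool (t < x) + of_bool (q < t)) = x + y + c" "of_bool (t < x) + of_bool (q < t) \<le> (1::nat)"
proof -
  have t: "t = (if x + y < W then x + y else x + y - W)"
    using assms(1,2) by (simp add: t_def mod_if)
  have q: "q = (if t + c < W then t + c else t + c - W)"
    unfolding q_def t_def[symmetric] using assms(3,4) t assms(1,2) by (auto simp: mod_if)
  show "q + W * (of_bool (t < x) + of_bool (q < t)) = x + y + c" "of_bool (t < x) + of_bool (q < t) \<le> (1::nat)"
    using assms(1-4) by (auto simp: q t of_bool_def split: if_splits)
qed

section \<open>Addition and short division of multi-word numbers\<close>

context program
begin

text \<open>The new digit is stored last, because the carry test still compares with the old one.
  Beyond the solver's digit count, array 1 may hold garbage and is read as 0.\<close>

definition add_body :: "stmt list" where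
  "add_body =
     [Asg (R + 17) (Ld (A + 1) vi [+] Ite (vi [<] Var 0) (Ld 1 vi) (Num 0)),
      Asg (R + 18) (vt [+] vc),
      Asg (R + 16) ((vt [<] Ld (A + 1) vi) [+] (vq [<] vt)),
      Sto (A + 1) vi vq]"

lemma add_body_ok: "\<forall>c\<in>set add_body. stmt_ok z c"
  using R1 by (auto simp: add_body_def)

lemma add_body_keeps:
  "r \<noteq> R + 16 \<Longrightarrow> r \<noteq> R + 17 \<Longrightarrow> r \<noteq> R + 18 \<Longrightarrow> \<forall>c\<in>set add_body. keeps_reg r c"
  "A' \<noteq> A + 1 \<Longrightarrow> \<forall>c\<in>set add_body. keeps_array A' c"
  by (auto simp: add_body_def)

lemma step_add_body:
  assumes w: "w \<ge> 1" and c: "reg s (R + 16) \<le> 1"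
    and j: "reg s (R + 15) = j" and y: "y = (if j < reg s 0 then mem s 1 j else 0)"
    and x: "x = mem s (A + 1) j" and less: "x < 2 ^ w" "y < 2 ^ w"
  defines "s' \<equiv> fold (step w) add_body s"
  shows "mem s' (A + 1) = (mem s (A + 1))(j := mem s' (A + 1) j)"
    "mem s' (A + 1) j + 2 ^ w * reg s' (R + 16) = x + y + reg s (R + 16)" "reg s' (R + 16) \<le> 1"
proof -
  define t where "t = (x + y) mod 2 ^ w"
  define q where "q = (t + reg s (R + 16)) mod 2 ^ w"
  have W: "(2::nat) \<le> 2 ^ w" using w power_increasing[of 1 w "2::nat"] by simp
  have d: "of_bool (t < x) + of_bool (q < t) \<le> (1::nat)" "q + 2 ^ w * (of_bool (t < x) + of_bool (q < t)) = x + y + reg s (R + 16)"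
    using add_digits[OF less c W] by (simp_all add: t_def q_def)
  have sum: "(of_bool (t < x) + of_bool (q < t)) mod 2 ^ w = (of_bool (t < x) + of_bool (q < t) :: nat)"
    using d(1) W by simp
  have ite: "ev w s (Ite (vi [<] Var 0) (Ld 1 vi) (Num 0)) = y"
    using ev_test[OF w] j y by (simp del: ev.simps add: ev.simps(1,2,4,5))
  define s1 where "s1 = s\<lparr>reg := (reg s)(R + 17 := t)\<rparr>"
  have 1: "step w (Asg (R + 17) (Ld (A + 1) vi [+] Ite (vi [<] Var 0) (Ld 1 vi) (Num 0))) s = s1"
    unfolding step.simps ev.simps(3) ite binop_val.simps s1_def t_def using j x by simp
  define s2 where "s2 = s1\<lparr>reg := (reg s1)(R + 18 := q)\<rparr>"
  have 2: "step w (Asg (R + 18) (vt [+] vc)) s1 = s2"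
    by (simp add: s2_def s1_def q_def)
  define s3 where "s3 = s2\<lparr>reg := (reg s2)(R + 16 := of_bool (t < x) + of_bool (q < t))\<rparr>"
  have e1: "ev w s2 (vt [<] Ld (A + 1) vi) = of_bool (t < x)" using ev_test(1)[OF w] j x by (simp del: ev.simps add: ev.simps(1,2,4) s2_def s1_def)
  have e2: "ev w s2 (vq [<] vt) = of_bool (q < t)" using ev_test(1)[OF w] by (simp del: ev.simps add: ev.simps(1,2,4) s2_def s1_def)
  have 3: "step w (Asg (R + 16) ((vt [<] Ld (A + 1) vi) [+] (vq [<] vt))) s2 = s3"
    unfolding step.simps ev.simps(3)[of w s2 Add] e1 e2 binop_val.simps sum s3_def ..
  have 4: "s' = s3\<lparr>mem := (mem s3)(A + 1 := (mem s3 (A + 1))(j := q))\<rparr>"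
    unfolding s'_def add_body_def fold_simps 1 2 3 using j by (simp add: s3_def s2_def s1_def)
  show "mem s' (A + 1) = (mem s (A + 1))(j := mem s' (A + 1) j)"
    by (simp add: 4 s3_def s2_def s1_def)
  show "mem s' (A + 1) j + 2 ^ w * reg s' (R + 16) = x + y + reg s (R + 16)" "reg s' (R + 16) \<le> 1"
    using d by (simp_all add: 4 s3_def)
qed

lemma iterate_add:
  assumes w: "w \<ge> 1" and words: "words w s" and c: "reg s (R + 16) = 0"
  shows "reg (iterate w (R + 15) add_body j s) (R + 16) \<le> 1 \<and>
    (\<forall>i\<ge>j. mem (iterate w (R + 15) add_body j s) (A + 1) i = mem s (A + 1) i) \<and>
    number w j (mem (iterate w (R + 15) add_body j s) (A + 1)) + reg (iterate w (R + 15) add_body j s) (R + 16) * 2 ^ (w * j) =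
    number w j (mem s (A + 1)) + number w j (\<lambda>i. if i < reg s 0 then mem s 1 i else 0)"
proof (induction j)
  case 0
  show ?case using c by (simp add: number_def)
next
  case (Suc j)
  define s1 where "s1 = iterate w (R + 15) add_body j s"
  define s2 where "s2 = fold (step w) add_body s1"
  have R0: "R \<noteq> 0" using R1 by simp
  have r0: "reg s1 0 = reg s 0" unfolding s1_def by (rule iterate_keeps_reg[OF add_body_keeps(1)]) (use R0 in auto)
  have m1: "mem s1 1 = mem s 1" unfolding s1_def by (rule iterate_keeps_array[OF add_body_keeps(2)]) (use A2 in auto)
  have IH: "reg s1 (R + 16) \<le> 1" "\<forall>i\<ge>j. mem s1 (A + 1) i = mem s (A + 1) i"
    "number w j (mem s1 (A + 1)) + reg s1 (R + 16) * 2 ^ (w * j) =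
      number w j (mem s (A + 1)) + number w j (\<lambda>i. if i < reg s 0 then mem s 1 i else 0)"
    using Suc.IH unfolding s1_def by blast+
  define x y where "x = mem s (A + 1) j" and "y = (if j < reg s 0 then mem s 1 j else 0)"
  have less: "x < 2 ^ w" "y < 2 ^ w" using words by (auto simp: words_def x_def y_def)
  have j1: "reg s1 (R + 15) = j" by (simp add: s1_def iterate_index)
  have y1: "y = (if j < reg s1 0 then mem s1 1 j else 0)" by (simp only: y_def r0 m1)
  have x1: "x = mem s1 (A + 1) j" using IH(2) by (simp add: x_def)
  note st = step_add_body[OF w IH(1) j1 y1 x1 less, folded s2_def]
  have it: "reg (iterate w (R + 15) add_body (Suc j) s) (R + 16) = reg s2 (R + 16)"
    "mem (iterate w (R + 15) add_body (Suc j) s) = mem s2"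
    by (simp_all add: Let_def s2_def s1_def)
  have low: "number w j (mem s2 (A + 1)) = number w j (mem s1 (A + 1))"
    by (rule number_cong) (subst st(1), simp)
  have high: "\<forall>i\<ge>Suc j. mem s2 (A + 1) i = mem s (A + 1) i"
    by (subst st(1)) (use IH(2) in auto)
  have S: "number w (Suc j) h = number w j h + h j * 2 ^ (w * j)" for h by (simp add: number_def)
  let ?P = "2 ^ (w * j) :: nat"
  have "number w (Suc j) (mem s2 (A + 1)) + reg s2 (R + 16) * 2 ^ (w * Suc j) =
      number w j (mem s1 (A + 1)) + (mem s2 (A + 1) j + 2 ^ w * reg s2 (R + 16)) * ?P"
    unfolding S low by (simp add: power_add algebra_simps)
  also have "\<dots> = number w j (mem s1 (A + 1)) + reg s1 (R + 16) * ?P + (x + y) * ?P"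
    unfolding st(2) by (simp add: algebra_simps)
  also have "\<dots> = number w (Suc j) (mem s (A + 1)) + number w (Suc j) (\<lambda>i. if i < reg s 0 then mem s 1 i else 0)"
    unfolding IH(3) S by (simp add: algebra_simps x_def y_def)
  finally show ?case unfolding it using high st(3) by blast
qed

definition add_com :: com where
  "add_com = Seq (comp_block z [Asg (R + 16) (Num 0)]) (for_loop z (R + 15) (R + 14) add_body)"

definition add_cost :: nat where
  "add_cost = block_cost [Asg (R + 16) (Num 0)] + block_cost add_body + 20"

lemma exec_add_com:
  assumes w: "w \<ge> 1" and words: "words w s" and N: "reg s (R + 14) = N"
    and v: "number w N (mem s (A + 1)) + number w N (\<lambda>i. if i < reg s 0 then mem s 1 i else 0) = v" "v < 2 ^ (w * N)"
  shows "\<exists>t s'. exec w add_com s t s' \<and> t \<le> add_cost * (N + 1) \<and> number w N (mem s' (A + 1)) = v \<and>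
    (\<forall>A'. A' \<noteq> A + 1 \<longrightarrow> mem s' A' = mem s A') \<and> (\<forall>r<R + 15. reg s' r = reg s r)"
proof -
  have "\<forall>c\<in>set [Asg (R + 16) (Num 0)]. stmt_ok z c" by simp
  from exec_block[OF this] obtain t1 s1 where 1: "exec w (comp_block z [Asg (R + 16) (Num 0)]) s t1 s1"
    "t1 \<le> block_cost [Asg (R + 16) (Num 0)]" "eqz z (fold (step w) [Asg (R + 16) (Num 0)] s) s1" by blast
  have s1: "mem s1 = mem s" "reg s1 (R + 16) = 0" "\<forall>r<R + 15. reg s1 r = reg s r"
    using 1(3) by (auto simp: eqz_def)
  have r0: "reg s1 0 = reg s 0" using s1(3) by simp
  have words1: "words w s1" using exec_words[OF 1(1) words] .
  have N1: "reg s1 (R + 14) = N" using s1(3) N by simp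
  have "\<exists>t s'. exec w (for_loop z (R + 15) (R + 14) add_body) s1 t s' \<and>
      t \<le> (block_cost add_body + 20) * (reg s1 (R + 14) + 1) \<and>
      eqz z (iterate w (R + 15) add_body (reg s1 (R + 14)) s1) s'"
    by (rule exec_for_loop[OF add_body_ok _ _ _ add_body_keeps(1) add_body_keeps(1) _ w])
      (use words1 in \<open>auto simp: words_def\<close>)
  then obtain t2 s2 where 2: "exec w (for_loop z (R + 15) (R + 14) add_body) s1 t2 s2"
    "t2 \<le> (block_cost add_body + 20) * (N + 1)" "eqz z (iterate w (R + 15) add_body N s1) s2"
    unfolding N1 by blast
  let ?s = "iterate w (R + 15) add_body N s1"
  have inv: "number w N (mem ?s (A + 1)) + reg ?s (R + 16) * 2 ^ (w * N) = v"
    using iterate_add[OF w words1 s1(2), of N, unfolded s1(1) r0] v(1) by simp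
  \<comment> \<open>A carry out of the top digit would make the total at least
    \<open>2 ^ (w * N)\<close>.\<close>
  then have "reg ?s (R + 16) = 0" using v(2) by (cases "reg ?s (R + 16)") auto
  with inv have "number w N (mem s2 (A + 1)) = v" using 2(3) by (simp add: eqz_def)
  moreover have "mem s2 A' = mem s A'" if "A' \<noteq> A + 1" for A'
    using 2(3) iterate_keeps_array[OF add_body_keeps(2)[OF that]] s1(1) by (simp add: eqz_def)
  moreover have "reg s2 r = reg s r" if "r < R + 15" for r
    using 2(3) iterate_keeps_reg[OF add_body_keeps(1)[of r]] s1(3) that by (simp add: eqz_def)
  moreover have "exec w add_com s (t1 + t2) s2" unfolding add_com_def by (rule exec.Seq[OF 1(1) 2(1)])
  moreover have "t1 + t2 \<le> add_cost * (N + 1)"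
    using 1(2) 2(2) by (simp add: add_cost_def algebra_simps)
  ultimately show ?thesis by blast
qed

text \<open>Schoolbook division from the top digit down, with the remainder in
  \<open>R + 16\<close>. The two-digit dividend \<open>r * 2 ^ w + t\<close> is no word, so
  registers \<open>R + 18\<close> and \<open>R + 19\<close> hold \<open>q0\<close> and
  \<open>r0\<close> with \<open>2 ^ w = fact k * q0 + r0\<close>, and the quotient digit is
  assembled from them.\<close>

definition div_body :: "stmt list" where
  "div_body =
     (let D = Num (fact k); j = Var (R + 14) [-] Num 1 [-] vi; c = vc [*] vr [+] vt [mod] D
      in [Asg (R + 17) (Ld (A + 1) j),
          Sto 1 j (vc [*] vq [+] vt [div] D [+] c [div] D),
          Asg (R + 16) (c [mod] D)])"

lemma div_body_ok: "\<forall>c\<in>set div_body. stmt_ok z c"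
  by (auto simp: div_body_def Let_def)

lemma div_body_keeps:
  "r \<noteq> R + 16 \<Longrightarrow> r \<noteq> R + 17 \<Longrightarrow> \<forall>c\<in>set div_body. keeps_reg r c"
  "A' \<noteq> 1 \<Longrightarrow> \<forall>c\<in>set div_body. keeps_array A' c"
  by (auto simp: div_body_def Let_def)

text \<open>Substituting for \<open>W\<close> gives
  \<open>r * W + t = D * (r * q0 + t div D) + (r * r0 + t mod D)\<close>. Only the last bracket
  remains to be divided; its bound \<open>2 * (D * D)\<close> is the origin of
  \<open>fit_fact\<close>.\<close>

lemma div_digit:
  fixes W D q0 r0 r t :: nat
  assumes "W = D * q0 + r0" "r < D" "t < W" "r0 \<le> D"
  defines "c \<equiv> r * r0 + t mod D" and "d \<equiv> r * q0 + t div D + (r * r0 + t mod D) div D"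
  shows "D * d + c mod D = r * W + t" "d < W" "c < 2 * (D * D)"
proof -
  have D: "D > 0" using assms(2) by simp
  have "D * d + c mod D = D * (r * q0) + D * (t div D) + (D * (c div D) + c mod D)"
    by (simp add: d_def c_def algebra_simps)
  also have "\<dots> = D * (r * q0) + r * r0 + (D * (t div D) + t mod D)"
    unfolding mult_div_mod_eq by (simp add: c_def)
  also have "\<dots> = r * W + t" by (simp add: assms(1) algebra_simps)
  finally show eq: "D * d + c mod D = r * W + t" .
  have "r * W + t < D * W" using assms(2,3) by (rule mult_add_less)
  then have "D * d < D * W" using eq by linarith
  then show "d < W" by simp
  have "r * r0 \<le> D * D" using assms(2,4) by (intro mult_le_mono) auto
  moreover have "t mod D < D" "D \<le> D * D" using D by auto
  ultimately show "c < 2 * (D * D)" unfolding c_def by linarith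
qed

lemma step_div_body:
  assumes w: "w \<ge> 1" and fit: "2 * (fact k * fact k) < (2::nat) ^ w"
    and N: "reg s (R + 14) = N" "N < 2 ^ w" and j: "reg s (R + 15) = j" "j < N"
    and q0: "reg s (R + 18) = q0" and r0: "reg s (R + 19) = r0" "r0 \<le> fact k"
    and W: "2 ^ w = fact k * q0 + r0"
    and r: "reg s (R + 16) < fact k" and t: "t = mem s (A + 1) (N - Suc j)" "t < 2 ^ w"
  defines "s' \<equiv> fold (step w) div_body s"
  shows "mem s' 1 = (mem s 1)(N - Suc j := mem s' 1 (N - Suc j))"
    "fact k * mem s' 1 (N - Suc j) + reg s' (R + 16) = reg s (R + 16) * 2 ^ w + t" "reg s' (R + 16) < fact k"
proof -
  define D where "D = (fact k :: nat)"
  define c where "c = reg s (R + 16) * r0 + t mod D"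
  define d where "d = reg s (R + 16) * q0 + t div D + c div D"
  have "(1::nat) \<le> D" by (simp add: D_def)
  then have DD: "D \<le> D * D" by simp
  then have DW: "D < 2 ^ w" using fit unfolding D_def[symmetric] by linarith
  have dd: "D * d + c mod D = reg s (R + 16) * 2 ^ w + t" "d < 2 ^ w" "c < 2 * (D * D)"
    unfolding c_def d_def using div_digit[OF W r t(2) r0(2)] by (simp_all add: D_def)
  have cW: "c < 2 ^ w" using dd(3) fit unfolding D_def by linarith
  have num: "ev w s'' (Num (fact k)) = D" "ev w s'' (Num 1) = 1" for s''
    using DW w one_less_power[of "2::nat" w] by (simp_all add: D_def)
  let ?j = "Var (R + 14) [-] Num 1 [-] vi"
  have ej: "ev w s'' ?j = N - Suc j" if "reg s'' (R + 14) = N" "reg s'' (R + 15) = j" for s''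
  proof -
    have "ev w s'' (Var (R + 14) [-] Num 1) = N - 1"
      using that N(2) j(2) num(2) by (subst ev_arith(3)) (auto simp del: ev.simps simp add: ev.simps(2))
    then show ?thesis using that N(2) j(2) by (subst ev_arith(3)) (auto simp del: ev.simps simp add: ev.simps(2))
  qed
  define s1 where "s1 = s\<lparr>reg := (reg s)(R + 17 := t)\<rparr>"
  have 1: "step w (Asg (R + 17) (Ld (A + 1) ?j)) s = s1"
    unfolding step.simps ev.simps(4) ej[OF N(1) j(1)] s1_def t(1) ..
  have regs1: "ev w s1 vc = reg s (R + 16)" "ev w s1 vr = r0" "ev w s1 vq = q0" "ev w s1 vt = t"
    using q0 r0 by (simp_all add: s1_def)
  have j1: "ev w s1 ?j = N - Suc j" by (rule ej) (simp_all add: s1_def N j)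
  let ?c = "vc [*] vr [+] vt [mod] Num (fact k)"
  have ec: "ev w s'' ?c = c" if "ev w s'' vc = reg s (R + 16)" "ev w s'' vr = r0" "ev w s'' vt = t" for s''
  proof -
    have "ev w s'' (vc [*] vr) = reg s (R + 16) * r0"
      using that cW unfolding c_def by (subst ev_arith(2)) (auto simp del: ev.simps)
    moreover have "ev w s'' (vt [mod] Num (fact k)) = t mod D" using that num by (simp del: ev.simps add: ev.simps(3))
    ultimately show ?thesis using cW unfolding c_def by (subst ev_arith(1)) (auto simp del: ev.simps)
  qed
  have c1: "ev w s1 ?c = c" using regs1 by (intro ec)
  have "ev w s1 (vc [*] vq) = reg s (R + 16) * q0"
    using regs1 dd(2) unfolding d_def by (subst ev_arith(2)) (auto simp del: ev.simps)
  moreover have "ev w s1 (vt [div] Num (fact k)) = t div D" using regs1 num by (simp del: ev.simps add: ev.simps(3))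
  ultimately have "ev w s1 (vc [*] vq [+] vt [div] Num (fact k)) = reg s (R + 16) * q0 + t div D"
    using dd(2) unfolding d_def by (subst ev_arith(1)) (auto simp del: ev.simps)
  moreover have "ev w s1 (?c [div] Num (fact k)) = c div D" using c1 num by (simp del: ev.simps add: ev.simps(3))
  ultimately have ed: "ev w s1 (vc [*] vq [+] vt [div] Num (fact k) [+] ?c [div] Num (fact k)) = d"
    using dd(2) unfolding d_def by (subst ev_arith(1)) (auto simp del: ev.simps)
  define s2 where "s2 = s1\<lparr>mem := (mem s1)(1 := (mem s1 1)(N - Suc j := d))\<rparr>"
  have 2: "step w (Sto 1 ?j (vc [*] vq [+] vt [div] Num (fact k) [+] ?c [div] Num (fact k))) s1 = s2"
    unfolding step.simps ed j1 s2_def ..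
  have "ev w s2 ?c = c" by (rule ec) (simp_all add: s2_def s1_def r0)
  then have "ev w s2 (?c [mod] Num (fact k)) = c mod D" using num by (simp del: ev.simps add: ev.simps(3))
  then have 3: "step w (Asg (R + 16) (?c [mod] Num (fact k))) s2 = s2\<lparr>reg := (reg s2)(R + 16 := c mod D)\<rparr>"
    by (simp del: ev.simps)
  have s': "s' = s2\<lparr>reg := (reg s2)(R + 16 := c mod D)\<rparr>"
    unfolding s'_def div_body_def Let_def fold_simps 1 2 3 ..
  show "mem s' 1 = (mem s 1)(N - Suc j := mem s' 1 (N - Suc j))" by (simp add: s' s2_def s1_def)
  show "fact k * mem s' 1 (N - Suc j) + reg s' (R + 16) = reg s (R + 16) * 2 ^ w + t"
    using dd(1) by (simp add: s' s2_def D_def)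
  show "reg s' (R + 16) < fact k" by (simp add: s' D_def)
qed

text \<open>The value of the \<open>j\<close> most significant of \<open>N\<close> digits, the part
  of the dividend or quotient already processed by the division.\<close>

definition top_number :: "nat \<Rightarrow> nat \<Rightarrow> nat \<Rightarrow> (nat \<Rightarrow> nat) \<Rightarrow> nat" where
  "top_number w N j h = (\<Sum>i<j. h (N - j + i) * 2 ^ (w * i))"

lemma top_number_Suc:
  assumes "j < N"
  shows "top_number w N (Suc j) h = h (N - Suc j) + 2 ^ w * top_number w N j h"
proof -
  have eq: "N - Suc j + Suc i = N - j + i" for i using assms by simp
  show ?thesis
    unfolding top_number_def sum.lessThan_Suc_shift eq
    by (simp add: sum_distrib_left power_add algebra_simps)
qed

lemma iterate_div:
  assumes w: "w \<ge> 1" and fit: "2 * (fact k * fact k) < (2::nat) ^ w"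
    and N: "reg s (R + 14) = N" "N < 2 ^ w"
    and q0: "reg s (R + 18) = q0" and r0: "reg s (R + 19) = r0" "r0 \<le> fact k"
    and W: "2 ^ w = fact k * q0 + r0" and r: "reg s (R + 16) = 0" and words: "words w s" and j: "j \<le> N"
  shows "reg (iterate w (R + 15) div_body j s) (R + 16) < fact k \<and>
    fact k * top_number w N j (mem (iterate w (R + 15) div_body j s) 1) + reg (iterate w (R + 15) div_body j s) (R + 16) =
    top_number w N j (mem s (A + 1))"
  using j
proof (induction j)
  case 0
  show ?case using r by (simp add: top_number_def)
next
  case (Suc j)
  define s1 where "s1 = iterate w (R + 15) div_body j s"
  define s2 where "s2 = fold (step w) div_body s1"
  have keep: "reg s1 r = reg s r" if "r \<noteq> R + 16" "r \<noteq> R + 17" "r \<noteq> R + 15" for r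
    unfolding s1_def using div_body_keeps(1)[OF that(1,2)] that(3) by (rule iterate_keeps_reg)
  have m1: "mem s1 (A + 1) = mem s (A + 1)"
    unfolding s1_def by (rule iterate_keeps_array[OF div_body_keeps(2)]) (use A2 in auto)
  have j: "j < N" using Suc.prems by simp
  have IH: "reg s1 (R + 16) < fact k"
    "fact k * top_number w N j (mem s1 1) + reg s1 (R + 16) = top_number w N j (mem s (A + 1))"
    using Suc unfolding s1_def by auto
  define t where "t = mem s (A + 1) (N - Suc j)"
  have tl: "t < 2 ^ w" using words by (simp add: words_def t_def)
  have t1: "t = mem s1 (A + 1) (N - Suc j)" by (simp only: t_def m1)
  have "reg s1 (R + 14) = N" "reg s1 (R + 18) = q0" "reg s1 (R + 19) = r0" using keep N q0 r0 by auto
  moreover have "reg s1 (R + 15) = j" by (simp add: s1_def iterate_index)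
  ultimately have st: "mem s2 1 = (mem s1 1)(N - Suc j := mem s2 1 (N - Suc j))"
    "fact k * mem s2 1 (N - Suc j) + reg s2 (R + 16) = reg s1 (R + 16) * 2 ^ w + t" "reg s2 (R + 16) < fact k"
    unfolding s2_def using step_div_body[OF w fit _ N(2) _ j _ _ r0(2) W IH(1) t1 tl] by blast+
  have it: "reg (iterate w (R + 15) div_body (Suc j) s) (R + 16) = reg s2 (R + 16)"
    "mem (iterate w (R + 15) div_body (Suc j) s) = mem s2"
    by (simp_all add: Let_def s2_def s1_def)
  have low: "top_number w N j (mem s2 1) = top_number w N j (mem s1 1)"
    unfolding top_number_def by (rule sum.cong[OF refl]) (subst st(1), use j in auto)
  have "fact k * top_number w N (Suc j) (mem s2 1) + reg s2 (R + 16) =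
      (fact k * mem s2 1 (N - Suc j) + reg s2 (R + 16)) + 2 ^ w * (fact k * top_number w N j (mem s1 1))"
    unfolding top_number_Suc[OF j] low by (simp add: algebra_simps)
  also have "\<dots> = t + 2 ^ w * (fact k * top_number w N j (mem s1 1) + reg s1 (R + 16))"
    unfolding st(2) by (simp add: algebra_simps)
  also have "\<dots> = top_number w N (Suc j) (mem s (A + 1))"
    unfolding IH(2) top_number_Suc[OF j] t_def ..
  finally show ?case unfolding it using st(3) by blast
qed

text \<open>\<open>2 ^ w\<close> is not a word, so \<open>q0\<close> and \<open>r0\<close> come from
  the largest word \<open>2 ^ w - 1\<close>, obtained as 0 minus 1 with wraparound. The remainder
  plus 1 may be equal to \<open>fact k\<close>, whence \<open>r0 \<le> fact k\<close> and not a
  strict bound.\<close>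

definition div_init :: "stmt list" where
  "div_init =
     [Asg (R + 18) ((Num 0 [-] Num 1) [div] Num (fact k)),
      Asg (R + 19) ((Num 0 [-] Num 1) [mod] Num (fact k) [+] Num 1),
      Asg (R + 16) (Num 0)]"

definition finish_count :: com where
  "finish_count = Seq (comp_block z div_init)
     (Seq (for_loop z (R + 15) (R + 14) div_body) (comp_block z [Asg 0 (Var (R + 14))]))"

definition finish_count_cost :: nat where
  "finish_count_cost = block_cost div_init + block_cost div_body + 20 + block_cost [Asg 0 (Var (R + 14))]"

lemma exec_finish_count:
  assumes w: "w \<ge> 1" and fit: "2 * (fact k * fact k) < (2::nat) ^ w" and words: "words w s"
    and N: "reg s (R + 14) = N" and v: "number w N (mem s (A + 1)) = fact k * v"
  shows "\<exists>t s'. exec w finish_count s t s' \<and> t \<le> finish_count_cost * (N + 1) \<and> output_value w s' = v"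
proof -
  define D where "D = (fact k :: nat)"
  have D1: "1 \<le> D" by (simp add: D_def)
  then have "D \<le> D * D" by simp
  then have DW: "D < 2 ^ w" using fit unfolding D_def[symmetric] by linarith
  have one: "(1::nat) < 2 ^ w" using w by (intro one_less_power) auto
  have NW: "N < 2 ^ w" using words N by (auto simp: words_def)
  have "\<forall>c\<in>set div_init. stmt_ok z c" by (auto simp: div_init_def)
  from exec_block[OF this] obtain t1 s1 where 1: "exec w (comp_block z div_init) s t1 s1"
    "t1 \<le> block_cost div_init" "eqz z (fold (step w) div_init s) s1" by blast
  define q0 r0 where "q0 = (2 ^ w - 1) div D" and "r0 = (2 ^ w - 1) mod D + 1"
  have r0: "r0 \<le> D" using mod_less_divisor[of D "2 ^ w - 1"] D1 unfolding r0_def by linarith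
  have W: "2 ^ w = D * q0 + r0" using mult_div_mod_eq[of D "2 ^ w - 1"] one by (simp add: q0_def r0_def)
  have m1: "ev w s'' (Num 0 [-] Num 1) = 2 ^ w - 1" for s'' using one w by simp
  have num: "ev w s'' (Num (fact k)) = D" "ev w s'' (Num 1) = 1" for s'' using DW one w by (simp_all add: D_def)
  have q: "ev w s'' ((Num 0 [-] Num 1) [div] Num (fact k)) = q0" for s''
    unfolding ev.simps(3)[of w s'' Div] m1 num by (simp add: q0_def)
  have "ev w s'' ((Num 0 [-] Num 1) [mod] Num (fact k)) = (2 ^ w - 1) mod D" for s''
    unfolding ev.simps(3)[of w s'' Mod] m1 num by simp
  then have rr: "ev w s'' ((Num 0 [-] Num 1) [mod] Num (fact k) [+] Num 1) = r0" for s''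
    using r0 DW num unfolding r0_def by (subst ev_arith(1)) (auto simp del: ev.simps)
  have regs: "reg s1 (R + 18) = q0" "reg s1 (R + 19) = r0" "reg s1 (R + 16) = 0" "reg s1 (R + 14) = N" "mem s1 = mem s"
    using 1(3) q rr N unfolding div_init_def eqz_def by (simp_all del: ev.simps add: ev.simps(1))
  have words1: "words w s1" using exec_words[OF 1(1) words] .
  have "\<exists>t s'. exec w (for_loop z (R + 15) (R + 14) div_body) s1 t s' \<and>
      t \<le> (block_cost div_body + 20) * (reg s1 (R + 14) + 1) \<and>
      eqz z (iterate w (R + 15) div_body (reg s1 (R + 14)) s1) s'"
    by (rule exec_for_loop[OF div_body_ok _ _ _ div_body_keeps(1) div_body_keeps(1) _ w])
      (use words1 in \<open>auto simp: words_def\<close>)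
  then obtain t2 s2 where 2: "exec w (for_loop z (R + 15) (R + 14) div_body) s1 t2 s2"
    "t2 \<le> (block_cost div_body + 20) * (N + 1)" "eqz z (iterate w (R + 15) div_body N s1) s2"
    unfolding regs(4) by blast
  let ?s = "iterate w (R + 15) div_body N s1"
  have top: "top_number w N N h = number w N h" for h by (simp add: top_number_def number_def)
  have inv: "reg ?s (R + 16) < D" "D * number w N (mem ?s 1) + reg ?s (R + 16) = D * v"
    using iterate_div[OF w fit regs(4) NW regs(1,2) r0[unfolded D_def] W[unfolded D_def] regs(3) words1, of N] v regs(5)
    by (simp_all add: top D_def)
  \<comment> \<open>The final remainder is below \<open>D\<close> and congruent to the multiple
    \<open>D * v\<close>, hence 0.\<close>
  have "reg ?s (R + 16) = (D * number w N (mem ?s 1) + reg ?s (R + 16)) mod D" using inv(1) by simp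
  then have "reg ?s (R + 16) = 0" unfolding inv(2) by simp
  with inv(2) D1 have val: "number w N (mem s2 1) = v" using 2(3) by (simp add: eqz_def)
  have N2: "reg s2 (R + 14) = N"
    using 2(3) iterate_keeps_reg[OF div_body_keeps(1)[of "R + 14"], of "R + 15" w N s1] regs(4) by (simp add: eqz_def)
  have "\<forall>c\<in>set [Asg 0 (Var (R + 14))]. stmt_ok z c" by simp
  from exec_block[OF this] obtain t3 s3 where 3: "exec w (comp_block z [Asg 0 (Var (R + 14))]) s2 t3 s3"
    "t3 \<le> block_cost [Asg 0 (Var (R + 14))]" "eqz z (fold (step w) [Asg 0 (Var (R + 14))] s2) s3" by blast
  have "output_value w s3 = v" using 3(3) N2 val by (simp add: eqz_def output_value_def number_def)
  moreover have "exec w finish_count s (t1 + (t2 + t3)) s3"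
    unfolding finish_count_def by (rule exec.Seq[OF 1(1) exec.Seq[OF 2(1) 3(1)]])
  moreover have "t1 + (t2 + t3) \<le> finish_count_cost * (N + 1)"
    using 1(2) 2(2) 3(2) by (simp add: finish_count_cost_def algebra_simps)
  ultimately show ?thesis by blast
qed

text \<open>The lowest digit decides, as a sum of constantly many bits fits into one word.\<close>

definition finish_decide :: com where
  "finish_decide = comp_block z [Sto 1 (Num 0) (Ite (Ld (A + 1) (Num 0)) (Num 1) (Num 0)), Asg 0 (Num 1)]"

definition finish_decide_cost :: nat where
  "finish_decide_cost = block_cost [Sto 1 (Num 0) (Ite (Ld (A + 1) (Num 0)) (Num 1) (Num 0)), Asg 0 (Num 1)]"

lemma exec_finish_decide:
  assumes w: "w \<ge> 1" and v: "number w N (mem s (A + 1)) = v" "v < 2 ^ w" and N: "N \<ge> 1" and words: "words w s"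
  shows "\<exists>t s'. exec w finish_decide s t s' \<and> t \<le> finish_decide_cost \<and> output_value w s' = of_bool (v > 0)"
proof -
  let ?b = "[Sto 1 (Num 0) (Ite (Ld (A + 1) (Num 0)) (Num 1) (Num 0)), Asg 0 (Num 1)]"
  have one: "(1::nat) < 2 ^ w" using w by (intro one_less_power) auto
  obtain N' where N': "N = Suc N'" using N by (cases N) auto
  have "number w N (mem s (A + 1)) = mem s (A + 1) 0 + 2 ^ w * (\<Sum>i<N'. mem s (A + 1) (Suc i) * 2 ^ (w * i))"
    unfolding number_def N' sum.lessThan_Suc_shift by (simp add: sum_distrib_left power_add algebra_simps)
  moreover have "mem s (A + 1) 0 < 2 ^ w" using words by (simp add: words_def)
  ultimately have "v mod 2 ^ w = mem s (A + 1) 0" using v(1) by (metis mod_less mod_mult_self2)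
  then have m0: "mem s (A + 1) 0 = v" using v(2) by simp
  have "\<forall>c\<in>set ?b. stmt_ok z c" by simp
  from exec_block[OF this] obtain t s' where *: "exec w (comp_block z ?b) s t s'"
    "t \<le> block_cost ?b" "eqz z (fold (step w) ?b s) s'" by blast
  have "reg s' 0 = 1" "mem s' 1 0 = of_bool (v > 0)" using *(3) m0 one w by (auto simp: eqz_def)
  then have "output_value w s' = of_bool (v > 0)" by (simp add: output_value_def)
  with * show ?thesis unfolding finish_decide_def finish_decide_cost_def by blast
qed

end

section \<open>The reduction program\<close>

context program
begin

text \<open>The input is copied because the solver expects its own instance in array 0; the
  accumulator \<open>A + 1\<close> is cleared because storage is initially arbitrary.\<close>

definition setup_com :: com where
  "setup_com = Seq (comp_block z init_block)
     (Seq (for_loop z (R + 15) (R + 12) [Sto A vi (Ld 0 vi)]) (for_loop z (R + 15) (R + 14) [Sto (A + 1) vi (Num 0)]))"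

definition setup_cost :: nat where
  "setup_cost = block_cost init_block + (block_cost [Sto A vi (Ld 0 vi)] + 20) + (block_cost [Sto (A + 1) vi (Num 0)] + 20)"

definition round_com :: "com \<Rightarrow> nat list \<Rightarrow> com" where
  "round_com c a = Seq (for_loop z (R + 15) (R + 13) [Sto 0 vi (cell a)]) (Seq c add_com)"

definition round_cost :: "nat list \<Rightarrow> nat" where
  "round_cost a = block_cost [Sto 0 vi (cell a)] + 20 + add_cost + 1"

definition rounds_com :: "com \<Rightarrow> nat list list \<Rightarrow> com" where
  "rounds_com c as = foldr (\<lambda>a. Seq (round_com c a)) as Skip"

end

context reduction
begin

abbreviation "nd \<equiv> g + (k + 2)"
abbreviation "len' \<equiv> 3 + n * n + n * (n * (g * 2 ^ (l * b)))"

lemma exec_setup: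
  assumes s: "input_state w xs s"
  shows "\<exists>t s'. exec w setup_com s t s' \<and> t \<le> setup_cost * (length xs + nd + 1) \<and> ready s' \<and> words w s' \<and>
    number w nd (mem s' (A + 1)) = 0"
proof -
  have words: "words w s" using s by (simp add: input_state_words)
  obtain t1 s1 where 1: "exec w (comp_block z init_block) s t1 s1"
    "t1 \<le> block_cost init_block" "eqz z (fold (step w) init_block s) s1"
    using exec_block[OF init_block_ok] by blast
  have c1: "ctx n g b s1" by (rule ctx_cong[OF init_ctx(1)[OF s]]) (use 1(3) in \<open>auto simp: eqz_def\<close>)
  have m1: "mem s1 = mem s" using init_ctx(2)[OF s] 1(3) by (simp add: eqz_def)
  have words1: "words w s1" using exec_words[OF 1(1) words] .
  have r12: "reg s1 (R + 12) = length xs" using ctxD(13)[OF c1] length_xs by simp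
  obtain t2 s2 where 2: "exec w (for_loop z (R + 15) (R + 12) [Sto A vi (Ld 0 vi)]) s1 t2 s2"
    "t2 \<le> (block_cost [Sto A vi (Ld 0 vi)] + 20) * (length xs + 1)"
    "mem s2 = (mem s1)(A := (\<lambda>t. if t < length xs then ev w (s1\<lparr>reg := (reg s1)(R + 15 := t)\<rparr>) (Ld 0 vi) else mem s1 A t))"
    "\<forall>r'<z. r' \<noteq> R + 15 \<longrightarrow> reg s2 r' = reg s1 r'"
    using exec_fill[of A "Ld 0 vi" z "R + 15" "R + 12" s1 w] A2 w1 length_xs_less unfolding r12 by auto
  have words2: "words w s2" using exec_words[OF 2(1) words1] .
  have c2: "ctx n g b s2" by (rule ctx_cong[OF c1]) (use 2(4) in auto)
  have m2: "mem s2 A i = xs ! i" if "i < length xs" for i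
    using that s m1 by (simp add: 2(3) input_state_def)
  have r14: "reg s2 (R + 14) = nd" using ctxD(15)[OF c2] .
  obtain t3 s3 where 3: "exec w (for_loop z (R + 15) (R + 14) [Sto (A + 1) vi (Num 0)]) s2 t3 s3"
    "t3 \<le> (block_cost [Sto (A + 1) vi (Num 0)] + 20) * (nd + 1)"
    "mem s3 = (mem s2)(A + 1 := (\<lambda>t. if t < nd then ev w (s2\<lparr>reg := (reg s2)(R + 15 := t)\<rparr>) (Num 0) else mem s2 (A + 1) t))"
    "\<forall>r'<z. r' \<noteq> R + 15 \<longrightarrow> reg s3 r' = reg s2 r'"
    using exec_fill[of "A + 1" "Num 0" z "R + 15" "R + 14" s2 w] w1 fit_nd unfolding r14 by auto
  have words3: "words w s3" using exec_words[OF 3(1) words2] .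
  have c3: "ctx n g b s3" by (rule ctx_cong[OF c2]) (use 3(4) in auto)
  have "ready s3" using c3 m2 by (simp add: ready_def 3(3))
  moreover have "number w nd (mem s3 (A + 1)) = 0" by (simp add: number_def 3(3))
  moreover have "exec w setup_com s (t1 + (t2 + t3)) s3"
    unfolding setup_com_def by (rule exec.Seq[OF 1(1) exec.Seq[OF 2(1) 3(1)]])
  moreover have "t1 + (t2 + t3) \<le> setup_cost * (length xs + nd + 1)"
  proof -
    let ?a = "block_cost init_block" and ?b = "block_cost [Sto A vi (Ld 0 vi)] + 20"
      and ?c = "block_cost [Sto (A + 1) vi (Num 0)] + 20" and ?L = "length xs + nd + 1"
    have "t1 \<le> ?a * ?L" using 1(2) by (metis le_trans mult_le_mono2 le_add2 nat_mult_1_right)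
    moreover have "t2 \<le> ?b * ?L" by (rule le_trans[OF 2(2)], rule mult_le_mono2) simp
    moreover have "t3 \<le> ?c * ?L" by (rule le_trans[OF 3(2)], rule mult_le_mono2) simp
    ultimately show ?thesis unfolding setup_cost_def distrib_right by linarith
  qed
  ultimately show ?thesis using words3 by blast
qed

end

text \<open>\<open>h\<close> is the identity for counting and the indicator of positivity for
  deciding; \<open>T\<close> is the time bound at the given \<open>n\<close>.\<close>

locale solver_reduction = reduction +
  fixes c :: com and h :: "nat \<Rightarrow> nat" and T :: nat
  assumes solver_regs: "used_regs c \<subseteq> {..<R}" and solver_arrays: "used_arrays c \<subseteq> {..<A}"
    and solver: "\<And>E e s. factored_graph n g (l * b) E e \<Longrightarrow> input_state w (enc_graph n g (l * b) E e) s \<Longrightarrow>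
      \<exists>t s'. exec w c s t s' \<and> t \<le> T \<and> output_value w s' = h (clique_count k n g (zero_sum (l * b)) E e)"
begin

abbreviation "answer a \<equiv> h (clique_count k n g (zero_sum (l * b)) (Ea a) (ea a))"

lemma exec_round:
  assumes s: "ready s" "words w s" and a: "a \<in> tuples"
    and v: "number w nd (mem s (A + 1)) + answer a = v" "v < 2 ^ (w * nd)"
  shows "\<exists>t s'. exec w (round_com c a) s t s' \<and> t \<le> round_cost a * (len' + T + nd + 1) \<and> ready s' \<and> words w s' \<and>
    number w nd (mem s' (A + 1)) = v"
proof -
  have r13: "reg s (R + 13) = len'" using ctxD(14)[OF ready_regs[OF s(1)]] .
  have lenW: "len' < 2 ^ w" using fit_len by linarith
  obtain t1 s1 where 1: "exec w (for_loop z (R + 15) (R + 13) [Sto 0 vi (cell a)]) s t1 s1"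
    "t1 \<le> (block_cost [Sto 0 vi (cell a)] + 20) * (len' + 1)"
    "mem s1 = (mem s)(0 := (\<lambda>t. if t < len' then ev w (s\<lparr>reg := (reg s)(R + 15 := t)\<rparr>) (cell a) else mem s 0 t))"
    "\<forall>r'<z. r' \<noteq> R + 15 \<longrightarrow> reg s1 r' = reg s r'"
    using exec_fill[OF arrs_cell vars_cell, of "R + 15" "R + 13" s w a] w1 lenW unfolding r13 by auto
  have words1: "words w s1" using exec_words[OF 1(1) s(2)] .
  have c1: "ctx n g b s1" by (rule ctx_cong[OF ready_regs[OF s(1)]]) (use 1(4) in auto)
  have A0: "A \<noteq> 0" using A2 by simp
  have m1: "mem s1 A' = mem s A'" if "A' \<noteq> 0" for A' using that by (simp add: 1(3))
  have cells: "mem s1 0 t = enc_graph n g (l * b) (Ea a) (ea a) ! t" if t: "t < len'" for t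
  proof -
    let ?s = "s\<lparr>reg := (reg s)(R + 15 := t)\<rparr>"
    have "ready ?s" using s(1) ctx_cong[OF ready_regs[OF s(1)], of ?s] by (simp add: ready_def)
    from ev_cell[OF this a _ t] show ?thesis using t by (simp add: 1(3))
  qed
  have fg: "factored_graph n g (l * b) (Ea a) (ea a)" by (rule red_factored_graph[OF k3 graph refl])
  \<comment> \<open>Cells beyond the new instance may contain remains of earlier rounds:
    \<open>input_state\<close> only asks that they be words.\<close>
  have inp: "input_state w (enc_graph n g (l * b) (Ea a) (ea a)) s1"
    unfolding input_state_words using words1 cells by (simp add: length_enc_graph)
  from solver[OF fg inp] obtain t2 s2 where 2: "exec w c s1 t2 s2" "t2 \<le> T" "output_value w s2 = answer a" by blast
  have words2: "words w s2" using exec_words[OF 2(1) words1] .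
  have c2: "ctx n g b s2" by (rule ctx_cong[OF c1]) (use exec_frame(1)[OF 2(1)] solver_regs in force)
  have m2: "mem s2 A' = mem s A'" if "A \<le> A'" for A'
    using exec_frame(2)[OF 2(1), of A'] solver_arrays that m1[of A'] A0 by force
  have r14: "reg s2 (R + 14) = nd" using ctxD(15)[OF c2] .
  have "answer a < 2 ^ (w * nd)" using v by linarith
  from number_output[OF 2(3) this]
  have "number w nd (mem s2 (A + 1)) + number w nd (\<lambda>i. if i < reg s2 0 then mem s2 1 i else 0) = v"
    using v(1) m2[of "A + 1"] by simp
  from exec_add_com[OF w1 words2 r14 this v(2)] obtain t3 s3 where 3: "exec w add_com s2 t3 s3" "t3 \<le> add_cost * (nd + 1)"
    "number w nd (mem s3 (A + 1)) = v" "\<forall>A'. A' \<noteq> A + 1 \<longrightarrow> mem s3 A' = mem s2 A'" "\<forall>r<R + 15. reg s3 r = reg s2 r" by blast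
  have "ready s3"
    unfolding ready_def using ctx_cong[OF c2, of s3] 3(4,5) m2[of A] ready_mem[OF s(1)] by simp
  moreover have "words w s3" using exec_words[OF 3(1) words2] .
  moreover have "exec w (round_com c a) s (t1 + (t2 + t3)) s3"
    unfolding round_com_def by (rule exec.Seq[OF 1(1) exec.Seq[OF 2(1) 3(1)]])
  moreover have "t1 + (t2 + t3) \<le> round_cost a * (len' + T + nd + 1)"
  proof -
    let ?L = "len' + T + nd + 1" and ?b = "block_cost [Sto 0 vi (cell a)] + 20"
    have "t1 \<le> ?b * ?L" by (rule le_trans[OF 1(2)], rule mult_le_mono2) simp
    moreover have "t2 \<le> 1 * ?L" using 2(2) by simp
    moreover have "t3 \<le> add_cost * ?L" by (rule le_trans[OF 3(2)], rule mult_le_mono2) simp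
    ultimately show ?thesis unfolding round_cost_def distrib_right by linarith
  qed
  ultimately show ?thesis using 3(3) by blast
qed

lemma exec_rounds:
  assumes "ready s" "words w s" "set as \<subseteq> tuples"
    "number w nd (mem s (A + 1)) + sum_list (map answer as) = v" "v < 2 ^ (w * nd)"
  shows "\<exists>t s'. exec w (rounds_com c as) s t s' \<and> t \<le> (sum_list (map round_cost as) + 1) * (len' + T + nd + 1) \<and>
    ready s' \<and> words w s' \<and> number w nd (mem s' (A + 1)) = v"
  using assms
proof (induction as arbitrary: s)
  case Nil
  have "exec w (rounds_com c []) s 1 s" by (simp add: rounds_com_def exec.Skip[simplified])
  then show ?case using Nil by (intro exI[of _ 1] exI[of _ s]) simp
next
  case (Cons a as)
  have "number w nd (mem s (A + 1)) + answer a < 2 ^ (w * nd)" using Cons.prems(4,5) by simp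
  from exec_round[OF Cons.prems(1,2) _ refl this] Cons.prems(3)
  obtain t1 s1 where 1: "exec w (round_com c a) s t1 s1" "t1 \<le> round_cost a * (len' + T + nd + 1)" "ready s1" "words w s1"
    "number w nd (mem s1 (A + 1)) = number w nd (mem s (A + 1)) + answer a" by auto
  have "number w nd (mem s1 (A + 1)) + sum_list (map answer as) = v" using Cons.prems(4) 1(5) by simp
  from Cons.IH[OF 1(3,4) _ this Cons.prems(5)] Cons.prems(3)
  obtain t2 s2 where 2: "exec w (rounds_com c as) s1 t2 s2" "t2 \<le> (sum_list (map round_cost as) + 1) * (len' + T + nd + 1)"
    "ready s2" "words w s2" "number w nd (mem s2 (A + 1)) = v" by auto
  have "exec w (rounds_com c (a # as)) s (t1 + t2) s2" using exec.Seq[OF 1(1) 2(1)] by (simp add: rounds_com_def)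
  moreover have "t1 + t2 \<le> (sum_list (map round_cost (a # as)) + 1) * (len' + T + nd + 1)"
    using 1(2) 2(2) unfolding list.map sum_list.Cons add.assoc distrib_right[of "round_cost a"] by linarith
  ultimately show ?case using 2 by blast
qed

text \<open>The origin of \<open>g + (k + 2)\<close>: one word for each of the \<open>k\<close>
  factors \<open>n\<close>, one for each of the \<open>g\<close> factors \<open>2 ^ (l * b)\<close>,
  one for \<open>fact k\<close>, and one spare.\<close>

lemma count_sum_less:
  "fact k * clique_count k n g f E e < 2 ^ (w * nd)"
proof -
  have "clique_count k n g f E e \<le> n ^ k * ((2 ^ b) ^ l) ^ g" by (rule clique_count_bound[OF graph])
  also have "\<dots> \<le> (2 ^ w) ^ k * (2 ^ w) ^ g"
  proof (rule mult_le_mono)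
    have "n \<le> (2 * k + 1) * (n + 1)" by simp
    then have "n \<le> 2 ^ w" using fit_src by linarith
    then show "n ^ k \<le> (2 ^ w) ^ k" by (intro power_mono) auto
    have "((2::nat) ^ b) ^ l = 2 ^ (l * b)" by (simp add: power_mult[symmetric] mult.commute)
    then have "((2::nat) ^ b) ^ l \<le> 2 ^ w" using fit_len by linarith
    then show "((2 ^ b) ^ l) ^ g \<le> ((2::nat) ^ w) ^ g" by (intro power_mono) auto
  qed
  finally have "fact k * clique_count k n g f E e \<le> fact k * ((2 ^ w) ^ k * (2 ^ w) ^ g)" by (rule mult_le_mono2)
  also have "\<dots> < 2 ^ w * ((2 ^ w) ^ k * (2 ^ w) ^ g)"
  proof -
    have "(1::nat) \<le> fact k" by simp
    then have "(fact k :: nat) \<le> fact k * fact k" by simp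
    then have "fact k < (2::nat) ^ w" using fit_fact by linarith
    then show ?thesis by simp
  qed
  also have "\<dots> = 2 ^ (w * (g + (k + 1)))" by (simp add: power_add[symmetric] power_mult[symmetric] algebra_simps)
  also have "\<dots> \<le> 2 ^ (w * nd)" by (intro power_increasing) auto
  finally show ?thesis .
qed

text \<open>\<open>F\<close> turns the accumulated sum into the answer: by division when counting,
  by a test for 0 when deciding.\<close>

lemma exec_main:
  assumes s: "input_state w xs s" and as: "set as = tuples" "distinct as"
    and less: "(\<Sum>a\<in>tuples. answer a) < 2 ^ (w * nd)"
    and fin: "\<And>s. words w s \<Longrightarrow> reg s (R + 14) = nd \<Longrightarrow> number w nd (mem s (A + 1)) = (\<Sum>a\<in>tuples. answer a) \<Longrightarrow>
      \<exists>t s'. exec w F s t s' \<and> t \<le> K * (nd + 1) \<and> output_value w s' = v"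
  shows "\<exists>t s'. exec w (Seq setup_com (Seq (rounds_com c as) F)) s t s' \<and>
    t \<le> (setup_cost + (sum_list (map round_cost as) + 1) + K) * (len' + 2 ^ (l * b) + T + nd + 1) \<and> output_value w s' = v"
proof -
  let ?L = "len' + 2 ^ (l * b) + T + nd + 1" and ?rc = "sum_list (map round_cost as) + 1"
  obtain t1 s1 where 1: "exec w setup_com s t1 s1" "t1 \<le> setup_cost * (length xs + nd + 1)" "ready s1" "words w s1"
    "number w nd (mem s1 (A + 1)) = 0"
    using exec_setup[OF s] by blast
  have "sum_list (map answer as) = (\<Sum>a\<in>tuples. answer a)"
    using sum_list_distinct_conv_sum_set[OF as(2)] by (simp add: as(1))
  then have "number w nd (mem s1 (A + 1)) + sum_list (map answer as) = (\<Sum>a\<in>tuples. answer a)" using 1(5) by simp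
  from exec_rounds[OF 1(3,4) _ this less] as(1) obtain t2 s2 where 2: "exec w (rounds_com c as) s1 t2 s2"
    "t2 \<le> ?rc * (len' + T + nd + 1)" "ready s2" "words w s2" "number w nd (mem s2 (A + 1)) = (\<Sum>a\<in>tuples. answer a)"
    by blast
  from fin[OF 2(4) ctxD(15)[OF ready_regs[OF 2(3)]] 2(5)] obtain t3 s3 where 3: "exec w F s2 t3 s3"
    "t3 \<le> K * (nd + 1)" "output_value w s3 = v" by blast
  have "exec w (Seq setup_com (Seq (rounds_com c as) F)) s (t1 + (t2 + t3)) s3"
    by (rule exec.Seq[OF 1(1) exec.Seq[OF 2(1) 3(1)]])
  moreover have "t1 + (t2 + t3) \<le> (setup_cost + ?rc + K) * ?L"
  proof -
    have "length xs + nd + 1 \<le> ?L" using off_le length_xs by linarith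
    then have "t1 \<le> setup_cost * ?L" by (rule le_trans[OF 1(2) mult_le_mono2])
    moreover have "t2 \<le> ?rc * ?L" by (rule le_trans[OF 2(2)], rule mult_le_mono2) simp
    moreover have "t3 \<le> K * ?L" by (rule le_trans[OF 3(2)], rule mult_le_mono2) simp
    ultimately show ?thesis unfolding distrib_right by linarith
  qed
  ultimately show ?thesis using 3(3) by blast
qed

lemma exec_main_count:
  assumes "h = (\<lambda>x. x)" "input_state w xs s" "set as = tuples" "distinct as"
  shows "\<exists>t s'. exec w (Seq setup_com (Seq (rounds_com c as) finish_count)) s t s' \<and>
    t \<le> (setup_cost + (sum_list (map round_cost as) + 1) + finish_count_cost) * (len' + 2 ^ (l * b) + T + nd + 1) \<and>
    output_value w s' = h (clique_count k n g f E e)"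
proof (rule exec_main[OF assms(2-4)])
  have sum: "(\<Sum>a\<in>tuples. answer a) = fact k * clique_count k n g f E e"
    using red_count[OF k3 graph refl, of f] by (simp add: assms(1))
  then show "(\<Sum>a\<in>tuples. answer a) < 2 ^ (w * nd)" using count_sum_less by simp
  fix s assume "words w s" "reg s (R + 14) = nd" "number w nd (mem s (A + 1)) = (\<Sum>a\<in>tuples. answer a)"
  then show "\<exists>t s'. exec w finish_count s t s' \<and> t \<le> finish_count_cost * (nd + 1) \<and>
      output_value w s' = h (clique_count k n g f E e)"
    unfolding sum unfolding assms(1) by (rule exec_finish_count[OF w1 fit_fact])
qed

lemma exec_main_decide:
  assumes "h = (\<lambda>x. of_bool (x > 0))" "input_state w xs s" "set as = tuples" "distinct as" "(2 * k) ^ k < 2 ^ w"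
  shows "\<exists>t s'. exec w (Seq setup_com (Seq (rounds_com c as) finish_decide)) s t s' \<and>
    t \<le> (setup_cost + (sum_list (map round_cost as) + 1) + finish_decide_cost) * (len' + 2 ^ (l * b) + T + nd + 1) \<and>
    output_value w s' = h (clique_count k n g f E e)"
proof (rule exec_main[OF assms(2-4)])
  let ?S = "\<Sum>a\<in>tuples. answer a" and ?C = "\<Sum>a\<in>tuples. clique_count k n g (zero_sum (l * b)) (Ea a) (ea a)"
  have sum: "?C = fact k * clique_count k n g f E e" by (rule red_count[OF k3 graph refl])
  have "?S \<le> ?C" by (rule sum_mono) (auto simp: assms(1))
  then show "?S < 2 ^ (w * nd)" using count_sum_less sum by linarith
  have fin: "finite tuples" by (rule finite_tuples)
  have "?S \<le> (\<Sum>a\<in>tuples. 1)" by (rule sum_mono) (auto simp: assms(1))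
  also have "\<dots> = (2 * k) ^ k" using card_lists_length_eq[of "{..<2 * k}" k] by (simp add: conj_commute)
  finally have SW: "?S < 2 ^ w" using assms(5) by linarith
  \<comment> \<open>All summands are natural numbers, so either sum vanishes exactly if every count
    does; no cancellation can hide a clique.\<close>
  have "?S > 0 \<longleftrightarrow> ?C > 0"
    using sum_nonneg_eq_0_iff[OF fin, of answer] sum_nonneg_eq_0_iff[OF fin, of "\<lambda>a. clique_count k n g (zero_sum (l * b)) (Ea a) (ea a)"]
    by (auto simp: assms(1) simp flip: neq0_conv)
  then have pos: "?S > 0 \<longleftrightarrow> clique_count k n g f E e > 0" by (simp add: sum)
  fix s assume *: "words w s" "number w nd (mem s (A + 1)) = ?S"
  have "nd \<ge> 1" by simp
  from exec_finish_decide[OF w1 *(2) SW this *(1)] obtain t s' where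
    t: "exec w finish_decide s t s'" "t \<le> finish_decide_cost" "output_value w s' = of_bool (?S > 0)" by blast
  have "t \<le> finish_decide_cost * (nd + 1)" using t(2) by simp
  moreover have "output_value w s' = h (clique_count k n g f E e)" using t(3) pos by (simp only: assms(1))
  ultimately show "\<exists>t s'. exec w finish_decide s t s' \<and> t \<le> finish_decide_cost * (nd + 1) \<and>
      output_value w s' = h (clique_count k n g f E e)"
    using t(1) by blast
qed

end

section \<open>Word size and running time\<close>

text \<open>The word size must suffice for every \<open>n\<close>, while the hypotheses on
  \<open>g\<close> and \<open>b\<close> are asymptotic. Finitely many exceptions are absorbed into
  the exponent, as the base \<open>n + 2\<close> is at least 2.\<close>

lemma eventually_le_imp_bound:
  fixes q :: "nat \<Rightarrow> nat"
  assumes "eventually (\<lambda>n. real (q n) \<le> real n + 2) sequentially"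
  shows "\<exists>p. \<forall>n. q n \<le> (n + 2) ^ p"
proof -
  from assms obtain N where N: "\<And>n. n \<ge> N \<Longrightarrow> real (q n) \<le> real n + 2"
    by (auto simp: eventually_sequentially)
  define p where "p = Suc (\<Sum>n<N. q n)"
  have "q n \<le> (n + 2) ^ p" for n
  proof (cases "n < N")
    case True
    then have "q n \<le> (\<Sum>n<N. q n)" by (intro member_le_sum) auto
    also have "\<dots> < p" by (simp add: p_def)
    also have "p < 2 ^ p" by (rule less_exp)
    also have "\<dots> \<le> (n + 2) ^ p" by (intro power_mono) auto
    finally show ?thesis by simp
  next
    case False
    then have "q n \<le> n + 2" using N[of n] by linarith
    also have "\<dots> \<le> (n + 2) ^ p" by (rule self_le_power) (auto simp: p_def)
    finally show ?thesis .
  qed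
  then show ?thesis by blast
qed

lemma power_le_word:
  assumes "real d * log 2 (real n + 2) \<le> real w"
  shows "(n + 2) ^ d \<le> (2::nat) ^ w"
proof -
  have "real ((n + 2) ^ d) = (real n + 2) powr real d" by (simp add: powr_realpow add.commute)
  also have "\<dots> = 2 powr (real d * log 2 (real n + 2))" by (simp add: powr_def log_def)
  also have "\<dots> \<le> 2 powr real w" using assms by simp
  also have "\<dots> = real (2 ^ w)" by (simp add: powr_realpow)
  finally show ?thesis by (simp only: of_nat_le_iff)
qed

context
  fixes g b :: "nat \<Rightarrow> nat"
  assumes g: "(\<lambda>n. real (g n)) \<in> o(\<lambda>n. log 2 (real n) / log 2 (log 2 (real n)))"
    and b: "(\<lambda>n. real (b n)) \<in> o(\<lambda>n. log 2 (real n))"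
begin

lemma eventually_g_le: "eventually (\<lambda>n. real (g n) \<le> ln (real n)) sequentially"
proof -
  have "eventually (\<lambda>n. norm (real (g n)) \<le> ln 2 * norm (log 2 (real n) / log 2 (log 2 (real n)))) sequentially"
    using landau_o.smallD[OF g, of "ln 2"] by simp
  then show ?thesis using eventually_ge_at_top[of 4]
  proof eventually_elim
    case (elim n)
    have "log 2 4 \<le> log 2 (real n)" using elim(2) by simp
    moreover have "log 2 (4::real) = 2" using log_pow_cancel[of 2 2] by simp
    ultimately have L: "2 \<le> log 2 (real n)" by simp
    then have "log 2 2 \<le> log 2 (log 2 (real n))" by (subst log_le_cancel_iff) auto
    then have LL: "1 \<le> log 2 (log 2 (real n))" by simp
    have "log 2 (real n) / log 2 (log 2 (real n)) \<le> log 2 (real n) / 1"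
      using L LL by (intro divide_left_mono) auto
    moreover have "real (g n) \<le> ln 2 * (log 2 (real n) / log 2 (log 2 (real n)))"
      using elim(1) L LL by simp
    moreover have "ln 2 * (log 2 (real n) / log 2 (log 2 (real n))) \<le> ln 2 * log 2 (real n)"
      using calculation(1) by (intro mult_left_mono) auto
    ultimately have "real (g n) \<le> ln 2 * log 2 (real n)" by linarith
    then show ?case by (simp add: log_def)
  qed
qed

lemma eventually_exp_b_le:
  fixes l :: nat
  assumes "l \<ge> 1"
  shows "eventually (\<lambda>n. real (2 ^ (l * b n)) \<le> real n) sequentially"
proof -
  \<comment> \<open>With the constant \<open>1 / l\<close>, the exponent \<open>l * b n\<close> is
    at most the binary logarithm of \<open>n\<close>.\<close>
  have "eventually (\<lambda>n. norm (real (b n)) \<le> 1 / real l * norm (log 2 (real n))) sequentially"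
    using landau_o.smallD[OF b, of "1 / real l"] assms by simp
  then show ?thesis using eventually_ge_at_top[of 1]
  proof eventually_elim
    case (elim n)
    have "0 \<le> log 2 (real n)" using elim(2) by simp
    then have "real (l * b n) \<le> log 2 (real n)" using elim(1) assms by (simp add: field_simps)
    then have "2 powr real (l * b n) \<le> 2 powr log 2 (real n)" by simp
    then show ?case using elim(2) by (simp add: powr_realpow del: of_nat_mult)
  qed
qed

lemma word_size_suffices:
  fixes K l :: nat
  assumes "l \<ge> 1"
  shows "\<exists>d. \<forall>n w. real d * log 2 (real n + 2) \<le> real w \<longrightarrow> K * ((n + 2) ^ 2 * ((g n + 1) * 2 ^ (l * b n))) < 2 ^ w"
proof -
  have "eventually (\<lambda>n. real (g n) \<le> real n + 2) sequentially"
    using eventually_g_le eventually_ge_at_top[of 1]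
  proof eventually_elim
    case (elim n)
    have "ln (real n) \<le> real n - 1" using elim(2) by (intro ln_le_minus_one) auto
    then show ?case using elim(1) by linarith
  qed
  from eventually_le_imp_bound[OF this] obtain p where p: "\<And>n. g n \<le> (n + 2) ^ p" by blast
  have "eventually (\<lambda>n. real (2 ^ (l * b n)) \<le> real n + 2) sequentially"
    using eventually_exp_b_le[OF assms] by eventually_elim linarith
  from eventually_le_imp_bound[OF this] obtain q where q: "\<And>n. 2 ^ (l * b n) \<le> (n + 2) ^ q" by blast
  \<comment> \<open>The exponents of the four factors, using
    \<open>K \<le> 2 ^ K \<le> (n + 2) ^ K\<close>, plus 1 for strictness.\<close>
  let ?d = "K + (2 + ((p + 1) + q)) + 1"
  have "K * ((n + 2) ^ 2 * ((g n + 1) * 2 ^ (l * b n))) < 2 ^ w" if w: "real ?d * log 2 (real n + 2) \<le> real w" for n w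
  proof -
    have "K \<le> 2 ^ K" by (simp add: less_imp_le)
    also have "\<dots> \<le> (n + 2) ^ K" by (intro power_mono) auto
    finally have K: "K \<le> (n + 2) ^ K" .
    have "1 \<le> (n + 2) ^ p" by simp
    then have "g n + 1 \<le> 2 * (n + 2) ^ p" using p[of n] by linarith
    also have "\<dots> \<le> (n + 2) * (n + 2) ^ p" by (intro mult_le_mono1) simp
    finally have G: "g n + 1 \<le> (n + 2) ^ (p + 1)" by simp
    have "K * ((n + 2) ^ 2 * ((g n + 1) * 2 ^ (l * b n))) \<le> (n + 2) ^ K * ((n + 2) ^ 2 * ((n + 2) ^ (p + 1) * (n + 2) ^ q))"
      by (intro mult_le_mono K G q le_refl)
    also have "\<dots> = (n + 2) ^ (K + (2 + ((p + 1) + q)))" by (simp only: power_add)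
    also have "\<dots> < (n + 2) ^ ?d" by (rule power_strict_increasing) auto
    also have "\<dots> \<le> 2 ^ w" using w by (rule power_le_word)
    finally show ?thesis .
  qed
  then show ?thesis by blast
qed

end

text \<open>Counting and deciding are treated together, with \<open>h\<close> as in
  \<open>solver_reduction\<close>.\<close>

definition zero_clique_problem :: "(nat \<Rightarrow> nat) \<Rightarrow> nat \<Rightarrow> (nat \<Rightarrow> nat) \<Rightarrow> (nat \<Rightarrow> nat) \<Rightarrow> problem" where
  "zero_clique_problem h k g b n =
     {(enc_graph n (g n) (b n) E e, h (clique_count k n (g n) (zero_sum (b n)) E e)) | E e.
        factored_graph n (g n) (b n) E e}"

definition fun_clique_problem ::
  "(nat \<Rightarrow> nat) \<Rightarrow> nat \<Rightarrow> (nat \<Rightarrow> nat) \<Rightarrow> (nat \<Rightarrow> nat) \<Rightarrow> (nat \<Rightarrow> nat list \<Rightarrow> bool) \<Rightarrow> problem" where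
  "fun_clique_problem h k g b f n =
     {(enc_graph n (g n) (b n) E e @ enc_fun k (b n) (f n), h (clique_count k n (g n) (f n) E e)) | E e.
        factored_graph n (g n) (b n) E e}"

definition work :: "nat \<Rightarrow> nat \<Rightarrow> nat \<Rightarrow> nat \<Rightarrow> nat \<Rightarrow> nat" where
  "work k n g b T = 3 + n * n + n * (n * (g * 2 ^ ((k choose 2) * b))) + 2 ^ ((k choose 2) * b) + T + (g + (k + 2)) + 1"

lemma solvable_lower_bound:
  assumes k: "k \<ge> 3" and h: "\<And>x. x > 0 \<Longrightarrow> h x \<noteq> h 0" and g: "g n \<ge> 1"
    and solv: "solvable_in_time (zero_clique_problem h k g b) T"
  shows "((n - (k - 2)) choose 2) * 2 ^ b n \<le> T n"
proof -
  from solv obtain c d where cd: "\<And>n w xs a s. (xs, a) \<in> zero_clique_problem h k g b n \<Longrightarrow>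
      real d * log 2 (real n + 2) \<le> real w \<Longrightarrow> input_state w xs s \<Longrightarrow>
      \<exists>t s'. exec w c s t s' \<and> t \<le> T n \<and> output_value w s' = a"
    unfolding solvable_in_time_def by blast
  \<comment> \<open>\<open>T\<close> does not depend on the word size, so the bound may be proved
    for one large \<open>w\<close>: it meets the solver's requirement and holds \<open>n\<close>,
    \<open>g n\<close> and \<open>b n\<close>.\<close>
  define w where "w = nat \<lceil>real d * log 2 (real n + 2)\<rceil> + n + g n + b n + 1"
  have big: "real d * log 2 (real n + 2) \<le> real w" unfolding w_def by linarith
  have exp: "x < 2 ^ w" if "x \<le> w" for x :: nat using that less_exp[of w] by linarith
  show ?thesis
  proof (rule solver_time_lower_bound[OF k g, where h = h and c = c and w = w])
    show "\<And>x. x > 0 \<Longrightarrow> h x \<noteq> h 0" by (rule h)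
    show "n < 2 ^ w" "g n < 2 ^ w" "b n < 2 ^ w" by (rule exp, simp add: w_def)+
    show "w \<ge> 1" by (simp add: w_def)
    fix E e s assume "factored_graph n (g n) (b n) E e" "input_state w (enc_graph n (g n) (b n) E e) s"
    then show "\<exists>t s'. exec w c s t s' \<and> t \<le> T n \<and> output_value w s' = h (clique_count k n (g n) (zero_sum (b n)) E e)"
      by (intro cd big) (auto simp: zero_clique_problem_def)
  qed
qed

lemma time_in_soft_O:
  fixes g b T :: "nat \<Rightarrow> nat" and K k l :: nat
  assumes g: "(\<lambda>n. real (g n)) \<in> o(\<lambda>n. log 2 (real n) / log 2 (log 2 (real n)))"
    and b: "(\<lambda>n. real (b n)) \<in> o(\<lambda>n. log 2 (real n))" and l: "l \<ge> 1"
    and lower: "\<And>n. g n \<ge> 1 \<Longrightarrow> ((n - (k - 2)) choose 2) * 2 ^ (l * b n) \<le> T n"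
  shows "(\<lambda>n. real (K * (3 + n * n + n * (n * (g n * 2 ^ (l * b n))) + 2 ^ (l * b n) + T n + (g n + (k + 2)) + 1)))
    \<in> soft_O (\<lambda>n. real (T n) + (real n)\<^sup>2)"
proof -
  have "eventually (\<lambda>n. real (K * (3 + n * n + n * (n * (g n * 2 ^ (l * b n))) + 2 ^ (l * b n) + T n + (g n + (k + 2)) + 1))
      \<le> (real K * 20) * ((real (T n) + (real n)\<^sup>2) * ln (real n))) sequentially"
    using eventually_g_le[OF g b] eventually_exp_b_le[OF g b l] eventually_ge_at_top[of "2 * k + 6"]
  proof eventually_elim
    case (elim n)
    let ?N = "2 ^ (l * b n) :: nat"
    have n: "real n \<ge> 6" "n \<ge> 2 * k" using elim(3) by auto
    have "exp 1 \<le> real n" using exp_le n by linarith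
    then have ln1: "1 \<le> ln (real n)" using n by (subst ln_ge_iff) auto
    have sq: "real n \<le> (real n)\<^sup>2" using n by (simp add: power2_eq_square)
    have lnn: "ln (real n) \<le> real n" using ln_le_minus_one[of "real n"] n by linarith
    \<comment> \<open>The only term that may exceed \<open>n ^ 2\<close> up to constants and
      \<open>T\<close>. For \<open>g n > 0\<close> the lower bound gives
      \<open>n * n * 2 ^ (l * b n) \<le> 8 * T n\<close>: the \<open>x\<close> vertices outside the
      hubs satisfy \<open>n \<le> 2 * (x - 1)\<close>, and halving in the binomial coefficient costs
      another factor 2. One logarithm pays for \<open>g n\<close>.\<close>
    have cell: "real (n * (n * (g n * ?N))) \<le> 8 * (real (T n) * ln (real n))"
    proof (cases "g n = 0")
      case True
      then show ?thesis using ln1 by simp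
    next
      case False
      define x where "x = n - (k - 2)"
      have x: "n \<le> 2 * x" "n \<le> 2 * (x - 1)" using n(2) elim(3) by (auto simp: x_def)
      have "n * n \<le> (2 * x) * (2 * (x - 1))" using x by (rule mult_le_mono)
      also have "\<dots> = 8 * (x choose 2)"
      proof -
        have "even (x * (x - 1))" by (cases x) auto
        then show ?thesis by (simp add: choose_two) 
      qed
      finally have "n * n * ?N \<le> 8 * (x choose 2) * ?N" by (rule mult_le_mono1)
      also have "\<dots> \<le> 8 * T n" using lower[of n] False by (simp add: x_def)
      finally have "real (n * n * ?N) \<le> 8 * real (T n)" by linarith
      then have "real (n * n * ?N) * real (g n) \<le> 8 * real (T n) * ln (real n)"
        using elim(1) by (intro mult_mono) auto
      then show ?thesis by (simp add: algebra_simps)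
    qed
    let ?S = "(real (T n) + (real n)\<^sup>2) * ln (real n)"
    have S: "real (T n) * ln (real n) \<le> ?S" using ln1 by (simp add: algebra_simps)
    have "real (T n) \<le> real (T n) * ln (real n)" using mult_left_mono[OF ln1, of "real (T n)"] by simp
    moreover have S2: "(real n)\<^sup>2 \<le> (real n)\<^sup>2 * ln (real n)" using mult_left_mono[OF ln1, of "(real n)\<^sup>2"] by simp
    moreover have "?S = real (T n) * ln (real n) + (real n)\<^sup>2 * ln (real n)" by (simp add: algebra_simps)
    moreover have "0 \<le> real (T n) * ln (real n)" using ln1 by simp
    moreover have "0 \<le> (real n)\<^sup>2" by simp
    ultimately have parts: "real (T n) \<le> ?S" "(real n)\<^sup>2 \<le> ?S" by linarith+
    have "real (3 + n * n + n * (n * (g n * ?N)) + ?N + T n + (g n + (k + 2)) + 1) =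
        3 + (real n)\<^sup>2 + real (n * (n * (g n * ?N))) + real ?N + real (T n) + (real (g n) + (real k + 2)) + 1"
      by (simp add: power2_eq_square)
    also have "\<dots> \<le> 20 * ?S"
    proof -
      have "real k \<le> real n" using n(2) by simp
      then show ?thesis using cell S parts elim(1,2) sq lnn n(1) by linarith
    qed
    finally have "real K * real (3 + n * n + n * (n * (g n * ?N)) + ?N + T n + (g n + (k + 2)) + 1) \<le> real K * (20 * ?S)"
      by (intro mult_left_mono) auto
    then show ?case by (simp add: mult.assoc)
  qed
  then have "eventually (\<lambda>n. norm (real (K * (3 + n * n + n * (n * (g n * 2 ^ (l * b n))) + 2 ^ (l * b n) + T n + (g n + (k + 2)) + 1)))
      \<le> (real K * 20) * norm ((real (T n) + (real n)\<^sup>2) * ln (real n) ^ 1)) sequentially"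
    using eventually_ge_at_top[of 1]
  proof eventually_elim
    case (elim n)
    have "0 \<le> (real (T n) + (real n)\<^sup>2) * ln (real n)" using elim(2) by simp
    then show ?case using elim(1) by (simp only: real_norm_def power_one_right abs_of_nonneg abs_of_nat)
  qed
  then show ?thesis unfolding soft_O_def by (intro CollectI exI[of _ 1] bigoI)
qed

text \<open>The two versions differ in \<open>h\<close> and in the last step of the program, which
  enters through \<open>main\<close>. There \<open>P\<close> and \<open>K\<close> are chosen before
  \<open>n\<close>, \<open>w\<close> and the instance; this order makes the program uniform.\<close>

lemma solvable_transfer:
  fixes g b T :: "nat \<Rightarrow> nat" and f :: "nat \<Rightarrow> nat list \<Rightarrow> bool"
  assumes k: "k \<ge> 3"
    and g: "(\<lambda>n. real (g n)) \<in> o(\<lambda>n. log 2 (real n) / log 2 (log 2 (real n)))"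
    and b: "(\<lambda>n. real (b n)) \<in> o(\<lambda>n. log 2 (real n))"
    and h: "\<And>x. x > 0 \<Longrightarrow> h x \<noteq> h 0"
    and solv: "solvable_in_time (zero_clique_problem h k g (\<lambda>n. (k choose 2) * b n)) T"
    and main: "\<And>R A c. program k R A \<Longrightarrow> \<exists>P K. \<forall>n g b w E e f T s.
      solver_reduction k R A n g b w E e c h T \<longrightarrow> (2 * k) ^ k < 2 ^ w \<longrightarrow>
      input_state w (enc_graph n g b E e @ enc_fun k b f) s \<longrightarrow>
      (\<exists>t s'. exec w P s t s' \<and>
        t \<le> K * work k n g b T \<and>
        output_value w s' = h (clique_count k n g f E e))"
  shows "\<exists>T'. (\<lambda>n. real (T' n)) \<in> soft_O (\<lambda>n. real (T n) + (real n)\<^sup>2) \<and>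
    solvable_in_time (fun_clique_problem h k g b f) T'"
proof -
  let ?l = "k choose 2"
  have l: "?l \<ge> 1" using choose_two_ge[OF k] by simp
  from solv obtain c d where cd: "\<And>n w xs a s. (xs, a) \<in> zero_clique_problem h k g (\<lambda>n. ?l * b n) n \<Longrightarrow>
      real d * log 2 (real n + 2) \<le> real w \<Longrightarrow> input_state w xs s \<Longrightarrow>
      \<exists>t s'. exec w c s t s' \<and> t \<le> T n \<and> output_value w s' = a"
    unfolding solvable_in_time_def by blast
  \<comment> \<open>Bounds above every name in the solver; \<open>R\<close> also exceeds the output
    register 0, and \<open>A\<close> the input and output arrays 0 and 1.\<close>
  define R where "R = Suc (Max (insert 0 (used_regs c)))"
  define A where "A = Suc (Suc (Max (insert 0 (used_arrays c))))"
  have regs: "used_regs c \<subseteq> {..<R}"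
    using finite_used_regs[of c] by (auto simp: R_def less_Suc_eq_le intro: Max_ge)
  have arrays: "used_arrays c \<subseteq> {..<A}"
  proof
    fix x assume "x \<in> used_arrays c"
    then have "x \<le> Max (insert 0 (used_arrays c))" using finite_used_arrays[of c] by (intro Max_ge) auto
    then show "x \<in> {..<A}" by (simp add: A_def)
  qed
  have prog: "program k R A" by unfold_locales (use k in \<open>auto simp: R_def A_def\<close>)
  from main[OF prog, of c] obtain P K where PK: "\<And>n g b w E e f T s.
      solver_reduction k R A n g b w E e c h T \<Longrightarrow> (2 * k) ^ k < 2 ^ w \<Longrightarrow>
      input_state w (enc_graph n g b E e @ enc_fun k b f) s \<Longrightarrow>
      (\<exists>t s'. exec w P s t s' \<and>
        t \<le> K * work k n g b T \<and>
        output_value w s' = h (clique_count k n g f E e))"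
    by blast
  \<comment> \<open>Dominates every constant factor and every constant bound among the assumptions
    of \<open>reduction\<close>; the varying parts are at most
    \<open>(n + 2) ^ 2 * ((g n + 1) * 2 ^ (l * b n))\<close>.\<close>
  define C where "C = 8 + (2 * k + 2) + k * k + 2 * (fact k * fact k) + (2 * k) ^ k"
  from word_size_suffices[OF g b l, of C] obtain d' where
    d': "\<And>n w. real d' * log 2 (real n + 2) \<le> real w \<Longrightarrow> C * ((n + 2) ^ 2 * ((g n + 1) * 2 ^ (?l * b n))) < 2 ^ w" by blast
  define T' where "T' n = K * work k n (g n) (b n) (T n)" for n
  have "(\<lambda>n. real (T' n)) \<in> soft_O (\<lambda>n. real (T n) + (real n)\<^sup>2)"
    unfolding T'_def work_def by (rule time_in_soft_O[OF g b l], rule solvable_lower_bound[OF k _ _ solv])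
      (simp_all add: h)
  moreover have "solvable_in_time (fun_clique_problem h k g b f) T'"
    unfolding solvable_in_time_def
  \<comment> \<open>\<open>d\<close> is the word size demanded by the solver, \<open>d'\<close> the
    one that rules out overflow in the reduction.\<close>
  proof (rule exI[of _ P], rule exI[of _ "max d d'"], intro allI impI)
    fix n w xs a s
    assume xs: "(xs, a) \<in> fun_clique_problem h k g b f n" and w: "real (max d d') * log 2 (real n + 2) \<le> real w"
      and s: "input_state w xs s"
    from xs obtain E e where Ee: "xs = enc_graph n (g n) (b n) E e @ enc_fun k (b n) (f n)"
      "a = h (clique_count k n (g n) (f n) E e)" "factored_graph n (g n) (b n) E e"
      by (auto simp: fun_clique_problem_def)
    have "0 \<le> log 2 (real n + 2)" by simp
    then have "real d * log 2 (real n + 2) \<le> real (max d d') * log 2 (real n + 2)"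
      "real d' * log 2 (real n + 2) \<le> real (max d d') * log 2 (real n + 2)"
      by (auto intro!: mult_right_mono)
    then have wd: "real d * log 2 (real n + 2) \<le> real w" "real d' * log 2 (real n + 2) \<le> real w" using w by linarith+
    define N where "N = (2::nat) ^ (?l * b n)"
    define Q where "Q = (n + 2) ^ 2 * ((g n + 1) * N)"
    have N1: "1 \<le> N" by (simp add: N_def)
    have big: "C * Q < 2 ^ w" using d'[OF wd(2)] by (simp add: Q_def N_def)
    have gN: "N \<le> (g n + 1) * N" "g n + 1 \<le> (g n + 1) * N" "g n * N \<le> (g n + 1) * N"
      using mult_le_mono2[OF N1, of "g n + 1"] by auto
    have n2: "n * n + 2 * n + 4 \<le> (n + 2) ^ 2" by (simp add: power2_eq_square algebra_simps)
    then have "1 * ((g n + 1) * N) \<le> Q" unfolding Q_def by (intro mult_le_mono1) linarith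
    then have Q1: "N \<le> Q" "g n + 1 \<le> Q" "g n * N \<le> Q" "1 \<le> Q" using gN by linarith+
    have "(n + 2) ^ 2 * 1 \<le> Q" unfolding Q_def using N1 by (intro mult_le_mono2) simp
    then have Q2: "n * n \<le> Q" "n + 1 \<le> Q" using n2 by linarith+
    have "(n * n) * (g n * N) \<le> Q" unfolding Q_def using n2 gN(3) by (intro mult_le_mono) auto
    then have Q3: "n * (n * (g n * N)) \<le> Q" by (simp add: mult.assoc)
    have CQ: "c * Q \<le> C * Q" if "c \<le> C" for c using that by simp
    have le: "x < 2 ^ w" if "x \<le> c * Q" "c \<le> C" for x c using big CQ[OF that(2)] that(1) by linarith
    have const: "x < 2 ^ w" if "x \<le> C" for x using le[of x x] that Q1(4) by simp
    have "solver_reduction k R A n (g n) (b n) w E e c h (T n)"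
    proof (unfold_locales)
      show "3 \<le> k" "1 \<le> R" "2 \<le> A" using k by (auto simp: R_def A_def)
      show "factored_graph n (g n) (b n) E e" by (rule Ee(3))
      show "1 \<le> w"
      proof (rule ccontr)
        assume "\<not> 1 \<le> w"
        then have "w = 0" by simp
        then show False using const[of 1] by (simp add: C_def)
      qed
      show "3 + n * n + n * (n * (g n * 2 ^ (?l * b n))) + 2 ^ (?l * b n) < 2 ^ w"
        using Q1 Q2 Q3 unfolding N_def[symmetric] by (intro le[of _ 6]) (auto simp: C_def)
      show "g n * 2 ^ (?l * b n) < 2 ^ w"
        using Q1 unfolding N_def[symmetric] by (intro le[of _ 1]) (auto simp: C_def)
      show "(2 * k + 1) * (n + 1) < 2 ^ w"
        using Q2 by (intro le[of _ "2 * k + 1"] mult_le_mono) (auto simp: C_def)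
      show "k * k < 2 ^ w" by (rule const) (simp add: C_def)
      show "g n + (k + 2) < 2 ^ w"
      proof (rule le[of _ "k + 2"])
        have "(k + 1) * 1 \<le> (k + 1) * Q" using Q1(4) by (rule mult_le_mono2)
        then show "g n + (k + 2) \<le> (k + 2) * Q" using Q1(2) by simp
      qed (simp add: C_def)
      show "2 * (fact k * fact k) < (2::nat) ^ w" by (rule const) (simp add: C_def)
      show "used_regs c \<subseteq> {..<R}" "used_arrays c \<subseteq> {..<A}" by (rule regs arrays)+
      fix E e s assume "factored_graph n (g n) (?l * b n) E e" "input_state w (enc_graph n (g n) (?l * b n) E e) s"
      then show "\<exists>t s'. exec w c s t s' \<and> t \<le> T n \<and>
          output_value w s' = h (clique_count k n (g n) (zero_sum (?l * b n)) E e)"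
        by (intro cd wd(1)) (auto simp: zero_clique_problem_def)
    qed
    moreover have "(2 * k) ^ k < 2 ^ w" by (rule const) (simp add: C_def)
    ultimately show "\<exists>t s'. exec w P s t s' \<and> t \<le> T' n \<and> output_value w s' = a"
      unfolding T'_def Ee(2) by (rule PK) (use s Ee(1) in simp)
  qed
  ultimately show ?thesis by blast
qed

lemma ex_tuple_list: "\<exists>as. set as = {a. length a = k \<and> set a \<subseteq> {..<2 * k::nat}} \<and> distinct as"
  by (rule finite_distinct_list[OF finite_tuples])

theorem theorem1p10:
  fixes k :: nat
  assumes "k \<ge> 3"
  shows "\<exists>c\<ge>1. \<forall>(g :: nat \<Rightarrow> nat) (b :: nat \<Rightarrow> nat) (f :: nat \<Rightarrow> nat list \<Rightarrow> bool) (T :: nat \<Rightarrow> nat).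
    (\<lambda>n. real (g n)) \<in> o(\<lambda>n. log 2 (real n) / log 2 (log 2 (real n))) \<longrightarrow>
    (\<lambda>n. real (b n)) \<in> o(\<lambda>n. log 2 (real n)) \<longrightarrow>
    (solvable_in_time (FZkC k g (\<lambda>n. c * b n)) T \<longrightarrow>
      (\<exists>T'. (\<lambda>n. real (T' n)) \<in> soft_O (\<lambda>n. real (T n) + (real n)\<^sup>2) \<and>
            solvable_in_time (FfkC k g b f) T')) \<and>
    (solvable_in_time (count_FZkC k g (\<lambda>n. c * b n)) T \<longrightarrow>
      (\<exists>T'. (\<lambda>n. real (T' n)) \<in> soft_O (\<lambda>n. real (T n) + (real n)\<^sup>2) \<and>
            solvable_in_time (count_FfkC k g b f) T'))"
proof (intro exI[of _ "k choose 2"] conjI allI impI)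
  show "1 \<le> k choose 2" using choose_two_ge[OF assms] by simp
  \<comment> \<open>Depends on \<open>k\<close> alone, so the list can become part of the program
    text.\<close>
  obtain as where as: "set as = {a. length a = k \<and> set a \<subseteq> {..<2 * k}}" "distinct as"
    using ex_tuple_list[of k] by (elim exE conjE) (rule that)
  fix g b :: "nat \<Rightarrow> nat" and f :: "nat \<Rightarrow> nat list \<Rightarrow> bool" and T :: "nat \<Rightarrow> nat"
  assume g: "(\<lambda>n. real (g n)) \<in> o(\<lambda>n. log 2 (real n) / log 2 (log 2 (real n)))"
    and b: "(\<lambda>n. real (b n)) \<in> o(\<lambda>n. log 2 (real n))"
  let ?dec = "\<lambda>x::nat. of_bool (x > 0) :: nat"
  have dec: "FZkC k g b = zero_clique_problem ?dec k g b" "FfkC k g b f = fun_clique_problem ?dec k g b f" for g b f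
    by (auto simp: fun_eq_iff FZkC_def FfkC_def zero_clique_problem_def fun_clique_problem_def)
  have cnt: "count_FZkC k g b = zero_clique_problem (\<lambda>x. x) k g b"
    "count_FfkC k g b f = fun_clique_problem (\<lambda>x. x) k g b f" for g b f
    by (auto simp: fun_eq_iff count_FZkC_def count_FfkC_def zero_clique_problem_def fun_clique_problem_def)
  {
    assume "solvable_in_time (FZkC k g (\<lambda>n. (k choose 2) * b n)) T"
    then show "\<exists>T'. (\<lambda>n. real (T' n)) \<in> soft_O (\<lambda>n. real (T n) + (real n)\<^sup>2) \<and> solvable_in_time (FfkC k g b f) T'"
      unfolding dec
    proof (rule solvable_transfer[OF assms g b, rotated])
      fix R A c assume "program k R A"
      show "\<exists>P K. \<forall>n g b w E e f T s.
          solver_reduction k R A n g b w E e c ?dec T \<longrightarrow> (2 * k) ^ k < 2 ^ w \<longrightarrow>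
          input_state w (enc_graph n g b E e @ enc_fun k b f) s \<longrightarrow>
          (\<exists>t s'. exec w P s t s' \<and>
            t \<le> K * work k n g b T \<and>
            output_value w s' = ?dec (clique_count k n g f E e))"
        by (rule exI, rule exI, intro allI impI, unfold work_def, rule solver_reduction.exec_main_decide[OF _ refl _ as]) assumption+
    qed simp
  next
    assume "solvable_in_time (count_FZkC k g (\<lambda>n. (k choose 2) * b n)) T"
    then show "\<exists>T'. (\<lambda>n. real (T' n)) \<in> soft_O (\<lambda>n. real (T n) + (real n)\<^sup>2) \<and> solvable_in_time (count_FfkC k g b f) T'"
      unfolding cnt
    proof (rule solvable_transfer[OF assms g b, rotated])
      fix R A c assume "program k R A"
      show "\<exists>P K. \<forall>n g b w E e f T s.
          solver_reduction k R A n g b w E e c (\<lambda>x. x) T \<longrightarrow> (2 * k) ^ k < 2 ^ w \<longrightarrow>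
          input_state w (enc_graph n g b E e @ enc_fun k b f) s \<longrightarrow>
          (\<exists>t s'. exec w P s t s' \<and>
            t \<le> K * work k n g b T \<and>
            output_value w s' = clique_count k n g f E e)"
        by (rule exI, rule exI, intro allI impI, unfold work_def, rule solver_reduction.exec_main_count[OF _ refl _ as]) assumption+
    qed simp
  }
qed

end
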